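(* Let $p>1$ with $p\in(d/2,d]$, let $\gamma_+,\gamma_-\ge 0$ with $\gamma_++\gamma_->0$, and let $0<\lambda\le\Lambda$. Let $F:\mathcal{S}(d)\to\mathbb{R}$ be convex, with $F(0)=0$ and $$\lambda\|N\|\le F(M+N)-F(M)\le\Lambda\|N\|\quad\text{for all } M,N\in\mathcal{S}(d)\text{ with } N\ge 0.$$ Let $g\in W^{2,p}(B_1)$ be a nontrivial convex function, and set $$\mathcal{A}:=\{u\in W^{2,p}(B_1)\cap W^{1,p}_g(B_1)\;:\; u \text{ is convex}\}.$$ Then the functional $$I[u]:=\int_{B_1}[F(D^2u)]^p+\gamma_+\max(u,0)-\gamma_-\min(u,0)\,dx$$ admits a minimizer in $\mathcal{A}$; that is, there exists $u^*\in\mathcal{A}$ such that $I[u^*]\le I[u]$ for all $u\in\mathcal{A}$.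
   Context: $B_1$ is the open unit ball of $\mathbb{R}^d$ centered at the origin. $\mathcal{S}(d)$ is the space of real symmetric $d\times d$ matrices, with a matrix norm $\|\cdot\|$; $N\ge0$ means $N$ is nonnegative definite. For $g\in W^{2,p}(B_1)$, $u\in W^{2,p}(B_1)\cap W^{1,p}_g(B_1)$ means that $u\in W^{2,p}(B_1)$ and $u-g\in W^{1,p}_0(B_1)$. *)

theory Defs
  imports "HOL-Analysis.Analysis"
begin

text \<open>
  Members of the Lebesgue and Sobolev spaces below are represented by functions on the whole
  Euclidean space of which only the restriction to the open set \<open>\<Omega>\<close> matters.
  Multi-indices of order \<open>k\<close> are lists of \<open>k\<close> coordinate directions.
\<close>

primrec partial_deriv :: "'n list \<Rightarrow> (real ^ 'n \<Rightarrow> real) \<Rightarrow> real ^ 'n \<Rightarrow> real" where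
  "partial_deriv [] f = f"
| "partial_deriv (k # ks) f =
     (\<lambda>x. frechet_derivative (partial_deriv ks f) (at x) (axis k 1))"

text \<open>Differentiability of all iterated partial derivatives entails their continuity.\<close>

definition smooth :: "(real ^ 'n \<Rightarrow> real) \<Rightarrow> bool" where
  "smooth f \<longleftrightarrow> (\<forall>ks x. partial_deriv ks f differentiable (at x))"

definition test_function :: "(real ^ 'n) set \<Rightarrow> (real ^ 'n \<Rightarrow> real) \<Rightarrow> bool" where
  "test_function \<Omega> \<phi> \<longleftrightarrow>
     smooth \<phi> \<and> compact (closure {x. \<phi> x \<noteq> 0}) \<and> closure {x. \<phi> x \<noteq> 0} \<subseteq> \<Omega>"

definition Lp_space :: "(real ^ 'n) set \<Rightarrow> real \<Rightarrow> (real ^ 'n \<Rightarrow> real) set" where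
  "Lp_space \<Omega> p = {u. u \<in> borel_measurable (lebesgue_on \<Omega>) \<and>
     integrable (lebesgue_on \<Omega>) (\<lambda>x. \<bar>u x\<bar> powr p)}"

definition locally_integrable :: "(real ^ 'n) set \<Rightarrow> (real ^ 'n \<Rightarrow> real) \<Rightarrow> bool" where
  "locally_integrable \<Omega> u \<longleftrightarrow>
     (\<forall>K. compact K \<and> K \<subseteq> \<Omega> \<longrightarrow> u absolutely_integrable_on K)"

definition weak_deriv ::
    "(real ^ 'n) set \<Rightarrow> 'n list \<Rightarrow> (real ^ 'n \<Rightarrow> real) \<Rightarrow> (real ^ 'n \<Rightarrow> real) \<Rightarrow> bool" where
  "weak_deriv \<Omega> ks u v \<longleftrightarrow> locally_integrable \<Omega> u \<and> locally_integrable \<Omega> v \<and>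
     (\<forall>\<phi>. test_function \<Omega> \<phi> \<longrightarrow>
        (LINT x|lebesgue_on \<Omega>. u x * partial_deriv ks \<phi> x) =
        (- 1) ^ length ks * (LINT x|lebesgue_on \<Omega>. v x * \<phi> x))"

definition sobolev :: "(real ^ 'n) set \<Rightarrow> nat \<Rightarrow> real \<Rightarrow> (real ^ 'n \<Rightarrow> real) set" where
  "sobolev \<Omega> m p = {u \<in> Lp_space \<Omega> p.
     \<forall>ks. length ks \<le> m \<longrightarrow> (\<exists>v \<in> Lp_space \<Omega> p. weak_deriv \<Omega> ks u v)}"

text \<open>The weak derivative, chosen from its almost-everywhere class when it exists.\<close>

definition wderiv ::
    "(real ^ 'n) set \<Rightarrow> 'n list \<Rightarrow> (real ^ 'n \<Rightarrow> real) \<Rightarrow> real ^ 'n \<Rightarrow> real" where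
  "wderiv \<Omega> ks u = (SOME v. weak_deriv \<Omega> ks u v)"

text \<open>
  For \<open>m \<ge> 2\<close> mixed derivatives are counted once for each order of differentiation, which gives
  a norm equivalent to the one indexed by unordered multi-indices; for \<open>m = 1\<close> they agree.
\<close>

definition sobolev_norm ::
    "(real ^ 'n) set \<Rightarrow> nat \<Rightarrow> real \<Rightarrow> (real ^ 'n \<Rightarrow> real) \<Rightarrow> real" where
  "sobolev_norm \<Omega> m p u =
     (\<Sum>ks | length ks \<le> m. LINT x|lebesgue_on \<Omega>. \<bar>wderiv \<Omega> ks u x\<bar> powr p) powr (1 / p)"

definition sobolev0 :: "(real ^ 'n) set \<Rightarrow> nat \<Rightarrow> real \<Rightarrow> (real ^ 'n \<Rightarrow> real) set" where
  "sobolev0 \<Omega> m p = {u \<in> sobolev \<Omega> m p.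
     \<exists>\<phi>. (\<forall>j::nat. test_function \<Omega> (\<phi> j)) \<and>
         (\<lambda>j. sobolev_norm \<Omega> m p (\<lambda>x. u x - \<phi> j x)) \<longlonglongrightarrow> 0}"

text \<open>
  The values of the weak Hessian are symmetric matrices only almost everywhere. This is harmless for integrals with
  respect to the (complete) Lebesgue measure.
\<close>

definition weak_hessian ::
    "(real ^ 'n) set \<Rightarrow> (real ^ 'n \<Rightarrow> real) \<Rightarrow> real ^ 'n \<Rightarrow> real ^ 'n ^ 'n" where
  "weak_hessian \<Omega> u x = (\<chi> i j. wderiv \<Omega> [i, j] u x)"

definition sym_matrices :: "(real ^ 'n ^ 'n) set" where
  "sym_matrices = {M. transpose M = M}"

definition nonneg_definite :: "real ^ 'n ^ 'n \<Rightarrow> bool" where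
  "nonneg_definite N \<longleftrightarrow> (\<forall>x. 0 \<le> x \<bullet> (N *v x))"

definition norm_on_sym_matrices :: "(real ^ 'n ^ 'n \<Rightarrow> real) \<Rightarrow> bool" where
  "norm_on_sym_matrices nrm \<longleftrightarrow>
     (\<forall>M \<in> sym_matrices. 0 \<le> nrm M \<and> (nrm M = 0 \<longleftrightarrow> M = 0)) \<and>
     (\<forall>M \<in> sym_matrices. \<forall>c. nrm (c *\<^sub>R M) = \<bar>c\<bar> * nrm M) \<and>
     (\<forall>M \<in> sym_matrices. \<forall>N \<in> sym_matrices. nrm (M + N) \<le> nrm M + nrm N)"

text \<open>
  Convexity of a Sobolev function is required of the representing function itself: a class
  with a convex representative on the ball contains exactly one, namely the continuous one.
\<close>

definition admissible :: "real \<Rightarrow> (real ^ 'n \<Rightarrow> real) \<Rightarrow> (real ^ 'n \<Rightarrow> real) set" where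
  "admissible p g = {u. u \<in> sobolev (ball 0 1) 2 p \<and>
     (\<lambda>x. u x - g x) \<in> sobolev0 (ball 0 1) 1 p \<and> convex_on (ball 0 1) u}"

text \<open>
  For convex \<open>u\<close> and the operators \<open>F\<close> of interest, \<open>F\<close> of the Hessian is nonnegative almost
  everywhere, so that the real power is the intended one.
\<close>

definition energy ::
    "(real ^ 'n ^ 'n \<Rightarrow> real) \<Rightarrow> real \<Rightarrow> real \<Rightarrow> real \<Rightarrow> (real ^ 'n \<Rightarrow> real) \<Rightarrow> real" where
  "energy F p gam_pos gam_neg u =
     (LINT x|lebesgue_on (ball 0 1).
        F (weak_hessian (ball 0 1) u x) powr p + gam_pos * max (u x) 0 - gam_neg * min (u x) 0)"

end

theory Submission
  imports Defs
begin

text \<open>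
  Ellipticity gives \<open>F N \<ge> c * norm N\<close> on nonnegative definite matrices, so along a minimizing
  sequence the Hessians are bounded in \<open>L\<^sup>p\<close>. Weak compactness is avoided: the almost minimizers
  form decreasing convex sets, and choosing in each of them an element whose Hessian has almost least
  \<open>L\<^sup>p\<close>-norm yields, by uniform convexity of that norm, Hessians that converge strongly.
  A difference \<open>v\<close> of admissible functions lies in \<open>W\<^sup>2\<^sup>,\<^sup>p\<close> and in \<open>W\<^sub>0\<^sup>1\<^sup>,\<^sup>p\<close>; its first derivatives
  have mean zero, so two Poincare inequalities bound \<open>v\<close> and its gradient by its Hessian and the
  sequence converges in \<open>W\<^sup>2\<^sup>,\<^sup>p\<close>. The limit has a convex representative, and Fatou's lemma along
  an almost everywhere convergent subsequence shows that it is a minimizer.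
\<close>

section \<open>Smooth functions\<close>

text \<open>The energy is convex, but not uniformly so: different Hessians may have the same value
  under \<open>F\<close>, and the zero order terms are piecewise linear. Nothing forces a minimizing
  sequence to be Cauchy. Hence a second, uniformly convex functional is almost minimized among
  almost minimizers; as midpoints stay in these sets, that functional cannot drop much at a
  midpoint, which forces two choices to be close. The boundary condition acts to first order only:
  the gradient of a difference \<open>v\<close> need not vanish at the boundary. What survives is
  its mean, because derivatives of test functions integrate to zero; so the gradient needs a
  Poincare inequality of its own. Both inequalities come from one estimate for translations. Weak
  derivatives are chosen by \<open>SOME\<close> and known almost everywhere only, whereas convexity
  is required pointwise and ellipticity speaks of symmetric matrices only. So Hessians of convex
  functions must first be shown symmetric and nonnegative definite almost everywhere, and the
  Sobolev limit must be changed on a null set to become convex.\<close>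

lemma partial_deriv_append: "partial_deriv (ks @ js) f = partial_deriv ks (partial_deriv js f)"
  by (induction ks) auto

declare partial_deriv.simps(2) [simp del]

lemma partial_deriv_Cons: "partial_deriv (k # ks) f = partial_deriv [k] (partial_deriv ks f)"
  by (metis append_Cons append_Nil partial_deriv_append)

lemma partial_deriv_single: "partial_deriv [k] f x = frechet_derivative f (at x) (axis k 1)"
  by (simp add: partial_deriv.simps(2))

lemma smooth_partial_deriv: "smooth f \<Longrightarrow> smooth (partial_deriv js f)"
  unfolding smooth_def by (metis partial_deriv_append)

lemma smooth_differentiable: "smooth f \<Longrightarrow> f differentiable (at x)"
  unfolding smooth_def by (metis partial_deriv.simps(1))

lemma smooth_continuous_on: "smooth f \<Longrightarrow> continuous_on A f"
  by (simp add: continuous_at_imp_continuous_on differentiable_imp_continuous_within smooth_differentiable)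

text \<open>The innermost derivative is the one that stays in \<open>S\<close>. Therefore the
  induction runs from the right end of the list, and \<open>partial_deriv_append\<close> applies the
  shorter list to a new member of \<open>S\<close>.\<close>

lemma smooth_coinduct:
  assumes "f \<in> S"
    and "\<And>f x. f \<in> S \<Longrightarrow> f differentiable (at x)"
    and "\<And>f k. f \<in> S \<Longrightarrow> partial_deriv [k] f \<in> S"
  shows "smooth f"
proof -
  have "partial_deriv ks f \<in> S" if "f \<in> S" for ks f
    using that
    by (induction ks arbitrary: f rule: rev_induct) (auto simp: partial_deriv_append assms(3))
  then show ?thesis
    unfolding smooth_def using assms(1,2) by blast
qed

lemma partial_deriv_has_derivative:
  assumes "(f has_derivative f') (at x)"
  shows "partial_deriv [k] f x = f' (axis k 1)"
  using frechet_derivative_at[OF assms] by (simp add: partial_deriv_single)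

lemma has_derivative_partial_deriv:
  fixes f :: "real ^ 'n \<Rightarrow> real"
  assumes "f differentiable (at x)"
  shows "(f has_derivative (\<lambda>v. \<Sum>k\<in>UNIV. v $ k * partial_deriv [k] f x)) (at x)"
proof -
  have d: "(f has_derivative frechet_derivative f (at x)) (at x)"
    using assms by (simp add: frechet_derivative_works)
  then have l: "linear (frechet_derivative f (at x))"
    using has_derivative_bounded_linear bounded_linear.linear by blast
  have "frechet_derivative f (at x) = (\<lambda>v. \<Sum>k\<in>UNIV. v $ k * partial_deriv [k] f x)"
  proof
    fix v :: "real ^ 'n"
    have "v = (\<Sum>k\<in>UNIV. v $ k *\<^sub>R axis k 1)"
      using basis_expansion[of v] by (simp add: scalar_mult_eq_scaleR)
    then have "frechet_derivative f (at x) v = frechet_derivative f (at x) (\<Sum>k\<in>UNIV. v $ k *\<^sub>R axis k 1)"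
      by simp
    also have "\<dots> = (\<Sum>k\<in>UNIV. v $ k * partial_deriv [k] f x)"
      by (simp add: linear_sum[OF l] linear_cmul[OF l] partial_deriv_single)
    finally show "frechet_derivative f (at x) v = (\<Sum>k\<in>UNIV. v $ k * partial_deriv [k] f x)" .
  qed
  with d show ?thesis by (simp only:)
qed

text \<open>Restriction to lines makes the one-dimensional mean value theorem, Taylor formula and
  fundamental theorem of calculus available for functions of several variables.\<close>

lemma has_real_derivative_line:
  fixes f :: "real ^ 'n \<Rightarrow> real"
  assumes "\<And>x. f differentiable (at x)"
  shows "((\<lambda>s. f (x + s *\<^sub>R v)) has_real_derivative
           (\<Sum>k\<in>UNIV. v $ k * partial_deriv [k] f (x + s *\<^sub>R v))) (at s within A)"
proof -
  have 1: "((\<lambda>s. x + s *\<^sub>R v) has_derivative (\<lambda>s. s *\<^sub>R v)) (at s within A)"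
    by (auto intro!: derivative_eq_intros)
  have "((\<lambda>s. f (x + s *\<^sub>R v)) has_derivative
         (\<lambda>t. \<Sum>k\<in>UNIV. (t *\<^sub>R v) $ k * partial_deriv [k] f (x + s *\<^sub>R v))) (at s within A)"
    using has_derivative_compose[OF 1 has_derivative_partial_deriv[OF assms]] .
  then show ?thesis
    unfolding has_field_derivative_def
    by (rule has_derivative_eq_rhs) (auto simp: sum_distrib_left mult_ac)
qed

lemma has_real_derivative_axis:
  fixes f :: "real ^ 'n \<Rightarrow> real"
  assumes "\<And>x. f differentiable (at x)"
  shows "((\<lambda>s. f (x + s *\<^sub>R axis k 1)) has_real_derivative
           partial_deriv [k] f (x + s *\<^sub>R axis k 1)) (at s within A)"
proof -
  have "(\<Sum>j\<in>UNIV. axis k (1::real) $ j * partial_deriv [j] f y) = partial_deriv [k] f y" for y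
    unfolding axis_def by (simp add: if_distrib[of "\<lambda>a. a * _"] cong: if_cong)
  then show ?thesis
    using has_real_derivative_line[OF assms, of x "axis k 1" s A] by simp
qed

lemma partial_deriv_lincomb:
  assumes "smooth f" "smooth g"
  shows "partial_deriv ks (\<lambda>x. a * f x + b * g x) = (\<lambda>x. a * partial_deriv ks f x + b * partial_deriv ks g x)"
proof (induction ks)
  case (Cons k ks)
  have "((\<lambda>y. a * partial_deriv ks f y + b * partial_deriv ks g y) has_derivative
      (\<lambda>v. a * frechet_derivative (partial_deriv ks f) (at x) v
          + b * frechet_derivative (partial_deriv ks g) (at x) v)) (at x)" for x
    using assms unfolding smooth_def
    by (intro has_derivative_add has_derivative_mult_right) (auto simp: frechet_derivative_works)
  then have "frechet_derivative (\<lambda>y. a * partial_deriv ks f y + b * partial_deriv ks g y) (at x)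
      = (\<lambda>v. a * frechet_derivative (partial_deriv ks f) (at x) v
          + b * frechet_derivative (partial_deriv ks g) (at x) v)" for x
    by (rule frechet_derivative_at[symmetric])
  with Cons show ?case by (auto simp: partial_deriv.simps(2))
qed auto

lemma smooth_lincomb:
  assumes "smooth f" "smooth g"
  shows "smooth (\<lambda>x. a * f x + b * g x)"
  using assms unfolding smooth_def partial_deriv_lincomb[OF assms] by auto

lemma partial_deriv_translate:
  assumes "smooth f"
  shows "partial_deriv ks (\<lambda>x. f (x + h)) = (\<lambda>x. partial_deriv ks f (x + h))"
proof (induction ks)
  case (Cons k ks)
  have 1: "((\<lambda>x. x + h) has_derivative (\<lambda>v. v)) (at x)" for x
    by (auto intro!: derivative_eq_intros)
  have "((\<lambda>x. partial_deriv ks f (x + h)) has_derivative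
      (\<lambda>v. frechet_derivative (partial_deriv ks f) (at (x + h)) v)) (at x)" for x
    by (rule has_derivative_compose[OF 1])
      (use assms in \<open>auto simp: smooth_def frechet_derivative_works\<close>)
  then have "frechet_derivative (\<lambda>x. partial_deriv ks f (x + h)) (at x)
      = (\<lambda>v. frechet_derivative (partial_deriv ks f) (at (x + h)) v)" for x
    by (rule frechet_derivative_at[symmetric])
  with Cons show ?case by (auto simp: partial_deriv.simps(2))
qed auto

lemma smooth_translate:
  assumes "smooth f"
  shows "smooth (\<lambda>x. f (x + h))"
proof -
  have 1: "((\<lambda>x. x + h) has_derivative (\<lambda>v. v)) (at x)" for x
    by (auto intro!: derivative_eq_intros)
  show ?thesis
    unfolding smooth_def partial_deriv_translate[OF assms] differentiable_def
    using has_derivative_compose[OF 1] assms unfolding smooth_def differentiable_def by metis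
qed

text \<open>Schwarz's theorem. The second difference over a small square is symmetric in
  \<open>i\<close> and \<open>j\<close>, and two uses of the mean value theorem turn it into the
  squared side length times either mixed derivative at a nearby point. Continuity identifies the two
  derivatives as the square shrinks.\<close>

lemma partial_deriv_commute:
  fixes f :: "real ^ 'n \<Rightarrow> real"
  assumes f: "smooth f"
  shows "partial_deriv [i, j] f = partial_deriv [j, i] f"
proof
  fix x :: "real ^ 'n"
  have mixed: "\<exists>s t. 0 < s \<and> s < h \<and> 0 < t \<and> t < h \<and>
      f (x + h *\<^sub>R axis i 1 + h *\<^sub>R axis j 1) - f (x + h *\<^sub>R axis i 1) - f (x + h *\<^sub>R axis j 1) + f x
      = h * (h * partial_deriv [j, i] f (x + s *\<^sub>R axis i 1 + t *\<^sub>R axis j 1))"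
    if "h > 0" for h i j
  proof -
    let ?G = "\<lambda>s. f ((x + h *\<^sub>R axis j 1) + s *\<^sub>R axis i 1) - f (x + s *\<^sub>R axis i 1)"
    have "\<And>s. (?G has_real_derivative (partial_deriv [i] f ((x + h *\<^sub>R axis j 1) + s *\<^sub>R axis i 1)
                - partial_deriv [i] f (x + s *\<^sub>R axis i 1))) (at s)"
      by (intro DERIV_diff has_real_derivative_axis smooth_differentiable f)
    from MVT2[OF \<open>h > 0\<close>, of ?G, OF this] obtain s where s: "0 < s" "s < h"
      and 1: "?G h - ?G 0 = (h - 0) * (partial_deriv [i] f ((x + h *\<^sub>R axis j 1) + s *\<^sub>R axis i 1)
                - partial_deriv [i] f (x + s *\<^sub>R axis i 1))"
      by blast
    let ?H = "\<lambda>t. partial_deriv [i] f ((x + s *\<^sub>R axis i 1) + t *\<^sub>R axis j 1)"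
    have "\<And>t. (?H has_real_derivative
        partial_deriv [j] (partial_deriv [i] f) ((x + s *\<^sub>R axis i 1) + t *\<^sub>R axis j 1)) (at t)"
      by (intro has_real_derivative_axis smooth_differentiable smooth_partial_deriv f)
    from MVT2[OF \<open>h > 0\<close>, of ?H, OF this] obtain t where t: "0 < t" "t < h"
      and 2: "?H h - ?H 0 = (h - 0) *
        partial_deriv [j] (partial_deriv [i] f) ((x + s *\<^sub>R axis i 1) + t *\<^sub>R axis j 1)"
      by blast
    have "partial_deriv [j] (partial_deriv [i] f) = partial_deriv [j, i] f" by (simp add: partial_deriv_Cons[of j "[i]"])
    with 1 2 s t show ?thesis
      by (intro exI[of _ s] exI[of _ t]) (simp add: algebra_simps del: partial_deriv.simps(2))
  qed
  have eq: "\<exists>y z. dist y x \<le> 2 * h \<and> dist z x \<le> 2 * h \<and> partial_deriv [j, i] f y = partial_deriv [i, j] f z"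
    if "h > 0" for h
  proof -
    obtain s t where st: "0 < s" "s < h" "0 < t" "t < h" and
      1: "f (x + h *\<^sub>R axis i 1 + h *\<^sub>R axis j 1) - f (x + h *\<^sub>R axis i 1) - f (x + h *\<^sub>R axis j 1) + f x
      = h * (h * partial_deriv [j, i] f (x + s *\<^sub>R axis i 1 + t *\<^sub>R axis j 1))"
      using mixed[OF \<open>h > 0\<close>, of i j] by blast
    obtain s' t' where st': "0 < s'" "s' < h" "0 < t'" "t' < h" and
      2: "f (x + h *\<^sub>R axis j 1 + h *\<^sub>R axis i 1) - f (x + h *\<^sub>R axis j 1) - f (x + h *\<^sub>R axis i 1) + f x
      = h * (h * partial_deriv [i, j] f (x + s' *\<^sub>R axis j 1 + t' *\<^sub>R axis i 1))"
      using mixed[OF \<open>h > 0\<close>, of j i] by blast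
    have d: "dist (x + a *\<^sub>R axis k 1 + b *\<^sub>R axis l 1) x \<le> 2 * h" if "0 < a" "a < h" "0 < b" "b < h" for a b k l
    proof -
      have "norm (a *\<^sub>R axis k (1::real) + b *\<^sub>R axis l 1 :: real ^ 'n) \<le> \<bar>a\<bar> + \<bar>b\<bar>"
        by (rule order_trans[OF norm_triangle_ineq]) simp
      then show ?thesis using that by (simp add: dist_norm add.assoc)
    qed
    have "f (x + h *\<^sub>R axis i 1 + h *\<^sub>R axis j 1) - f (x + h *\<^sub>R axis i 1) - f (x + h *\<^sub>R axis j 1) + f x
       = f (x + h *\<^sub>R axis j 1 + h *\<^sub>R axis i 1) - f (x + h *\<^sub>R axis j 1) - f (x + h *\<^sub>R axis i 1) + f x"
      by (simp add: ac_simps)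
    then have "partial_deriv [j, i] f (x + s *\<^sub>R axis i 1 + t *\<^sub>R axis j 1)
        = partial_deriv [i, j] f (x + s' *\<^sub>R axis j 1 + t' *\<^sub>R axis i 1)"
      unfolding 1 2 using that by (simp del: partial_deriv.simps(2))
    with d[OF st] d[OF st'] show ?thesis by blast
  qed
  have "\<forall>n. \<exists>y z. dist y x \<le> 2 * inverse (real (Suc n)) \<and> dist z x \<le> 2 * inverse (real (Suc n))
      \<and> partial_deriv [j, i] f y = partial_deriv [i, j] f z"
    using eq by simp
  then obtain y z where yz: "\<And>n. dist (y n) x \<le> 2 * inverse (real (Suc n))"
      "\<And>n. dist (z n) x \<le> 2 * inverse (real (Suc n))"
      "\<And>n. partial_deriv [j, i] f (y n) = partial_deriv [i, j] f (z n)" by metis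
  have lim0: "(\<lambda>n. 2 * inverse (real (Suc n))) \<longlonglongrightarrow> 0"
    using tendsto_mult_right_zero[OF LIMSEQ_inverse_real_of_nat] .
  have conv: "w \<longlonglongrightarrow> x" if "\<And>n. dist (w n) x \<le> 2 * inverse (real (Suc n))" for w
    by (subst tendsto_dist_iff) (rule tendsto_sandwich[OF _ _ tendsto_const lim0], use that in auto)
  have cont: "isCont (partial_deriv ks f) x" for ks
    using f unfolding smooth_def by (simp add: differentiable_imp_continuous_within)
  have "(\<lambda>n. partial_deriv [j, i] f (y n)) \<longlonglongrightarrow> partial_deriv [j, i] f x"
    using isCont_tendsto_compose[OF cont conv[OF yz(1)]] .
  moreover have "(\<lambda>n. partial_deriv [i, j] f (z n)) \<longlonglongrightarrow> partial_deriv [i, j] f x"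
    using isCont_tendsto_compose[OF cont conv[OF yz(2)]] .
  ultimately show "partial_deriv [i, j] f x = partial_deriv [j, i] f x"
    unfolding yz(3) using LIMSEQ_unique by metis
qed

section \<open>Smooth bump functions built from exp(-1/t)\<close>

definition exp_flat :: "nat \<Rightarrow> real \<Rightarrow> real" where
  "exp_flat n t = (if t > 0 then exp (- (1 / t)) / t ^ n else 0)"

text \<open>With s = 1/t the limit from the right becomes that of s^n / exp s at infinity.\<close>

lemma exp_flat_tendsto_0: "(exp_flat n \<longlongrightarrow> 0) (at 0)"
proof -
  have "((\<lambda>t. (inverse t) ^ n / exp (inverse t)) \<longlongrightarrow> 0) (at_right (0::real))"
    by (rule filterlim_compose[OF tendsto_power_div_exp_0 filterlim_inverse_at_top_right])
  then have "(exp_flat n \<longlongrightarrow> 0) (at_right 0)"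
    by (rule Lim_transform_eventually)
      (auto simp: exp_flat_def eventually_at_filter exp_minus field_simps)
  moreover have "(exp_flat n \<longlongrightarrow> 0) (at_left 0)"
    by (rule Lim_transform_eventually[OF tendsto_const])
      (auto simp: exp_flat_def eventually_at_filter)
  ultimately show ?thesis by (simp add: filterlim_at_split)
qed

text \<open>The denominators t^n are built into the family so that differentiation stays in its
  linear span; no polynomial factors have to be tracked to see that exp(-1/t) extends smoothly by
  zero.\<close>

lemma exp_flat_deriv:
  "(exp_flat n has_real_derivative (exp_flat (n + 2) t - real n * exp_flat (n + 1) t)) (at t)"
proof -
  consider "t > 0" | "t < 0" | "t = 0" by linarith
  then show ?thesis
  proof cases
    case 1
    have "((\<lambda>t. exp (- (1 / t)) / t ^ n) has_real_derivative
        (exp_flat (n + 2) t - real n * exp_flat (n + 1) t)) (at t)"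
    proof (cases n)
      case 0
      then show ?thesis using 1
        by (auto intro!: derivative_eq_intros simp: exp_flat_def field_simps power2_eq_square)
    next
      case (Suc m)
      have "((\<lambda>t. exp (- (1 / t)) / t ^ Suc m) has_real_derivative
          (exp (- (1 / t)) * (1 / t\<^sup>2) * t ^ Suc m - exp (- (1 / t)) * (real (Suc m) * t ^ m)) / (t ^ Suc m * t ^ Suc m)) (at t)"
        using 1 by (auto intro!: derivative_eq_intros simp: power2_eq_square simp del: power_Suc)
      moreover have "(exp (- (1 / t)) * (1 / t\<^sup>2) * t ^ Suc m - exp (- (1 / t)) * (real (Suc m) * t ^ m)) / (t ^ Suc m * t ^ Suc m)
          = exp_flat (n + 2) t - real n * exp_flat (n + 1) t"
        using 1 Suc by (simp add: exp_flat_def field_simps power2_eq_square)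
      ultimately show ?thesis using Suc by simp
    qed
    then show ?thesis
      by (rule has_field_derivative_transform_within_open[where S = "{0<..}"])
        (use 1 in \<open>auto simp: exp_flat_def\<close>)
  next
    case 2
    have "((\<lambda>t. 0) has_real_derivative (exp_flat (n + 2) t - real n * exp_flat (n + 1) t)) (at t)"
      using 2 by (simp add: exp_flat_def)
    then show ?thesis
      by (rule has_field_derivative_transform_within_open[where S = "{..<0}"])
        (use 2 in \<open>auto simp: exp_flat_def\<close>)
  next
    case 3
    \<comment> \<open>Away from the origin the difference quotient of \<open>exp_flat n\<close> at 0
      is \<open>exp_flat (Suc n)\<close>, so the limit already proved gives derivative 0.\<close>
    have "((\<lambda>h. (exp_flat n (0 + h) - exp_flat n 0) / h) \<longlongrightarrow> 0) (at 0)"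
      by (rule Lim_transform_eventually[OF exp_flat_tendsto_0[of "Suc n"]])
        (auto simp: exp_flat_def eventually_at_filter field_simps)
    then have "(exp_flat n has_real_derivative 0) (at 0)"
      by (simp only: DERIV_def)
    then show ?thesis using 3 by (simp add: exp_flat_def)
  qed
qed

text \<open>An algebra that contains radial bumps and whose generators have derivatives inside it:
  differentiating \<open>flat\<close> yields coordinates, constants and further \<open>flat\<close>
  terms. Smoothness then follows by coinduction without tracking derivatives of high order.\<close>

inductive bump_algebra :: "(real ^ 'n \<Rightarrow> real) \<Rightarrow> bool" where
  const: "bump_algebra (\<lambda>x. a)"
| coord: "bump_algebra (\<lambda>x. x $ k)"
| flat: "bump_algebra (\<lambda>x. exp_flat n (r - (x - c) \<bullet> (x - c)))"
| add: "bump_algebra f \<Longrightarrow> bump_algebra g \<Longrightarrow> bump_algebra (\<lambda>x. f x + g x)"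
| mult: "bump_algebra f \<Longrightarrow> bump_algebra g \<Longrightarrow> bump_algebra (\<lambda>x. f x * g x)"

lemma bump_algebra_diff:
  assumes "bump_algebra f" "bump_algebra g" shows "bump_algebra (\<lambda>x. f x - g x)"
  using bump_algebra.add[OF assms(1) bump_algebra.mult[OF bump_algebra.const[of "-1"] assms(2)]]
  by simp

lemma bump_algebra_deriv:
  fixes f :: "real ^ 'n \<Rightarrow> real"
  assumes "bump_algebra f"
  shows "(\<forall>x. f differentiable (at x)) \<and> (\<forall>k. bump_algebra (partial_deriv [k] f))"
  using assms
proof induction
  case (const a)
  have "partial_deriv [k] (\<lambda>x :: real ^ 'n. a) = (\<lambda>x. 0)" for k
    by (rule ext) (simp add: frechet_derivative_const partial_deriv_single)
  then show ?case by (auto simp: bump_algebra.const)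
next
  case (coord k)
  have d: "((\<lambda>x. x $ k) has_derivative (\<lambda>v. v $ k)) (at x)" for x :: "real ^ 'n"
    by (simp add: bounded_linear_imp_has_derivative bounded_linear_vec_nth)
  have "partial_deriv [j] (\<lambda>x :: real ^ 'n. x $ k) = (\<lambda>x. axis j 1 $ k)" for j
    by (rule ext) (rule partial_deriv_has_derivative[OF d])
  then show ?case using d by (auto simp: bump_algebra.const differentiable_def)
next
  case (flat n r c)
  let ?q = "\<lambda>x. r - (x - c) \<bullet> (x - c)"
  let ?h = "\<lambda>x. exp_flat (n + 2) (?q x) - real n * exp_flat (n + 1) (?q x)"
  have d: "((\<lambda>x. exp_flat n (?q x)) has_derivative (\<lambda>v. ?h x * (- 2 * ((x - c) \<bullet> v)))) (at x)" for x
  proof -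
    have 1: "(?q has_derivative (\<lambda>v. - 2 * ((x - c) \<bullet> v))) (at x)"
      by (auto intro!: derivative_eq_intros simp: inner_commute)
    show ?thesis
      using has_derivative_compose[OF 1 exp_flat_deriv[of n, unfolded has_field_derivative_def]] .
  qed
  have eq: "partial_deriv [k] (\<lambda>x. exp_flat n (?q x)) = (\<lambda>x. ?h x * (- 2 * (x $ k - c $ k)))" for k
    by (rule ext) (simp add: partial_deriv_has_derivative[OF d] inner_axis del: partial_deriv.simps)
  have "bump_algebra (\<lambda>x. ?h x * (- 2 * (x $ k - c $ k)))" for k
    by (intro bump_algebra.mult bump_algebra.const bump_algebra_diff bump_algebra.flat bump_algebra.coord)
  with d show ?case by (auto simp: eq differentiable_def)
next
  case (add f g)
  have "((\<lambda>x. f x + g x) has_derivative (\<lambda>v. frechet_derivative f (at x) v + frechet_derivative g (at x) v)) (at x)" for x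
    using add.IH by (intro has_derivative_add) (auto simp: frechet_derivative_works)
  from partial_deriv_has_derivative[OF this]
  have "partial_deriv [k] (\<lambda>x. f x + g x) = (\<lambda>x. partial_deriv [k] f x + partial_deriv [k] g x)" for k
    by (auto simp: partial_deriv_single)
  then show ?case using add.IH by (auto intro: bump_algebra.add)
next
  case (mult f g)
  have "((\<lambda>x. f x * g x) has_derivative (\<lambda>v. f x * frechet_derivative g (at x) v + frechet_derivative f (at x) v * g x)) (at x)" for x
    using mult.IH by (intro has_derivative_mult) (auto simp: frechet_derivative_works)
  from partial_deriv_has_derivative[OF this]
  have "partial_deriv [k] (\<lambda>x. f x * g x) = (\<lambda>x. f x * partial_deriv [k] g x + partial_deriv [k] f x * g x)" for k
    by (auto simp: partial_deriv_single)
  moreover have "bump_algebra (\<lambda>x. f x * partial_deriv [k] g x + partial_deriv [k] f x * g x)" for k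
    by (intro bump_algebra.add bump_algebra.mult) (use mult.IH mult.hyps in blast)+
  ultimately show ?case using mult.IH by simp
qed

lemma bump_algebra_smooth: "bump_algebra f \<Longrightarrow> smooth f"
  by (rule smooth_coinduct[where S = "{f. bump_algebra f}"]) (use bump_algebra_deriv in auto)

section \<open>Test functions and locally integrable functions\<close>

lemma closure_support_outside: "x \<notin> closure {x. \<phi> x \<noteq> 0} \<Longrightarrow> \<phi> x = 0"
  using closure_subset[of "{x. \<phi> x \<noteq> 0}"] by blast

lemma support_subset_compact:
  fixes \<phi> :: "'a::euclidean_space \<Rightarrow> real"
  assumes "compact K" "\<And>x. x \<notin> K \<Longrightarrow> \<phi> x = 0"
  shows "closure {x. \<phi> x \<noteq> 0} \<subseteq> K" "compact (closure {x. \<phi> x \<noteq> 0})"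
proof -
  show sub: "closure {x. \<phi> x \<noteq> 0} \<subseteq> K"
    by (rule closure_minimal) (use assms compact_imp_closed in auto)
  show "compact (closure {x. \<phi> x \<noteq> 0})"
    using compact_Int_closed[OF assms(1) closed_closure, of "{x. \<phi> x \<noteq> 0}"] sub
    by (simp add: Int_absorb1)
qed

text \<open>Any compact set off which the function vanishes can stand in for the closed support;
  supports are handled in this form throughout.\<close>

lemma test_functionI:
  assumes "smooth \<phi>" "compact K" "K \<subseteq> \<Omega>" "\<And>x. x \<notin> K \<Longrightarrow> \<phi> x = 0"
  shows "test_function \<Omega> \<phi>"
  using support_subset_compact[of K \<phi>] assms unfolding test_function_def by blast

lemma test_functionE:
  assumes "test_function \<Omega> \<phi>"
  obtains K where "smooth \<phi>" "compact K" "K \<subseteq> \<Omega>" "\<And>x. x \<notin> K \<Longrightarrow> \<phi> x = 0"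
  using assms closure_support_outside[of _ \<phi>] that[of "closure {x. \<phi> x \<noteq> 0}"] unfolding test_function_def by blast

text \<open>The complement of \<open>K\<close> is open, so near \<open>x\<close> a derivative that
  vanishes off \<open>K\<close> vanishes identically, and its own derivative at \<open>x\<close> is
  zero.\<close>

lemma partial_deriv_outside:
  fixes \<phi> :: "real ^ 'n \<Rightarrow> real"
  assumes "closed K" "\<And>x. x \<notin> K \<Longrightarrow> \<phi> x = 0" "x \<notin> K"
  shows "partial_deriv ks \<phi> x = 0"
  using assms(3)
proof (induction ks arbitrary: x)
  case (Cons k ks)
  have "((\<lambda>x. 0) has_derivative (\<lambda>v. 0)) (at x)" by simp
  then have "(partial_deriv ks \<phi> has_derivative (\<lambda>v. 0)) (at x)"
    by (rule has_derivative_transform_within_open[where s = "- K"])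
      (use Cons assms in auto)
  then show ?case
    using partial_deriv_has_derivative partial_deriv_Cons by metis
qed (use assms in auto)

lemma test_function_partial_deriv:
  assumes "test_function \<Omega> \<phi>"
  shows "test_function \<Omega> (partial_deriv ks \<phi>)"
proof -
  obtain K where K: "smooth \<phi>" "compact K" "K \<subseteq> \<Omega>" "\<And>x. x \<notin> K \<Longrightarrow> \<phi> x = 0"
    using test_functionE[OF assms] by metis
  show ?thesis
    by (rule test_functionI[OF smooth_partial_deriv[OF K(1)] K(2,3)])
      (rule partial_deriv_outside[OF compact_imp_closed[OF K(2)] K(4)])
qed

lemma test_function_lincomb:
  assumes "test_function \<Omega> \<phi>" "test_function \<Omega> \<psi>"
  shows "test_function \<Omega> (\<lambda>x. a * \<phi> x + b * \<psi> x)"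
proof -
  obtain K where K: "smooth \<phi>" "compact K" "K \<subseteq> \<Omega>" "\<And>x. x \<notin> K \<Longrightarrow> \<phi> x = 0"
    using test_functionE[OF assms(1)] by metis
  obtain L where L: "smooth \<psi>" "compact L" "L \<subseteq> \<Omega>" "\<And>x. x \<notin> L \<Longrightarrow> \<psi> x = 0"
    using test_functionE[OF assms(2)] by metis
  show ?thesis
    by (rule test_functionI[OF smooth_lincomb[OF K(1) L(1)], of "K \<union> L"])
      (use K L in auto)
qed

lemma test_function_zero: "test_function \<Omega> (\<lambda>x. 0)"
  by (rule test_functionI[where K = "{}"])
    (use bump_algebra_smooth[OF bump_algebra.const, of 0] in auto)

lemma test_function_translate:
  assumes "test_function \<Omega>' \<phi>" "\<And>x. \<phi> (x + h) \<noteq> 0 \<Longrightarrow> x \<in> K" "compact K" "K \<subseteq> \<Omega>"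
  shows "test_function \<Omega> (\<lambda>x. \<phi> (x + h))"
  by (rule test_functionI[OF smooth_translate, of _ K])
    (use assms in \<open>auto simp: test_function_def\<close>)

lemma borel_measurable_lebesgue_continuous:
  fixes \<phi> :: "'a::euclidean_space \<Rightarrow> real"
  assumes "continuous_on UNIV \<phi>"
  shows "\<phi> \<in> borel_measurable lebesgue"
  using borel_measurable_continuous_onI[OF assms] by (intro measurable_completion) simp

lemma continuous_compact_support_bounded:
  fixes \<phi> :: "'a::euclidean_space \<Rightarrow> real"
  assumes "continuous_on UNIV \<phi>" "compact K" "\<And>x. x \<notin> K \<Longrightarrow> \<phi> x = 0"
  obtains C where "0 \<le> C" "\<And>x. \<bar>\<phi> x\<bar> \<le> C"
proof -
  have "bounded (\<phi> ` K)"
    using assms continuous_on_subset compact_continuous_image compact_imp_bounded by blast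
  then obtain C where "\<And>x. x \<in> K \<Longrightarrow> \<bar>\<phi> x\<bar> \<le> C" unfolding bounded_iff by auto
  then show ?thesis using assms(3) that[of "max C 0"] by (metis abs_0 le_max_iff_disj order_refl)
qed

lemma test_function_bounded:
  fixes \<phi> :: "real ^ 'n \<Rightarrow> real"
  assumes "test_function \<Omega> \<phi>"
  obtains C where "0 \<le> C" "\<And>x. \<bar>\<phi> x\<bar> \<le> C"
proof -
  obtain K where K: "smooth \<phi>" "compact K" "K \<subseteq> \<Omega>" "\<And>x. x \<notin> K \<Longrightarrow> \<phi> x = 0"
    using test_functionE[OF assms] by metis
  show ?thesis
    by (rule continuous_compact_support_bounded[OF smooth_continuous_on[OF K(1)] K(2) K(4) that])
qed

lemma test_function_measurable:
  fixes \<phi> :: "real ^ 'n \<Rightarrow> real"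
  assumes "test_function \<Omega> \<phi>"
  shows "\<phi> \<in> borel_measurable lebesgue" "\<phi> \<in> borel_measurable (lebesgue_on A)"
proof -
  show "\<phi> \<in> borel_measurable lebesgue"
    using assms smooth_continuous_on borel_measurable_lebesgue_continuous
    unfolding test_function_def by blast
  then show "\<phi> \<in> borel_measurable (lebesgue_on A)" by (rule measurable_restrict_space1)
qed

lemma locally_integrable_mult:
  fixes v :: "real ^ 'n \<Rightarrow> real"
  assumes "locally_integrable \<Omega> v" "compact K" "K \<subseteq> \<Omega>" "continuous_on UNIV \<phi>"
    "\<And>x. x \<notin> K \<Longrightarrow> \<phi> x = 0"
  shows "integrable lebesgue (\<lambda>x. v x * \<phi> x)"
proof -
  obtain C where C: "0 \<le> C" "\<And>x. \<bar>\<phi> x\<bar> \<le> C"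
    using continuous_compact_support_bounded[OF assms(4,2,5)] by blast
  have "set_integrable lebesgue K v"
    using assms(1-3) unfolding locally_integrable_def by blast
  then have i: "integrable lebesgue (\<lambda>x. indicator K x * v x)"
    by (simp add: set_integrable_def)
  have m: "\<phi> \<in> borel_measurable lebesgue"
    using assms(4) by (rule borel_measurable_lebesgue_continuous)
  have eq: "v x * \<phi> x = (indicator K x * v x) * \<phi> x" for x
    using assms(5)[of x] by (auto simp: indicator_def)
  show ?thesis
  proof (rule Bochner_Integration.integrable_bound)
    show "integrable lebesgue (\<lambda>x. C * (indicator K x * v x))" using i by simp
    show "(\<lambda>x. v x * \<phi> x) \<in> borel_measurable lebesgue"
      unfolding eq by (rule borel_measurable_times[OF borel_measurable_integrable[OF i] m])
    show "AE x in lebesgue. norm (v x * \<phi> x) \<le> norm (C * (indicator K x * v x))"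
      unfolding eq using C by (auto simp: abs_mult mult.commute[of C] intro!: mult_left_mono)
  qed
qed

lemma continuous_imp_locally_integrable:
  fixes v :: "real ^ 'n \<Rightarrow> real"
  assumes "continuous_on \<Omega> v"
  shows "locally_integrable \<Omega> v"
  unfolding locally_integrable_def
proof (intro allI impI)
  fix K assume K: "compact K \<and> K \<subseteq> \<Omega>"
  then have "integrable lborel (\<lambda>x. indicator K x *\<^sub>R v x)"
    using borel_integrable_compact continuous_on_subset[OF assms] by blast
  then show "v absolutely_integrable_on K"
    unfolding set_integrable_def using integrable_completion borel_measurable_integrable by blast
qed

lemma integrable_continuous_compact_support:
  fixes \<phi> :: "real ^ 'n \<Rightarrow> real"
  assumes "continuous_on UNIV \<phi>" "compact K" "\<And>x. x \<notin> K \<Longrightarrow> \<phi> x = 0"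
  shows "integrable lebesgue \<phi>"
  using locally_integrable_mult[OF continuous_imp_locally_integrable[OF continuous_on_const[of UNIV 1]]
      assms(2) subset_UNIV assms(1,3)] by simp

lemma locally_integrable_test:
  fixes v :: "real ^ 'n \<Rightarrow> real"
  assumes "locally_integrable \<Omega> v" "test_function \<Omega> \<phi>"
  shows "integrable lebesgue (\<lambda>x. v x * \<phi> x)"
proof -
  obtain K where K: "smooth \<phi>" "compact K" "K \<subseteq> \<Omega>" "\<And>x. x \<notin> K \<Longrightarrow> \<phi> x = 0"
    using test_functionE[OF assms(2)] by metis
  show ?thesis
    by (rule locally_integrable_mult[OF assms(1) K(2,3) smooth_continuous_on[OF K(1)] K(4)])
qed

lemma integral_test_function:
  fixes v :: "real ^ 'n \<Rightarrow> real"
  assumes "open \<Omega>" "test_function \<Omega> \<phi>"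
  shows "(LINT x|lebesgue_on \<Omega>. v x * \<phi> x) = (LINT x|lebesgue. v x * \<phi> x)"
    and "integrable (lebesgue_on \<Omega>) (\<lambda>x. v x * \<phi> x) \<longleftrightarrow> integrable lebesgue (\<lambda>x. v x * \<phi> x)"
proof -
  obtain K where K: "smooth \<phi>" "compact K" "K \<subseteq> \<Omega>" "\<And>x. x \<notin> K \<Longrightarrow> \<phi> x = 0"
    using test_functionE[OF assms(2)] by metis
  have "(\<lambda>x. v x * \<phi> x) = (\<lambda>x. if x \<in> \<Omega> then v x * \<phi> x else 0)"
    by (rule ext) (metis K(3,4) mult_zero_right subset_eq)
  moreover have "\<Omega> \<in> sets lebesgue" using assms(1) by auto
  ultimately show "(LINT x|lebesgue_on \<Omega>. v x * \<phi> x) = (LINT x|lebesgue. v x * \<phi> x)"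
    "integrable (lebesgue_on \<Omega>) (\<lambda>x. v x * \<phi> x) \<longleftrightarrow> integrable lebesgue (\<lambda>x. v x * \<phi> x)"
    using Lebesgue_Measure.integral_restrict_UNIV[of \<Omega> "\<lambda>x. v x * \<phi> x"]
      Lebesgue_Measure.integrable_restrict_UNIV[of \<Omega> "\<lambda>x. v x * \<phi> x"] by auto
qed

text \<open>Local integrability speaks of compact subsets only. An exhaustion of the open set by
  compact sets makes the function, extended by zero, a pointwise limit of measurable
  functions.\<close>

lemma locally_integrable_measurable:
  fixes v :: "real ^ 'n \<Rightarrow> real"
  assumes "open \<Omega>" "locally_integrable \<Omega> v"
  shows "v \<in> borel_measurable (lebesgue_on \<Omega>)"
proof -
  obtain C where C: "\<And>n. compact (C n)" "\<And>n. C n \<subseteq> \<Omega>" "\<And>n. C n \<subseteq> interior (C (Suc n))"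
    "\<Union>(range C) = \<Omega>" "\<And>K. \<lbrakk>compact K; K \<subseteq> \<Omega>\<rbrakk> \<Longrightarrow> \<exists>N. \<forall>n\<ge>N. K \<subseteq> C n"
    using open_Union_compact_subsets[OF assms(1)] by metis
  have "(\<lambda>x. if x \<in> \<Omega> then v x else 0) \<in> borel_measurable lebesgue"
  proof (rule borel_measurable_LIMSEQ_real)
    fix n
    have "set_integrable lebesgue (C n) v"
      using assms(2) C(1,2) unfolding locally_integrable_def by blast
    then show "(\<lambda>x. indicator (C n) x * v x) \<in> borel_measurable lebesgue"
      by (simp add: set_integrable_def)
  next
    fix x :: "real ^ 'n"
    show "(\<lambda>n. indicator (C n) x * v x) \<longlonglongrightarrow> (if x \<in> \<Omega> then v x else 0)"
    proof (cases "x \<in> \<Omega>")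
      case True
      then obtain N where "\<forall>n\<ge>N. {x} \<subseteq> C n" using C(5)[of "{x}"] by auto
      then have "eventually (\<lambda>n. indicator (C n) x * v x = v x) sequentially"
        by (auto simp: eventually_sequentially intro!: exI[of _ N])
      with True show ?thesis by (simp add: tendsto_eventually)
    next
      case False
      then have "indicator (C n) x = (0::real)" for n using C(2) by (auto simp: indicator_def)
      with False show ?thesis by simp
    qed
  qed
  then show ?thesis using borel_measurable_if_D by blast
qed

lemma integrable_imp_locally_integrable:
  fixes v :: "real ^ 'n \<Rightarrow> real"
  assumes "integrable (lebesgue_on \<Omega>) v" "\<Omega> \<in> sets lebesgue"
  shows "locally_integrable \<Omega> v"
  unfolding locally_integrable_def
proof (intro allI impI)
  fix K assume K: "compact K \<and> K \<subseteq> \<Omega>"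
  have "set_integrable lebesgue \<Omega> v"
    using assms by (simp add: set_integrable_def integrable_restrict_space)
  then show "v absolutely_integrable_on K"
    by (rule set_integrable_subset) (use K lmeasurable_compact fmeasurableD in blast)+
qed

lemma locally_integrable_lincomb:
  assumes "locally_integrable \<Omega> u" "locally_integrable \<Omega> v"
  shows "locally_integrable \<Omega> (\<lambda>x. a * u x + b * v x)"
  using assms unfolding locally_integrable_def
  by (intro allI impI set_integral_add(1) set_integrable_mult_right) auto

lemma locally_integrable_cong_AE:
  fixes u :: "real ^ 'n \<Rightarrow> real"
  assumes "open \<Omega>" "locally_integrable \<Omega> u" "AE x in lebesgue_on \<Omega>. u x = v x"
  shows "locally_integrable \<Omega> v"
  unfolding locally_integrable_def
proof (intro allI impI)
  fix K assume K: "compact K \<and> K \<subseteq> \<Omega>"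
  have ae: "AE x in lebesgue. x \<in> \<Omega> \<longrightarrow> u x = v x"
    using assms(1,3) by (simp add: AE_restrict_space_iff)
  have i: "integrable lebesgue (\<lambda>x. indicator K x *\<^sub>R u x)"
    using assms(2) K unfolding locally_integrable_def set_integrable_def by blast
  have eq: "AE x in lebesgue. indicator K x *\<^sub>R u x = indicator K x *\<^sub>R v x"
    using ae by eventually_elim (use K in \<open>auto simp: indicator_def\<close>)
  have "(\<lambda>x. indicator K x *\<^sub>R v x) \<in> borel_measurable lebesgue"
    by (rule borel_measurable_AE[OF borel_measurable_integrable[OF i] eq])
  from integrable_cong_AE[OF borel_measurable_integrable[OF i] this eq] i show "v absolutely_integrable_on K"
    unfolding set_integrable_def by blast
qed

section \<open>Indicators as limits of test functions, and the fundamental lemma of the calculus of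
  variations\<close>

lemma compact_thickening:
  fixes K :: "'a::euclidean_space set"
  assumes "compact K"
  shows "compact (\<Union>x\<in>K. cball x r)"
proof -
  have "(\<Union>x\<in>K. cball x r) = (\<Union>x\<in>K. \<Union>y\<in>cball 0 r. {x + y})"
  proof (intro set_eqI iffI)
    fix z assume "z \<in> (\<Union>x\<in>K. cball x r)"
    then obtain x where "x \<in> K" "dist x z \<le> r" by auto
    then have "z = x + (z - x)" "z - x \<in> cball 0 r" by (auto simp: dist_norm norm_minus_commute)
    then show "z \<in> (\<Union>x\<in>K. \<Union>y\<in>cball 0 r. {x + y})" using \<open>x \<in> K\<close> by blast
  next
    fix z assume "z \<in> (\<Union>x\<in>K. \<Union>y\<in>cball 0 r. {x + y})"
    then obtain x y where "x \<in> K" "norm y \<le> r" "z = x + y" by auto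
    then show "z \<in> (\<Union>x\<in>K. cball x r)" by (auto simp: dist_norm intro!: bexI[of _ x])
  qed
  then show ?thesis using compact_sums'[OF assms compact_cball, of 0 r] by simp
qed

lemma compact_cover_balls:
  fixes K :: "(real ^ 'n) set"
  assumes "compact K" "r > 0"
  obtains C where "finite C" "C \<subseteq> K" "K \<subseteq> (\<Union>c\<in>C. ball c r)"
proof -
  have "K \<subseteq> (\<Union>c\<in>K. ball c r)" using assms(2) by auto
  then obtain C where "C \<subseteq> K" "finite C" "K \<subseteq> (\<Union>c\<in>C. ball c r)"
    using compactE_image[OF assms(1), of K "\<lambda>c. ball c r"] by auto
  with that show ?thesis by blast
qed

lemma bump_algebra_prod:
  fixes f :: "'a \<Rightarrow> real ^ 'n \<Rightarrow> real"
  assumes "finite C" "\<And>c. c \<in> C \<Longrightarrow> bump_algebra (f c)"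
  shows "bump_algebra (\<lambda>x. \<Prod>c\<in>C. f c x)"
  using assms by (induction C rule: finite_induct) (auto intro: bump_algebra.const bump_algebra.mult)

lemma bump_algebra_power:
  "bump_algebra f \<Longrightarrow> bump_algebra (\<lambda>x. f x ^ m)"
  by (induction m) (auto intro: bump_algebra.const bump_algebra.mult)

lemma indicator_mult_subset:
  fixes v :: real
  assumes "A \<subseteq> B"
  shows "(v * indicator B x) * indicator A x = v * indicator A x"
    and "norm (v * indicator A x) \<le> norm (v * indicator B x)"
  using assms by (auto simp: indicator_def)

lemma exp_flat_0_bounds: "0 \<le> exp_flat 0 t" "exp_flat 0 t < 1" "exp_flat 0 t > 0 \<longleftrightarrow> t > 0"
  by (auto simp: exp_flat_def)

text \<open>The product \<open>P\<close> over the centres of one minus a bump equals 1 off the union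
  of the balls and is less than 1 inside. Hence its powers stay 1 outside and tend to 0 inside, and
  \<open>1 - P x ^ m\<close> converges to the indicator of the union. No mollification is
  involved.\<close>

lemma ball_union_cutoff:
  fixes C :: "(real ^ 'n) set"
  assumes "finite C" "r > 0" "(\<Union>c\<in>C. cball c r) \<subseteq> \<Omega>"
  obtains \<phi> where "\<And>m::nat. test_function \<Omega> (\<phi> m)" "\<And>m x. 0 \<le> \<phi> m x" "\<And>m x. \<phi> m x \<le> 1"
    "\<And>m x. x \<notin> (\<Union>c\<in>C. ball c r) \<Longrightarrow> \<phi> m x = 0"
    "\<And>x. x \<in> (\<Union>c\<in>C. ball c r) \<Longrightarrow> (\<lambda>m. \<phi> m x) \<longlonglongrightarrow> 1"
proof -
  define b where "b c x = 1 - exp_flat 0 (r\<^sup>2 - (x - c) \<bullet> (x - c))" for c x :: "real ^ 'n"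
  define P where "P x = (\<Prod>c\<in>C. b c x)" for x
  define \<phi> where "\<phi> m x = 1 - P x ^ m" for m x
  have b: "0 < b c x" "b c x \<le> 1" for c x
    using exp_flat_0_bounds by (auto simp: b_def)
  have b1: "b c x < 1 \<longleftrightarrow> x \<in> ball c r" for c x
    using exp_flat_0_bounds(3)[of "r\<^sup>2 - (x - c) \<bullet> (x - c)"] assms(2)
    by (auto simp: b_def dist_norm norm_minus_commute norm_lt_square dot_square_norm)
  have P: "0 \<le> P x" "P x \<le> 1" for x
    unfolding P_def by (intro prod_nonneg prod_le_1 conjI ballI less_imp_le[OF b(1)] b(2))+
  have out: "P x = 1" if "x \<notin> (\<Union>c\<in>C. ball c r)" for x
    unfolding P_def using that b1 b(2) by (intro prod.neutral) (metis UN_I antisym_conv1 less_eq_real_def)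
  have ins: "P x < 1" if x: "x \<in> (\<Union>c\<in>C. ball c r)" for x
  proof -
    obtain c where c: "c \<in> C" "x \<in> ball c r" using x by blast
    have "P x = b c x * (\<Prod>c\<in>C - {c}. b c x)"
      unfolding P_def using c assms(1) by (simp add: prod.remove)
    also have "\<dots> \<le> b c x * 1"
      using b by (intro mult_left_mono prod_le_1) (auto simp: less_imp_le)
    finally show ?thesis using b1 c by (metis mult.right_neutral order.strict_trans1)
  qed
  have "bump_algebra (\<lambda>x. P x)"
    unfolding P_def b_def
    by (intro bump_algebra_prod assms bump_algebra_diff bump_algebra.const bump_algebra.flat)
  then have sm: "smooth (\<phi> m)" for m
    unfolding \<phi>_def
    by (intro bump_algebra_smooth bump_algebra_diff bump_algebra.const bump_algebra_power)
  have zero: "\<phi> m x = 0" if "x \<notin> (\<Union>c\<in>C. ball c r)" for m x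
    using out[OF that] by (simp add: \<phi>_def)
  show ?thesis
  proof (rule that)
    show "test_function \<Omega> (\<phi> m)" for m
    proof (rule test_functionI[OF sm])
      show "compact (\<Union>c\<in>C. cball c r)" using assms(1) by (intro compact_UN) auto
      show "\<phi> m x = 0" if "x \<notin> (\<Union>c\<in>C. cball c r)" for x
        using that zero by force
    qed (use assms in auto)
    show "0 \<le> \<phi> m x" for m x using P by (simp add: \<phi>_def power_le_one)
    show "\<phi> m x \<le> 1" for m x using P by (simp add: \<phi>_def)
    show "(\<lambda>m. \<phi> m x) \<longlonglongrightarrow> 1" if "x \<in> (\<Union>c\<in>C. ball c r)" for x
    proof -
      have "(\<lambda>m. P x ^ m) \<longlonglongrightarrow> 0"
        using ins[OF that] P(1)[of x] by (intro LIMSEQ_power_zero) auto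
      from tendsto_diff[OF tendsto_const[of 1] this] show ?thesis by (simp add: \<phi>_def)
    qed
  qed (use zero in auto)
qed

text \<open>The integral against indicators of compact sets is recovered by approximating those first by
  finite unions of balls and these by test functions.\<close>

lemma AE_nonneg_if_test_nonneg:
  fixes v :: "real ^ 'n \<Rightarrow> real"
  assumes op: "open \<Omega>" and li: "locally_integrable \<Omega> v"
    and test: "\<And>\<phi>. test_function \<Omega> \<phi> \<Longrightarrow> (\<And>x. 0 \<le> \<phi> x) \<Longrightarrow> 0 \<le> (LINT x|lebesgue_on \<Omega>. v x * \<phi> x)"
  shows "AE x in lebesgue_on \<Omega>. 0 \<le> v x"
proof -
  have int: "integrable lebesgue (\<lambda>x. v x * indicator K x)" if "compact K" "K \<subseteq> \<Omega>" for K
    using li that unfolding locally_integrable_def set_integrable_def by (simp add: mult.commute)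
  have balls: "0 \<le> (LINT x|lebesgue. v x * indicator (\<Union>c\<in>C. ball c r) x)"
    if C: "finite C" "r > 0" "(\<Union>c\<in>C. cball c r) \<subseteq> \<Omega>" for C r
  proof -
    let ?U = "\<Union>c\<in>C. ball c r" and ?L = "\<Union>c\<in>C. cball c r"
    obtain \<phi> where \<phi>: "\<And>m::nat. test_function \<Omega> (\<phi> m)" "\<And>m x. 0 \<le> \<phi> m x" "\<And>m x. \<phi> m x \<le> 1"
      "\<And>m x. x \<notin> ?U \<Longrightarrow> \<phi> m x = 0" "\<And>x. x \<in> ?U \<Longrightarrow> (\<lambda>m. \<phi> m x) \<longlonglongrightarrow> 1"
      using ball_union_cutoff[OF C] by metis
    have L: "compact ?L" using C(1) by (intro compact_UN) auto
    have i: "integrable lebesgue (\<lambda>x. v x * indicator ?L x)" using int[OF L C(3)] .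
    have "(\<lambda>m. LINT x|lebesgue. v x * \<phi> m x) \<longlonglongrightarrow> (LINT x|lebesgue. v x * indicator ?U x)"
    proof (rule integral_dominated_convergence[where w = "\<lambda>x. norm (v x * indicator ?L x)"])
      have "?U \<in> sets lebesgue" by (intro lmeasurable_open[THEN fmeasurableD] bounded_UN) (use C in auto)
      then have "(\<lambda>x. (v x * indicator ?L x) * indicator ?U x) \<in> borel_measurable lebesgue"
        by (rule borel_measurable_times[OF borel_measurable_integrable[OF i] borel_measurable_indicator])
      moreover have "(v x * indicator ?L x) * indicator ?U x = v x * indicator ?U x" for x
        by (rule indicator_mult_subset(1)) (use ball_subset_cball in blast)
      ultimately show "(\<lambda>x. v x * indicator ?U x) \<in> borel_measurable lebesgue" by simp
      show "(\<lambda>x. v x * \<phi> m x) \<in> borel_measurable lebesgue" for m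
        using locally_integrable_test[OF li \<phi>(1)] by (rule borel_measurable_integrable)
      show "integrable lebesgue (\<lambda>x. norm (v x * indicator ?L x))" using i by (rule integrable_norm)
      show "AE x in lebesgue. (\<lambda>m. v x * \<phi> m x) \<longlonglongrightarrow> v x * indicator ?U x"
      proof (intro AE_I2 tendsto_mult tendsto_const)
        show "(\<lambda>m. \<phi> m x) \<longlonglongrightarrow> indicator ?U x" for x
          using \<phi>(4,5)[of x] by (cases "x \<in> ?U") auto
      qed
      show "AE x in lebesgue. norm (v x * \<phi> m x) \<le> norm (v x * indicator ?L x)" for m
      proof (rule AE_I2)
        fix x
        have "\<bar>\<phi> m x\<bar> \<le> indicator ?L x"
        proof (cases "x \<in> ?U")
          case True
          then have "x \<in> ?L" using ball_subset_cball by blast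
          then show ?thesis using \<phi>(2,3)[of m x] by simp
        next
          case False
          then show ?thesis using \<phi>(4)[of x m] by simp
        qed
        then show "norm (v x * \<phi> m x) \<le> norm (v x * indicator ?L x)"
          by (auto simp: abs_mult intro!: mult_left_mono)
      qed
    qed
    moreover have "0 \<le> (LINT x|lebesgue. v x * \<phi> m x)" for m
      using test[OF \<phi>(1)[of m] \<phi>(2)] integral_test_function(1)[OF op \<phi>(1)] by simp
    ultimately show ?thesis by (meson LIMSEQ_le_const)
  qed
  have compacts: "0 \<le> (LINT x|lebesgue. v x * indicator K x)" if K: "compact K" "K \<subseteq> \<Omega>" for K
  proof -
    \<comment> \<open>One fixed thickening of \<open>K\<close> inside the domain carries the
      dominating function. The covering balls have radii at most \<open>\<epsilon>\<close> that tend
      to zero, so the indicators of their unions converge to that of \<open>K\<close>.\<close>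
    obtain \<epsilon> where \<epsilon>: "\<epsilon> > 0" "(\<Union>x\<in>K. cball x \<epsilon>) \<subseteq> \<Omega>"
      using compact_subset_open_imp_cball_epsilon_subset[OF K(1) op K(2)] .
    define r where "r n = min \<epsilon> (inverse (real (Suc n)))" for n
    have r: "r n > 0" "r n \<le> \<epsilon>" "r n \<le> inverse (real (Suc n))" for n using \<epsilon> by (auto simp: r_def)
    have "\<forall>n. \<exists>C. finite C \<and> C \<subseteq> K \<and> K \<subseteq> (\<Union>c\<in>C. ball c (r n))"
      using compact_cover_balls[OF K(1) r(1)] by metis
    then obtain C where C: "\<And>n. finite (C n)" "\<And>n. C n \<subseteq> K" "\<And>n. K \<subseteq> (\<Union>c\<in>C n. ball c (r n))"
      by metis
    let ?U = "\<lambda>n. \<Union>c\<in>C n. ball c (r n)" and ?L = "\<Union>x\<in>K. cball x \<epsilon>"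
    have L: "compact ?L" by (rule compact_thickening[OF K(1)])
    have i: "integrable lebesgue (\<lambda>x. v x * indicator ?L x)" using int[OF L \<epsilon>(2)] .
    have sub: "?U n \<subseteq> ?L" for n using C(2)[of n] r(2)[of n] by force
    have "(\<lambda>n. LINT x|lebesgue. v x * indicator (?U n) x) \<longlonglongrightarrow> (LINT x|lebesgue. v x * indicator K x)"
    proof (rule integral_dominated_convergence[where w = "\<lambda>x. norm (v x * indicator ?L x)"])
      show "(\<lambda>x. v x * indicator K x) \<in> borel_measurable lebesgue" using int[OF K] by auto
      show "(\<lambda>x. v x * indicator (?U n) x) \<in> borel_measurable lebesgue" for n
      proof -
        have "?U n \<in> sets lebesgue" by (intro lmeasurable_open[THEN fmeasurableD] bounded_UN) (use C in auto)
        then have "(\<lambda>x. (v x * indicator ?L x) * indicator (?U n) x) \<in> borel_measurable lebesgue"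
          by (rule borel_measurable_times[OF borel_measurable_integrable[OF i] borel_measurable_indicator])
        moreover have "(v x * indicator ?L x) * indicator (?U n) x = v x * indicator (?U n) x" for x
          by (rule indicator_mult_subset(1)[OF sub])
        ultimately show ?thesis by simp
      qed
      show "integrable lebesgue (\<lambda>x. norm (v x * indicator ?L x))" using i by (rule integrable_norm)
      show "AE x in lebesgue. (\<lambda>n. v x * indicator (?U n) x) \<longlonglongrightarrow> v x * indicator K x"
      proof (intro AE_I2 tendsto_mult tendsto_const)
        fix x
        show "(\<lambda>n. indicator (?U n) x :: real) \<longlonglongrightarrow> indicator K x"
        proof (cases "x \<in> K")
          case True
          then have "x \<in> ?U n" for n using C(3) by blast
          then show ?thesis using True by simp
        next
          case False
          then obtain \<delta> where \<delta>: "\<delta> > 0" "\<And>y. y \<in> K \<Longrightarrow> \<delta> \<le> dist y x"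
            using separate_point_closed[OF compact_imp_closed[OF K(1)] False] by (metis dist_commute)
          obtain N where N: "inverse (real (Suc N)) < \<delta>" using reals_Archimedean[OF \<delta>(1)] by blast
          have "x \<notin> ?U n" if "n \<ge> N" for n
          proof
            assume "x \<in> ?U n"
            then obtain c where "c \<in> K" "dist c x < r n" using C(2) by auto
            moreover have "inverse (real (Suc n)) \<le> inverse (real (Suc N))"
              using that by (intro le_imp_inverse_le) auto
            ultimately show False using \<delta>(2)[of c] r(3)[of n] N by linarith
          qed
          then have "indicator (?U n) x = (0::real)" if "n \<ge> N" for n
            using that indicator_simps(2) by metis
          then have "eventually (\<lambda>n. indicator (?U n) x = (0::real)) sequentially"
            unfolding eventually_sequentially by blast
          then show ?thesis using False by (simp add: tendsto_eventually)
        qed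
      qed
      show "AE x in lebesgue. norm (v x * indicator (?U n) x) \<le> norm (v x * indicator ?L x)" for n
        by (intro AE_I2) (rule indicator_mult_subset(2)[OF sub])
    qed
    moreover have "0 \<le> (LINT x|lebesgue. v x * indicator (?U n) x)" for n
    proof (rule balls[OF C(1) r(1)])
      show "(\<Union>c\<in>C n. cball c (r n)) \<subseteq> \<Omega>"
        using \<epsilon>(2) C(2)[of n] r(2)[of n] by (force simp: subset_eq)
    qed
    ultimately show ?thesis by (meson LIMSEQ_le_const)
  qed
  \<comment> \<open>On a compact part of the negative set the integral of \<open>v\<close> is
    nonnegative by the previous step although the integrand is negative there, so that part must be
    null.\<close>
  have null: "K \<in> null_sets lebesgue" if K: "compact K" "K \<subseteq> {x \<in> \<Omega>. v x < 0}" for K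
  proof -
    have K': "K \<subseteq> \<Omega>" using K by auto
    have i: "integrable lebesgue (\<lambda>x. - (v x * indicator K x))" using int[OF K(1) K'] by simp
    have nn: "0 \<le> - (v x * indicator K x)" for x using K(2) by (auto simp: indicator_def less_imp_le)
    have "(LINT x|lebesgue. - (v x * indicator K x)) \<le> 0" using compacts[OF K(1) K'] by simp
    moreover have "0 \<le> (LINT x|lebesgue. - (v x * indicator K x))"
      by (rule Bochner_Integration.integral_nonneg) (rule nn)
    ultimately have "AE x in lebesgue. - (v x * indicator K x) = 0"
      using integral_nonneg_eq_0_iff_AE[OF i] nn by auto
    then have "AE x in lebesgue. x \<notin> K"
      by eventually_elim (use K(2) in \<open>auto simp: indicator_def split: if_splits\<close>)
    moreover have "K \<in> sets lebesgue" using K(1) lmeasurable_compact fmeasurableD by blast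
    ultimately show ?thesis by (simp add: AE_iff_null_sets)
  qed
  let ?N = "{x \<in> \<Omega>. v x < 0}"
  have N: "?N \<in> sets lebesgue"
  proof -
    have "(\<lambda>x. if x \<in> \<Omega> then v x else 0) \<in> borel_measurable lebesgue"
      using locally_integrable_measurable[OF op li] op by (intro borel_measurable_if_I) auto
    then have "{x \<in> space lebesgue. (if x \<in> \<Omega> then v x else 0) < 0} \<in> sets lebesgue"
      by (rule borel_measurable_less) simp
    moreover have "{x \<in> space lebesgue. (if x \<in> \<Omega> then v x else 0) < 0} = ?N" by auto
    ultimately show ?thesis by simp
  qed
  \<comment> \<open>Inner regularity: up to a null set the negative set is a countable union of
    compact sets, each of which has just been seen to be null.\<close>
  from lebesgue_set_almost_fsigma[OF N]
  obtain C T where CT: "fsigma C" "T \<in> null_sets lebesgue" "C \<union> T = ?N" .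
  from CT(1) obtain F :: "nat \<Rightarrow> (real ^ 'n) set" where F': "range F \<subseteq> Collect compact"
    and F: "C = \<Union>(F ` UNIV)"
    unfolding fsigma_Union_compact by blast
  have "C \<in> null_sets lebesgue"
    unfolding F
  proof (intro null_sets_UN null)
    show "compact (F n)" for n using F' by blast
    show "F n \<subseteq> ?N" for n using CT(3) F by blast
  qed
  then have "?N \<in> null_sets lebesgue"
    using CT(2,3) null_sets.Un by metis
  then have "AE x in lebesgue. x \<notin> ?N" by (rule AE_not_in)
  then have "AE x in lebesgue. x \<in> \<Omega> \<longrightarrow> 0 \<le> v x" by eventually_elim auto
  then show ?thesis
    using op by (simp add: AE_restrict_space_iff)
qed

text \<open>The sign lemma applies to \<open>v\<close> and to its negative.\<close>

lemma AE_zero_if_test_zero: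
  fixes v :: "real ^ 'n \<Rightarrow> real"
  assumes op: "open \<Omega>" and li: "locally_integrable \<Omega> v"
    and test: "\<And>\<phi>. test_function \<Omega> \<phi> \<Longrightarrow> (LINT x|lebesgue_on \<Omega>. v x * \<phi> x) = 0"
  shows "AE x in lebesgue_on \<Omega>. v x = 0"
proof -
  have "AE x in lebesgue_on \<Omega>. 0 \<le> v x"
    by (rule AE_nonneg_if_test_nonneg[OF op li]) (simp add: test)
  moreover have "locally_integrable \<Omega> (\<lambda>x. - v x)"
    using locally_integrable_lincomb[OF li li, of "-1" 0] by simp
  then have "AE x in lebesgue_on \<Omega>. 0 \<le> - v x"
    by (rule AE_nonneg_if_test_nonneg[OF op]) (simp add: test)
  ultimately show ?thesis by eventually_elim simp
qed

section \<open>Weak derivatives\<close>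

lemma lebesgue_translation:
  fixes h :: "'a::euclidean_space"
  shows "(\<lambda>x. x + h) \<in> lebesgue \<rightarrow>\<^sub>M lebesgue"
    and "distr lebesgue lebesgue (\<lambda>x. x + h) = lebesgue"
proof -
  have T: "(\<lambda>x. h + (\<Sum>j\<in>Basis. (1 * (x \<bullet> j)) *\<^sub>R j)) = (\<lambda>x. x + h)"
    by (simp add: euclidean_representation add.commute)
  show "(\<lambda>x. x + h) \<in> lebesgue \<rightarrow>\<^sub>M lebesgue"
    using lebesgue_affine_measurable[of "\<lambda>_. 1" h] unfolding T by simp
  have "lebesgue = density (distr lebesgue lebesgue (\<lambda>x. x + h)) (\<lambda>_. 1)"
    using lebesgue_affine_euclidean[of "\<lambda>_. 1" h] unfolding T by simp
  also have "\<dots> = distr lebesgue lebesgue (\<lambda>x. x + h)" by (simp add: density_1)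
  finally show "distr lebesgue lebesgue (\<lambda>x. x + h) = lebesgue" ..
qed

lemma integrable_translate:
  fixes f :: "'a::euclidean_space \<Rightarrow> real"
  assumes "integrable lebesgue f"
  shows "integrable lebesgue (\<lambda>x. f (x + h))"
  using assms integrable_distr[OF lebesgue_translation(1)] lebesgue_translation(2) by metis

lemma integral_translate:
  fixes f :: "'a::euclidean_space \<Rightarrow> real"
  assumes "f \<in> borel_measurable lebesgue"
  shows "(LINT x|lebesgue. f (x + h)) = (LINT x|lebesgue. f x)"
  using integral_distr[OF lebesgue_translation(1) assms, of h] by (simp add: lebesgue_translation(2))

text \<open>Difference quotients in direction \<open>k\<close> have integral zero by translation
  invariance. By the mean value theorem they obey the same bound as the derivative, and they vanish
  off a fixed compact set, so dominated convergence carries the zero over to the derivative.\<close>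

lemma integral_compact_support_partial_deriv:
  fixes f :: "real ^ 'n \<Rightarrow> real"
  assumes diff: "\<And>x. f differentiable (at x)" and cont: "continuous_on UNIV (partial_deriv [k] f)"
    and K: "compact K" "\<And>x. x \<notin> K \<Longrightarrow> f x = 0"
  shows "(LINT x|lebesgue. partial_deriv [k] f x) = 0"
proof -
  have "partial_deriv [k] f x = 0" if "x \<notin> K" for x
    by (rule partial_deriv_outside[OF compact_imp_closed[OF K(1)] K(2) that])
  then obtain C where C: "0 \<le> C" "\<And>x. \<bar>partial_deriv [k] f x\<bar> \<le> C"
    using continuous_compact_support_bounded[OF cont K(1)] by blast
  define h where "h n = inverse (real (Suc n))" for n
  have h: "0 < h n" "h n \<le> 1" for n by (auto simp: h_def inverse_le_1_iff)
  have h0: "h \<longlonglongrightarrow> 0" unfolding h_def by (rule LIMSEQ_inverse_real_of_nat)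
  define q where "q n x = (f (x + h n *\<^sub>R axis k 1) - f x) / h n" for n x
  \<comment> \<open>As all \<open>h n\<close> are at most 1, thickening by 1 covers the supports of
    all quotients at once.\<close>
  let ?L = "\<Union>x\<in>K. cball x 1"
  have L: "compact ?L" using K(1) by (rule compact_thickening)
  have f: "continuous_on UNIV f"
    using diff by (simp add: continuous_at_imp_continuous_on differentiable_imp_continuous_within)
  have fm: "f \<in> borel_measurable lebesgue" using f by (rule borel_measurable_lebesgue_continuous)
  have fi: "integrable lebesgue f"
    by (rule integrable_continuous_compact_support[OF f K])
  have fi': "integrable lebesgue (\<lambda>x. f (x + v))" for v using fi by (rule integrable_translate)
  have zero: "(LINT x|lebesgue. q n x) = 0" for n
    unfolding q_def using fi fi' integral_translate[OF fm] by simp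
  have mvt: "\<bar>q n x\<bar> \<le> C" for n x
  proof -
    have "\<And>s. ((\<lambda>s. f (x + s *\<^sub>R axis k 1)) has_real_derivative
           partial_deriv [k] f (x + s *\<^sub>R axis k 1)) (at s)"
      by (rule has_real_derivative_axis[OF diff])
    from MVT2[OF h(1)[of n], of "\<lambda>s. f (x + s *\<^sub>R axis k 1)", OF this] obtain s where
      "f (x + h n *\<^sub>R axis k 1) - f (x + 0 *\<^sub>R axis k 1) = (h n - 0) * partial_deriv [k] f (x + s *\<^sub>R axis k 1)"
      by blast
    then have "q n x = partial_deriv [k] f (x + s *\<^sub>R axis k 1)"
      using h(1)[of n] by (simp add: q_def)
    then show ?thesis using C by simp
  qed
  have supp: "q n x = 0" if "x \<notin> ?L" for n x
  proof -
    have "x \<notin> K" using that by force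
    moreover have "x + h n *\<^sub>R axis k 1 \<notin> K"
    proof
      assume "x + h n *\<^sub>R axis k 1 \<in> K"
      moreover have "dist (x + h n *\<^sub>R axis k 1) x \<le> 1" using h[of n] by (simp add: dist_norm)
      ultimately show False using that by auto
    qed
    ultimately show ?thesis using K(2) by (simp add: q_def)
  qed
  have "(\<lambda>n. LINT x|lebesgue. q n x) \<longlonglongrightarrow> (LINT x|lebesgue. partial_deriv [k] f x)"
  proof (rule integral_dominated_convergence[where w = "\<lambda>x. C * indicator ?L x"])
    show "partial_deriv [k] f \<in> borel_measurable lebesgue"
      using cont by (rule borel_measurable_lebesgue_continuous)
    show "q n \<in> borel_measurable lebesgue" for n
      unfolding q_def using borel_measurable_integrable[OF fi'] fm by simp
    show "integrable lebesgue (\<lambda>x. C * indicator ?L x)"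
      using lmeasurable_compact[OF L]
      by (intro integrable_mult_right integrable_real_indicator) (auto simp: fmeasurable_def)
    show "AE x in lebesgue. norm (q n x) \<le> C * indicator ?L x" for n
    proof (rule AE_I2)
      show "norm (q n x) \<le> C * indicator ?L x" for x
        using mvt[of n x] supp[of x n] by (cases "x \<in> ?L") (simp_all only: indicator_simps, simp_all)
    qed
    show "AE x in lebesgue. (\<lambda>n. q n x) \<longlonglongrightarrow> partial_deriv [k] f x"
    proof (rule AE_I2)
      fix x
      have "((\<lambda>s. f (x + s *\<^sub>R axis k 1)) has_real_derivative
           partial_deriv [k] f (x + 0 *\<^sub>R axis k 1)) (at 0)"
        by (rule has_real_derivative_axis[OF diff])
      then have 1: "((\<lambda>s. (f (x + s *\<^sub>R axis k 1) - f x) / s) \<longlongrightarrow> partial_deriv [k] f x) (at 0)"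
        by (simp add: DERIV_def)
      have "filterlim h (at 0) sequentially"
        using h0 h(1) by (auto simp: filterlim_at less_imp_neq[THEN not_sym] intro!: always_eventually)
      from filterlim_compose[OF 1 this] show "(\<lambda>n. q n x) \<longlonglongrightarrow> partial_deriv [k] f x"
        by (simp add: q_def)
    qed
  qed
  then show ?thesis unfolding zero using LIMSEQ_unique tendsto_const by blast
qed

text \<open>The derivative of the product has compact support as soon as one factor has, so its
  integral vanishes; the product rule does the rest.\<close>

lemma integration_by_parts_test:
  fixes \<phi> \<psi> :: "real ^ 'n \<Rightarrow> real"
  assumes "smooth \<phi>" "test_function \<Omega> \<psi>"
  shows "(LINT x|lebesgue. \<phi> x * partial_deriv [k] \<psi> x) = - (LINT x|lebesgue. partial_deriv [k] \<phi> x * \<psi> x)"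
proof -
  obtain K where K: "smooth \<psi>" "compact K" "K \<subseteq> \<Omega>" "\<And>x. x \<notin> K \<Longrightarrow> \<psi> x = 0"
    using test_functionE[OF assms(2)] by metis
  have d: "((\<lambda>x. \<phi> x * \<psi> x) has_derivative (\<lambda>v. \<phi> x * frechet_derivative \<psi> (at x) v + frechet_derivative \<phi> (at x) v * \<psi> x)) (at x)" for x
    using smooth_differentiable[OF assms(1)] smooth_differentiable[OF K(1)]
    by (intro has_derivative_mult) (auto simp: frechet_derivative_works)
  have eq: "partial_deriv [k] (\<lambda>x. \<phi> x * \<psi> x) = (\<lambda>x. \<phi> x * partial_deriv [k] \<psi> x + partial_deriv [k] \<phi> x * \<psi> x)"
    using partial_deriv_has_derivative[OF d] by (auto simp: partial_deriv_single)
  have c: "continuous_on UNIV \<phi>" "continuous_on UNIV \<psi>" "continuous_on UNIV (partial_deriv [k] \<phi>)" "continuous_on UNIV (partial_deriv [k] \<psi>)"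
    using assms(1) K(1) by (auto intro!: smooth_continuous_on smooth_partial_deriv)
  have z: "partial_deriv [k] \<psi> x = 0" if "x \<notin> K" for x
    by (rule partial_deriv_outside[OF compact_imp_closed[OF K(2)] K(4) that])
  have i: "integrable lebesgue (\<lambda>x. \<phi> x * partial_deriv [k] \<psi> x)" "integrable lebesgue (\<lambda>x. partial_deriv [k] \<phi> x * \<psi> x)"
    by (rule integrable_continuous_compact_support[OF continuous_on_mult K(2)]; use c z K(4) in simp)+
  have "(LINT x|lebesgue. partial_deriv [k] (\<lambda>x. \<phi> x * \<psi> x) x) = 0"
  proof (rule integral_compact_support_partial_deriv[OF _ _ K(2)])
    show "(\<lambda>x. \<phi> x * \<psi> x) differentiable at x" for x using d unfolding differentiable_def by blast
    show "continuous_on UNIV (partial_deriv [k] (\<lambda>x. \<phi> x * \<psi> x))"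
      unfolding eq using c by (intro continuous_on_add continuous_on_mult) auto
  qed (simp add: K(4))
  then show ?thesis using i by (simp add: eq)
qed

lemma integrable_on_test:
  fixes v :: "real ^ 'n \<Rightarrow> real"
  assumes "open \<Omega>" "locally_integrable \<Omega> v" "test_function \<Omega> \<phi>"
  shows "integrable (lebesgue_on \<Omega>) (\<lambda>x. v x * \<phi> x)"
  using integral_test_function(2)[OF assms(1,3)] locally_integrable_test[OF assms(2,3)] by blast

section \<open>Calculus of weak derivatives\<close>

lemma weak_deriv_test:
  fixes \<phi> :: "real ^ 'n \<Rightarrow> real"
  assumes "open \<Omega>" "smooth \<phi>"
  shows "weak_deriv \<Omega> [] \<phi> \<phi>" "weak_deriv \<Omega> [k] \<phi> (partial_deriv [k] \<phi>)"
proof -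
  have li: "locally_integrable \<Omega> \<phi>" "locally_integrable \<Omega> (partial_deriv [k] \<phi>)"
    using assms by (auto intro!: continuous_imp_locally_integrable smooth_continuous_on smooth_partial_deriv)
  show "weak_deriv \<Omega> [] \<phi> \<phi>" using li by (simp add: weak_deriv_def)
  show "weak_deriv \<Omega> [k] \<phi> (partial_deriv [k] \<phi>)"
    unfolding weak_deriv_def using li
    by (auto simp: integral_test_function(1)[OF assms(1)] integral_test_function(1)[OF assms(1) test_function_partial_deriv]
        integration_by_parts_test[OF assms(2)])
qed

lemma weak_deriv_unique:
  fixes u :: "real ^ 'n \<Rightarrow> real"
  assumes op: "open \<Omega>" and v: "weak_deriv \<Omega> ks u v" and w: "weak_deriv \<Omega> ks u w"
  shows "AE x in lebesgue_on \<Omega>. v x = w x"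
proof -
  have li: "locally_integrable \<Omega> v" "locally_integrable \<Omega> w" using v w by (auto simp: weak_deriv_def)
  have "AE x in lebesgue_on \<Omega>. v x - w x = 0"
  proof (rule AE_zero_if_test_zero[OF op])
    show "locally_integrable \<Omega> (\<lambda>x. v x - w x)"
      using locally_integrable_lincomb[OF li, of 1 "-1"] by simp
    fix \<phi> assume t: "test_function \<Omega> \<phi>"
    have "(LINT x|lebesgue_on \<Omega>. u x * partial_deriv ks \<phi> x) = (- 1) ^ length ks * (LINT x|lebesgue_on \<Omega>. v x * \<phi> x)"
      using v t unfolding weak_deriv_def by blast
    moreover have "(LINT x|lebesgue_on \<Omega>. u x * partial_deriv ks \<phi> x) = (- 1) ^ length ks * (LINT x|lebesgue_on \<Omega>. w x * \<phi> x)"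
      using w t unfolding weak_deriv_def by blast
    ultimately have "(LINT x|lebesgue_on \<Omega>. v x * \<phi> x) = (LINT x|lebesgue_on \<Omega>. w x * \<phi> x)" by simp
    then show "(LINT x|lebesgue_on \<Omega>. (v x - w x) * \<phi> x) = 0"
      using integrable_on_test[OF op li(1) t] integrable_on_test[OF op li(2) t] by (simp add: left_diff_distrib)
  qed
  then show ?thesis by eventually_elim simp
qed

lemma weak_deriv_wderiv:
  assumes "weak_deriv \<Omega> ks u v"
  shows "weak_deriv \<Omega> ks u (wderiv \<Omega> ks u)"
  unfolding wderiv_def using someI[of "weak_deriv \<Omega> ks u", OF assms] .

lemma wderiv_AE:
  fixes u :: "real ^ 'n \<Rightarrow> real"
  assumes "open \<Omega>" "weak_deriv \<Omega> ks u v"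
  shows "AE x in lebesgue_on \<Omega>. wderiv \<Omega> ks u x = v x"
  using weak_deriv_unique[OF assms(1) weak_deriv_wderiv[OF assms(2)] assms(2)] .

lemma weak_deriv_lincomb:
  fixes u u' :: "real ^ 'n \<Rightarrow> real"
  assumes op: "open \<Omega>" and v: "weak_deriv \<Omega> ks u v" and w: "weak_deriv \<Omega> ks u' w"
  shows "weak_deriv \<Omega> ks (\<lambda>x. a * u x + b * u' x) (\<lambda>x. a * v x + b * w x)"
  unfolding weak_deriv_def
proof (intro conjI allI impI)
  have li: "locally_integrable \<Omega> v" "locally_integrable \<Omega> w" "locally_integrable \<Omega> u" "locally_integrable \<Omega> u'"
    using v w by (auto simp: weak_deriv_def)
  show "locally_integrable \<Omega> (\<lambda>x. a * u x + b * u' x)" "locally_integrable \<Omega> (\<lambda>x. a * v x + b * w x)"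
    using li by (auto intro: locally_integrable_lincomb)
  fix \<phi> assume t: "test_function \<Omega> \<phi>"
  note i = integrable_on_test[OF op li(1) t] integrable_on_test[OF op li(2) t]
    integrable_on_test[OF op li(3) test_function_partial_deriv[OF t, of ks]]
    integrable_on_test[OF op li(4) test_function_partial_deriv[OF t, of ks]]
  have "(LINT x|lebesgue_on \<Omega>. (a * u x + b * u' x) * partial_deriv ks \<phi> x)
      = (LINT x|lebesgue_on \<Omega>. a * (u x * partial_deriv ks \<phi> x) + b * (u' x * partial_deriv ks \<phi> x))"
    by (simp add: algebra_simps)
  also have "\<dots> = a * (LINT x|lebesgue_on \<Omega>. u x * partial_deriv ks \<phi> x) + b * (LINT x|lebesgue_on \<Omega>. u' x * partial_deriv ks \<phi> x)"
    using i by simp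
  also have "\<dots> = (- 1) ^ length ks * (a * (LINT x|lebesgue_on \<Omega>. v x * \<phi> x) + b * (LINT x|lebesgue_on \<Omega>. w x * \<phi> x))"
    using v w t unfolding weak_deriv_def by (simp add: algebra_simps)
  also have "a * (LINT x|lebesgue_on \<Omega>. v x * \<phi> x) + b * (LINT x|lebesgue_on \<Omega>. w x * \<phi> x)
      = (LINT x|lebesgue_on \<Omega>. a * (v x * \<phi> x) + b * (w x * \<phi> x))"
    using i by simp
  also have "\<dots> = (LINT x|lebesgue_on \<Omega>. (a * v x + b * w x) * \<phi> x)"
    by (simp add: algebra_simps)
  finally show "(LINT x|lebesgue_on \<Omega>. (a * u x + b * u' x) * partial_deriv ks \<phi> x) =
      (- 1) ^ length ks * (LINT x|lebesgue_on \<Omega>. (a * v x + b * w x) * \<phi> x)" .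
qed

lemma weak_deriv_cong_AE:
  fixes u u' :: "real ^ 'n \<Rightarrow> real"
  assumes op: "open \<Omega>" and d: "weak_deriv \<Omega> ks u v"
    and u: "AE x in lebesgue_on \<Omega>. u x = u' x" and v: "AE x in lebesgue_on \<Omega>. v x = v' x"
  shows "weak_deriv \<Omega> ks u' v'"
  unfolding weak_deriv_def
proof (intro conjI allI impI)
  have li: "locally_integrable \<Omega> u" "locally_integrable \<Omega> v"
    using d by (auto simp: weak_deriv_def)
  show li': "locally_integrable \<Omega> u'" "locally_integrable \<Omega> v'"
    using locally_integrable_cong_AE[OF op li(1) u] locally_integrable_cong_AE[OF op li(2) v] .
  note m = locally_integrable_measurable[OF op li(1)] locally_integrable_measurable[OF op li(2)]
    locally_integrable_measurable[OF op li'(1)] locally_integrable_measurable[OF op li'(2)]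
  fix \<phi> assume t: "test_function \<Omega> \<phi>"
  have t': "test_function \<Omega> (partial_deriv ks \<phi>)" using t by (rule test_function_partial_deriv)
  have "(LINT x|lebesgue_on \<Omega>. u' x * partial_deriv ks \<phi> x) = (LINT x|lebesgue_on \<Omega>. u x * partial_deriv ks \<phi> x)"
    by (rule integral_cong_AE)
      (use m test_function_measurable[OF t'] u in \<open>auto intro!: borel_measurable_times elim: eventually_mono\<close>)
  also have "\<dots> = (- 1) ^ length ks * (LINT x|lebesgue_on \<Omega>. v x * \<phi> x)"
    using d t unfolding weak_deriv_def by blast
  also have "(LINT x|lebesgue_on \<Omega>. v x * \<phi> x) = (LINT x|lebesgue_on \<Omega>. v' x * \<phi> x)"
    by (rule integral_cong_AE)
      (use m test_function_measurable[OF t] v in \<open>auto intro!: borel_measurable_times elim: eventually_mono\<close>)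
  finally show "(LINT x|lebesgue_on \<Omega>. u' x * partial_deriv ks \<phi> x) = (- 1) ^ length ks * (LINT x|lebesgue_on \<Omega>. v' x * \<phi> x)" .
qed

text \<open>All differentiation falls on the test function, so the symmetry of its second
  derivatives is enough.\<close>

lemma weak_deriv_commute: "weak_deriv \<Omega> [i, j] u v \<Longrightarrow> weak_deriv \<Omega> [j, i] u v"
  by (simp add: weak_deriv_def test_function_def partial_deriv_commute[of _ j i])

text \<open>The first derivative is tested with the \<open>j\<close>-th derivative of
  \<open>\<phi>\<close>, which is again a test function. This allows the components of the gradient
  to be treated as functions whose gradients are the rows of the Hessian.\<close>

lemma weak_deriv_of_weak_deriv:
  fixes u :: "real ^ 'n \<Rightarrow> real"
  assumes f: "weak_deriv \<Omega> [i] u f" and H: "weak_deriv \<Omega> [i, j] u h"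
  shows "weak_deriv \<Omega> [j] f h"
  unfolding weak_deriv_def
proof (intro conjI allI impI)
  show "locally_integrable \<Omega> f" "locally_integrable \<Omega> h" using f H by (auto simp: weak_deriv_def)
  fix \<phi> assume t: "test_function \<Omega> \<phi>"
  have "(LINT x|lebesgue_on \<Omega>. u x * partial_deriv [i] (partial_deriv [j] \<phi>) x) = - (LINT x|lebesgue_on \<Omega>. f x * partial_deriv [j] \<phi> x)"
    using f test_function_partial_deriv[OF t, of "[j]"] unfolding weak_deriv_def by simp
  moreover have "(LINT x|lebesgue_on \<Omega>. u x * partial_deriv [i, j] \<phi> x) = (LINT x|lebesgue_on \<Omega>. h x * \<phi> x)"
    using H t unfolding weak_deriv_def by simp
  ultimately show "(LINT x|lebesgue_on \<Omega>. f x * partial_deriv [j] \<phi> x) = (- 1) ^ length [j] * (LINT x|lebesgue_on \<Omega>. h x * \<phi> x)"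
    by (simp add: partial_deriv_Cons[of i "[j]"])
qed

lemma tendsto_integral_test:
  fixes w :: "nat \<Rightarrow> real ^ 'n \<Rightarrow> real"
  assumes op: "open \<Omega>" and t: "test_function \<Omega> \<phi>"
    and i: "\<And>n. integrable (lebesgue_on \<Omega>) (w n)" "integrable (lebesgue_on \<Omega>) w'"
    and lim: "(\<lambda>n. LINT x|lebesgue_on \<Omega>. \<bar>w n x - w' x\<bar>) \<longlonglongrightarrow> 0"
  shows "(\<lambda>n. LINT x|lebesgue_on \<Omega>. w n x * \<phi> x) \<longlonglongrightarrow> (LINT x|lebesgue_on \<Omega>. w' x * \<phi> x)"
proof -
  obtain C where C: "0 \<le> C" "\<And>x. \<bar>\<phi> x\<bar> \<le> C" using test_function_bounded[OF t] by metis
  have \<Omega>: "\<Omega> \<in> sets lebesgue" using op by auto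
  have i': "integrable (lebesgue_on \<Omega>) (\<lambda>x. w n x * \<phi> x)" "integrable (lebesgue_on \<Omega>) (\<lambda>x. w' x * \<phi> x)" for n
    using integrable_on_test[OF op integrable_imp_locally_integrable[OF i(1) \<Omega>] t]
      integrable_on_test[OF op integrable_imp_locally_integrable[OF i(2) \<Omega>] t] .
  have b: "norm ((LINT x|lebesgue_on \<Omega>. w n x * \<phi> x) - (LINT x|lebesgue_on \<Omega>. w' x * \<phi> x))
      \<le> C * (LINT x|lebesgue_on \<Omega>. \<bar>w n x - w' x\<bar>)" for n
  proof -
    have "(LINT x|lebesgue_on \<Omega>. w n x * \<phi> x) - (LINT x|lebesgue_on \<Omega>. w' x * \<phi> x)
        = (LINT x|lebesgue_on \<Omega>. w n x * \<phi> x - w' x * \<phi> x)" using i' by simp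
    also have "norm \<dots> \<le> (LINT x|lebesgue_on \<Omega>. \<bar>w n x * \<phi> x - w' x * \<phi> x\<bar>)"
      using integral_norm_bound[of "lebesgue_on \<Omega>"] by simp
    also have "\<dots> \<le> (LINT x|lebesgue_on \<Omega>. C * \<bar>w n x - w' x\<bar>)"
    proof (rule integral_mono)
      show "\<bar>w n x * \<phi> x - w' x * \<phi> x\<bar> \<le> C * \<bar>w n x - w' x\<bar>" for x
        using C(2)[of x] by (simp add: left_diff_distrib[symmetric] abs_mult mult.commute[of C] mult_left_mono)
    qed (use i i' in auto)
    also have "\<dots> = C * (LINT x|lebesgue_on \<Omega>. \<bar>w n x - w' x\<bar>)" by simp
    finally show ?thesis .
  qed
  have "(\<lambda>n. C * (LINT x|lebesgue_on \<Omega>. \<bar>w n x - w' x\<bar>)) \<longlonglongrightarrow> 0"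
    using lim by (rule tendsto_mult_right_zero)
  then have "(\<lambda>n. (LINT x|lebesgue_on \<Omega>. w n x * \<phi> x) - (LINT x|lebesgue_on \<Omega>. w' x * \<phi> x)) \<longlonglongrightarrow> 0"
    by (rule Lim_null_comparison[OF always_eventually[OF allI[OF b]]])
  then show ?thesis by (rule LIM_zero_cancel)
qed

text \<open>Weak differentiation is a closed operation: test functions and their derivatives are
  bounded, so both sides of the defining identity pass to limits in the mean.\<close>

lemma weak_deriv_limit:
  fixes w :: "nat \<Rightarrow> real ^ 'n \<Rightarrow> real"
  assumes op: "open \<Omega>" and d: "\<And>n. weak_deriv \<Omega> ks (w n) (v n)"
    and iw: "\<And>n. integrable (lebesgue_on \<Omega>) (w n)" "integrable (lebesgue_on \<Omega>) w'"
    and iv: "\<And>n. integrable (lebesgue_on \<Omega>) (v n)" "integrable (lebesgue_on \<Omega>) v'"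
    and limw: "(\<lambda>n. LINT x|lebesgue_on \<Omega>. \<bar>w n x - w' x\<bar>) \<longlonglongrightarrow> 0"
    and limv: "(\<lambda>n. LINT x|lebesgue_on \<Omega>. \<bar>v n x - v' x\<bar>) \<longlonglongrightarrow> 0"
  shows "weak_deriv \<Omega> ks w' v'"
  unfolding weak_deriv_def
proof (intro conjI allI impI)
  have \<Omega>: "\<Omega> \<in> sets lebesgue" using op by auto
  show "locally_integrable \<Omega> w'" "locally_integrable \<Omega> v'"
    using integrable_imp_locally_integrable iw(2) iv(2) \<Omega> by blast+
  fix \<phi> assume t: "test_function \<Omega> \<phi>"
  have 1: "(\<lambda>n. LINT x|lebesgue_on \<Omega>. w n x * partial_deriv ks \<phi> x) \<longlonglongrightarrow> (LINT x|lebesgue_on \<Omega>. w' x * partial_deriv ks \<phi> x)"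
    by (rule tendsto_integral_test[OF op test_function_partial_deriv[OF t] iw limw])
  have "(\<lambda>n. (- 1) ^ length ks * (LINT x|lebesgue_on \<Omega>. v n x * \<phi> x)) \<longlonglongrightarrow> (- 1) ^ length ks * (LINT x|lebesgue_on \<Omega>. v' x * \<phi> x)"
    by (intro tendsto_mult tendsto_const tendsto_integral_test[OF op t iv limv])
  moreover have "(LINT x|lebesgue_on \<Omega>. w n x * partial_deriv ks \<phi> x) = (- 1) ^ length ks * (LINT x|lebesgue_on \<Omega>. v n x * \<phi> x)" for n
    using d t unfolding weak_deriv_def by blast
  ultimately show "(LINT x|lebesgue_on \<Omega>. w' x * partial_deriv ks \<phi> x) = (- 1) ^ length ks * (LINT x|lebesgue_on \<Omega>. v' x * \<phi> x)"
    using LIMSEQ_unique[OF 1] by simp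
qed

section \<open>Spaces of p-integrable functions\<close>

lemma powr_above_tangent:
  fixes p m t :: real
  assumes p: "1 < p" and m: "0 < m" and t: "0 \<le> t" "t \<noteq> m"
  shows "m powr p + p * m powr (p - 1) * (t - m) < t powr p"
proof -
  have der: "((\<lambda>x. x powr p) has_real_derivative p * x powr (p - 1)) (at x)" if "0 < x" for x
    using that by (auto intro!: derivative_eq_intros)
  then have diff: "(\<lambda>x. x powr p) differentiable (at x)" if "0 < x" for x
    using that real_differentiable_def by blast
  have cont: "continuous_on {a..b} (\<lambda>x. x powr p)" if "0 \<le> a" for a b
    using that p by (intro continuous_on_powr') (auto intro: continuous_intros)
  \<comment> \<open>Differentiability is needed in the open interval only, continuity up to its
    ends. This is how the end point 0 is included.\<close>
  have mvt: "\<exists>z. a < z \<and> z < b \<and> b powr p - a powr p = (b - a) * (p * z powr (p - 1))"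
    if "0 \<le> a" "a < b" for a b
  proof -
    have "\<exists>l z. a < z \<and> z < b \<and> DERIV (\<lambda>x. x powr p) z :> l \<and> b powr p - a powr p = (b - a) * l"
      by (rule MVT[OF that(2) cont[OF that(1)]])
        (use diff that in auto)
    then obtain l z where z: "a < z" "z < b" "DERIV (\<lambda>x. x powr p) z :> l"
      "b powr p - a powr p = (b - a) * l" by blast
    moreover have "l = p * z powr (p - 1)" using DERIV_unique[OF z(3) der] z(1) that by simp
    ultimately show ?thesis by blast
  qed
  consider "t < m" | "m < t" using t(2) by linarith
  then show ?thesis
  proof cases
    case 1
    then obtain z where z: "t < z" "z < m" "m powr p - t powr p = (m - t) * (p * z powr (p - 1))"
      using mvt[OF t(1)] by blast
    have "z powr (p - 1) < m powr (p - 1)" using z(1,2) t(1) p by (intro powr_less_mono2) auto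
    then have "(m - t) * (p * z powr (p - 1)) < (m - t) * (p * m powr (p - 1))"
      using p 1 by (intro mult_strict_left_mono) auto
    then show ?thesis using z(3) by (simp add: algebra_simps)
  next
    case 2
    then obtain z where z: "m < z" "z < t" "t powr p - m powr p = (t - m) * (p * z powr (p - 1))"
      using mvt[OF less_imp_le[OF m]] by blast
    have "m powr (p - 1) < z powr (p - 1)" using z(1,2) m p by (intro powr_less_mono2) auto
    then have "(t - m) * (p * m powr (p - 1)) < (t - m) * (p * z powr (p - 1))"
      using p 2 by (intro mult_strict_left_mono) auto
    then show ?thesis using z(3) by (simp add: algebra_simps)
  qed
qed

text \<open>Add the strict tangent inequalities taken at the midpoint; their linear terms
  cancel.\<close>

lemma powr_midpoint_less:
  fixes p x y :: real
  assumes p: "1 < p" and "0 \<le> x" "0 \<le> y" "x \<noteq> y"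
  shows "((x + y) / 2) powr p < (x powr p + y powr p) / 2"
proof -
  define m where "m = (x + y) / 2"
  have m: "0 < m" "x \<noteq> m" "y \<noteq> m" using assms unfolding m_def by (auto simp: field_simps)
  have "m powr p + p * m powr (p - 1) * (x - m) + (m powr p + p * m powr (p - 1) * (y - m)) < x powr p + y powr p"
    by (intro add_strict_mono powr_above_tangent) (use assms m in auto)
  moreover have "p * m powr (p - 1) * (x - m) + p * m powr (p - 1) * (y - m) = p * m powr (p - 1) * ((x - m) + (y - m))"
    by (rule distrib_left[symmetric])
  moreover have "(x - m) + (y - m) = 0" by (simp add: m_def)
  ultimately have "2 * m powr p < x powr p + y powr p" by simp
  then show ?thesis by (simp add: m_def)
qed

lemma powr_midpoint_le:
  fixes p x y :: real
  assumes "1 < p" "0 \<le> x" "0 \<le> y"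
  shows "((x + y) / 2) powr p \<le> (x powr p + y powr p) / 2"
  using powr_midpoint_less[OF assms] by (cases "x = y") (auto simp: less_imp_le)

text \<open>If the absolute values differ, the inequality for nonnegative numbers is strict. If they
  agree, the numbers are opposite and the midpoint is zero.\<close>

lemma abs_powr_midpoint_less:
  fixes p a b :: real
  assumes p: "1 < p" and "a \<noteq> b"
  shows "\<bar>(a + b) / 2\<bar> powr p < (\<bar>a\<bar> powr p + \<bar>b\<bar> powr p) / 2"
proof (cases "\<bar>a\<bar> = \<bar>b\<bar>")
  case True
  then have "a + b = 0" "b \<noteq> 0" using assms(2) by auto
  then show ?thesis using True by simp
next
  case False
  have "\<bar>(a + b) / 2\<bar> powr p \<le> ((\<bar>a\<bar> + \<bar>b\<bar>) / 2) powr p"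
    using p by (intro powr_mono2) auto
  also have "\<dots> < (\<bar>a\<bar> powr p + \<bar>b\<bar> powr p) / 2"
    using False by (intro powr_midpoint_less[OF p]) auto
  finally show ?thesis .
qed

lemma abs_powr_midpoint_le:
  fixes p a b :: real
  assumes "1 < p"
  shows "\<bar>(a + b) / 2\<bar> powr p \<le> (\<bar>a\<bar> powr p + \<bar>b\<bar> powr p) / 2"
  using abs_powr_midpoint_less[OF assms, of a b] by (cases "a = b") (auto simp: less_imp_le)

text \<open>The factor comes from bounding |a + b| by twice the larger absolute value. The
  inequality replaces the triangle inequality wherever p-th powers of norms are compared without
  taking roots.\<close>

lemma abs_powr_add_le:
  fixes p a b :: real
  assumes "0 \<le> p"
  shows "\<bar>a + b\<bar> powr p \<le> 2 powr p * (\<bar>a\<bar> powr p + \<bar>b\<bar> powr p)"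
proof -
  have "\<bar>a + b\<bar> powr p \<le> (2 * max \<bar>a\<bar> \<bar>b\<bar>) powr p"
    using assms by (intro powr_mono2) auto
  also have "\<dots> = 2 powr p * max \<bar>a\<bar> \<bar>b\<bar> powr p" by (simp add: powr_mult)
  also have "\<dots> \<le> 2 powr p * (\<bar>a\<bar> powr p + \<bar>b\<bar> powr p)"
    by (intro mult_left_mono) (auto simp: max_def)
  finally show ?thesis .
qed

lemma abs_powr_diff_le:
  fixes p a b :: real
  assumes "0 \<le> p"
  shows "\<bar>a - b\<bar> powr p \<le> 2 powr p * (\<bar>a\<bar> powr p + \<bar>b\<bar> powr p)"
  using abs_powr_add_le[OF assms, of a "- b"] by simp

text \<open>The constant comes from homogeneity and the compactness of a normalized set of pairs.\<close>

lemma abs_powr_uniform_convexity: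
  fixes p \<epsilon> :: real
  assumes p: "1 < p" and \<epsilon>: "0 < \<epsilon>"
  obtains C where "0 < C" "\<And>a b :: real. \<bar>a - b\<bar> powr p \<le> \<epsilon> * (\<bar>a\<bar> powr p + \<bar>b\<bar> powr p)
      + C * ((\<bar>a\<bar> powr p + \<bar>b\<bar> powr p) / 2 - \<bar>(a + b) / 2\<bar> powr p)"
proof -
  define N where "N z = \<bar>fst z\<bar> powr p + \<bar>snd z\<bar> powr p" for z :: "real \<times> real"
  define D where "D z = N z / 2 - \<bar>(fst z + snd z) / 2\<bar> powr p" for z :: "real \<times> real"
  \<comment> \<open>Normalized pairs that are not close to each other. On this compact set the
    convexity defect \<open>D\<close> is continuous and positive, hence bounded below by a positive
    \<open>\<delta>\<close>.\<close>
  define S where "S = {z. N z = 1} \<inter> {z. \<epsilon> \<le> \<bar>fst z - snd z\<bar> powr p}"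
  have cN: "continuous_on UNIV N"
    unfolding N_def using p by (intro continuous_intros continuous_on_powr') auto
  have cD: "continuous_on UNIV D"
    unfolding D_def using p by (intro continuous_intros continuous_on_powr' cN) auto
  have "closed {z. N z = 1}"
    by (rule closed_Collect_eq) (use cN in auto)
  moreover have "closed {z :: real \<times> real. \<epsilon> \<le> \<bar>fst z - snd z\<bar> powr p}"
    using p by (intro closed_Collect_le continuous_intros continuous_on_powr') auto
  moreover have "bounded S"
  proof (rule bounded_subset)
    show "bounded (cball (0::real) 1 \<times> cball (0::real) 1)" by (intro bounded_Times bounded_cball)
    have le: "\<bar>x\<bar> \<le> 1" if "\<bar>x\<bar> powr p \<le> 1" for x :: real
    proof (rule ccontr)
      assume "\<not> \<bar>x\<bar> \<le> 1"
      then have "1 powr p < \<bar>x\<bar> powr p" using p by (intro powr_less_mono2) auto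
      with that show False by simp
    qed
    show "S \<subseteq> cball 0 1 \<times> cball 0 1"
    proof
      fix z assume "z \<in> S"
      then have "\<bar>fst z\<bar> powr p \<le> 1" "\<bar>snd z\<bar> powr p \<le> 1"
        using powr_ge_zero[of "\<bar>fst z\<bar>" p] powr_ge_zero[of "\<bar>snd z\<bar>" p]
        unfolding S_def N_def Int_iff mem_Collect_eq by linarith+
      with le show "z \<in> cball 0 1 \<times> cball 0 1" by (cases z) auto
    qed
  qed
  ultimately have S: "compact S" unfolding S_def by (simp add: compact_eq_bounded_closed closed_Int)
  have Dpos: "0 < D z" if "z \<in> S" for z
  proof -
    have "fst z \<noteq> snd z" using that \<epsilon> by (auto simp: S_def)
    from abs_powr_midpoint_less[OF p this] show ?thesis by (simp add: D_def N_def)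
  qed
  obtain \<delta> where \<delta>: "0 < \<delta>" "\<And>z. z \<in> S \<Longrightarrow> \<delta> \<le> D z"
  proof (cases "S = {}")
    case True
    then show ?thesis using that[of 1] by auto
  next
    case False
    then obtain z where "z \<in> S" "\<And>w. w \<in> S \<Longrightarrow> D z \<le> D w"
      using continuous_attains_inf[OF S False continuous_on_subset[OF cD subset_UNIV]] by blast
    then show ?thesis using that[of "D z"] Dpos by blast
  qed
  have D0: "0 \<le> D z" for z using abs_powr_midpoint_le[OF p] by (simp add: D_def N_def)
  \<comment> \<open>\<open>N\<close> and \<open>D\<close> are homogeneous of degree
    \<open>p\<close>. Dividing a pair by \<open>t\<close> moves it into \<open>S\<close>, so the
    lower bound extends to all pairs that are far apart relative to their size.\<close>
  have main: "\<delta> * N z \<le> D z" if z: "\<epsilon> * N z \<le> \<bar>fst z - snd z\<bar> powr p" for z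
  proof (cases "N z = 0")
    case True
    then show ?thesis using D0 by simp
  next
    case False
    then have Np: "0 < N z" by (simp add: N_def order_less_le add_nonneg_nonneg)
    define t where "t = N z powr (1 / p)"
    have t: "0 < t" "t powr p = N z" using Np p by (auto simp: t_def powr_powr)
    define w where "w = (fst z / t, snd z / t)"
    have sc: "\<bar>x / t\<bar> powr p = \<bar>x\<bar> powr p / N z" for x
      using t by (simp add: powr_divide)
    have "N w = N z / N z" unfolding w_def N_def fst_conv snd_conv sc
      by (rule add_divide_distrib[symmetric])
    then have Nw: "N w = 1" using Np by simp
    have dw: "\<bar>fst w - snd w\<bar> powr p = \<bar>fst z - snd z\<bar> powr p / N z"
      unfolding w_def fst_conv snd_conv diff_divide_distrib[symmetric] by (rule sc)
    have mw: "\<bar>(fst w + snd w) / 2\<bar> powr p = \<bar>(fst z + snd z) / 2\<bar> powr p / N z"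
    proof -
      have "(fst w + snd w) / 2 = (fst z + snd z) / 2 / t" by (simp add: w_def add_divide_distrib)
      then show ?thesis by (simp only: sc)
    qed
    have "\<epsilon> \<le> \<bar>fst w - snd w\<bar> powr p" unfolding dw using z Np by (simp add: pos_le_divide_eq)
    then have "w \<in> S" using Nw by (simp add: S_def)
    then have "\<delta> \<le> D w" by (rule \<delta>)
    also have "D w = D z / N z" using Np unfolding D_def Nw mw by (simp add: diff_divide_distrib)
    finally show ?thesis using Np by (simp add: field_simps)
  qed
  show ?thesis
  proof (rule that)
    \<comment> \<open>For far pairs |a - b|^p is at most 2^p times \<open>N\<close>, and
      \<open>N\<close> is at most \<open>D\<close> divided by \<open>\<delta>\<close>. For near
      pairs the term with \<open>\<epsilon>\<close> suffices, the defect being nonnegative.\<close>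
    show "0 < 2 powr p / \<delta>" using \<delta> by simp
    fix a b :: real
    let ?z = "(a, b)"
    have "\<bar>a - b\<bar> powr p \<le> \<epsilon> * N ?z + 2 powr p / \<delta> * D ?z"
    proof (cases "\<epsilon> * N ?z \<le> \<bar>a - b\<bar> powr p")
      case True
      then have "\<delta> * N ?z \<le> D ?z" using main[of ?z] by simp
      then have "N ?z \<le> D ?z / \<delta>" using \<delta> by (simp add: field_simps)
      then have "2 powr p * N ?z \<le> 2 powr p * (D ?z / \<delta>)" by (intro mult_left_mono) auto
      moreover have "\<bar>a - b\<bar> powr p \<le> 2 powr p * N ?z"
        using abs_powr_diff_le[of p a b] p by (simp add: N_def)
      moreover have "0 \<le> \<epsilon> * N ?z" using \<epsilon> by (simp add: N_def)
      ultimately show ?thesis by simp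
    next
      case False
      moreover have "0 \<le> 2 powr p / \<delta> * D ?z" using D0[of ?z] \<delta>(1) by simp
      ultimately show ?thesis by linarith
    qed
    then show "\<bar>a - b\<bar> powr p \<le> \<epsilon> * (\<bar>a\<bar> powr p + \<bar>b\<bar> powr p)
      + 2 powr p / \<delta> * ((\<bar>a\<bar> powr p + \<bar>b\<bar> powr p) / 2 - \<bar>(a + b) / 2\<bar> powr p)"
      by (simp add: N_def D_def)
  qed
qed

section \<open>Functions with integrable p-th power over a general measure\<close>

definition p_integrable :: "'a measure \<Rightarrow> real \<Rightarrow> ('a \<Rightarrow> real) \<Rightarrow> bool" where
  "p_integrable M p u \<longleftrightarrow> u \<in> borel_measurable M \<and> integrable M (\<lambda>x. \<bar>u x\<bar> powr p)"

lemma Lp_space_iff: "u \<in> Lp_space \<Omega> p \<longleftrightarrow> p_integrable (lebesgue_on \<Omega>) p u"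
  by (simp add: Lp_space_def p_integrable_def)

lemma borel_measurable_abs_powr: "u \<in> borel_measurable M \<Longrightarrow> (\<lambda>x. \<bar>u x\<bar> powr p :: real) \<in> borel_measurable M"
  by measurable

lemma p_integrable_bound:
  assumes "integrable M g" "u \<in> borel_measurable M" "AE x in M. \<bar>u x\<bar> powr p \<le> g x"
  shows "p_integrable M p u"
  unfolding p_integrable_def
proof
  show "integrable M (\<lambda>x. \<bar>u x\<bar> powr p)"
    by (rule Bochner_Integration.integrable_bound[OF assms(1) borel_measurable_abs_powr[OF assms(2)]])
      (use assms(3) in \<open>auto elim: eventually_mono\<close>)
qed fact

lemma p_integrable_lincomb:
  assumes p: "0 \<le> p" and u: "p_integrable M p u" and v: "p_integrable M p v"
  shows "p_integrable M p (\<lambda>x. a * u x + b * v x)"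
proof (rule p_integrable_bound)
  show "integrable M (\<lambda>x. 2 powr p * (\<bar>a\<bar> powr p * \<bar>u x\<bar> powr p + \<bar>b\<bar> powr p * \<bar>v x\<bar> powr p))"
    using u v by (simp add: p_integrable_def)
  show "(\<lambda>x. a * u x + b * v x) \<in> borel_measurable M"
    using u v by (auto simp: p_integrable_def)
  show "AE x in M. \<bar>a * u x + b * v x\<bar> powr p \<le> 2 powr p * (\<bar>a\<bar> powr p * \<bar>u x\<bar> powr p + \<bar>b\<bar> powr p * \<bar>v x\<bar> powr p)"
    using abs_powr_add_le[OF p] by (intro AE_I2) (metis abs_mult abs_ge_zero powr_mult)
qed

lemma p_integrable_diff:
  assumes "0 \<le> p" "p_integrable M p u" "p_integrable M p v"
  shows "p_integrable M p (\<lambda>x. u x - v x)"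
  using p_integrable_lincomb[OF assms, of 1 "-1"] by simp

lemma p_integrable_cong_AE:
  assumes u: "p_integrable M p u" and m: "v \<in> borel_measurable M" and eq: "AE x in M. u x = v x"
  shows "p_integrable M p v"
  by (rule p_integrable_bound[of M "\<lambda>x. \<bar>u x\<bar> powr p"])
    (use assms in \<open>auto simp: p_integrable_def elim: eventually_mono\<close>)

lemma p_integral_cong_AE:
  fixes u v :: "'a \<Rightarrow> real"
  assumes "u \<in> borel_measurable M" "v \<in> borel_measurable M" "AE x in M. u x = v x"
  shows "(LINT x|M. \<bar>u x\<bar> powr p) = (LINT x|M. \<bar>v x\<bar> powr p)"
  by (rule integral_cong_AE[OF borel_measurable_abs_powr[OF assms(1)] borel_measurable_abs_powr[OF assms(2)]])
    (use assms(3) in \<open>auto elim: eventually_mono\<close>)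

lemma p_integrable_imp_integrable:
  assumes "finite_measure M" "1 \<le> p" "p_integrable M p u"
  shows "integrable M u"
proof (rule Bochner_Integration.integrable_bound)
  show "integrable M (\<lambda>x. 1 + \<bar>u x\<bar> powr p)"
    using assms by (simp add: p_integrable_def finite_measure.integrable_const)
  show "u \<in> borel_measurable M" using assms by (simp add: p_integrable_def)
  have "\<bar>t\<bar> \<le> 1 + \<bar>t\<bar> powr p" for t :: real
  proof (cases "\<bar>t\<bar> \<le> 1")
    case False
    then have "\<bar>t\<bar> powr 1 \<le> \<bar>t\<bar> powr p" using assms(2) by (intro powr_mono) auto
    then show ?thesis by simp
  qed (simp add: add_increasing2)
  then show "AE x in M. norm (u x) \<le> norm (1 + \<bar>u x\<bar> powr p)" by (simp add: abs_of_nonneg)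
qed

text \<open>Split the values at height \<open>e\<close>: below it the first term suffices, and above
  it |t| = |t|^(1-p) |t|^p with a decreasing first factor. The free height plays the part of
  Hoelder's inequality when smallness in the p-norm has to give smallness in the mean.\<close>

lemma L1_norm_le_p_norm:
  assumes M: "finite_measure M" and p: "1 \<le> p" and u: "p_integrable M p u" and e: "0 < e"
  shows "(LINT x|M. \<bar>u x\<bar>) \<le> e * measure M (space M) + e powr (1 - p) * (LINT x|M. \<bar>u x\<bar> powr p)"
proof -
  have i: "integrable M u" "integrable M (\<lambda>x. \<bar>u x\<bar> powr p)" "integrable M (\<lambda>x. e :: real)"
    using p_integrable_imp_integrable[OF M p u] u M
    by (auto simp: p_integrable_def finite_measure.integrable_const)
  have "\<bar>t\<bar> \<le> e + e powr (1 - p) * \<bar>t\<bar> powr p" for t :: real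
  proof (cases "\<bar>t\<bar> \<le> e")
    case False
    have "\<bar>t\<bar> = \<bar>t\<bar> powr (1 - p) * \<bar>t\<bar> powr p" using False e by (simp add: powr_add[symmetric])
    also have "\<dots> \<le> e powr (1 - p) * \<bar>t\<bar> powr p"
      using False e p by (intro mult_right_mono powr_mono2') auto
    finally show ?thesis using e by simp
  qed (simp add: add_increasing2)
  then have "(LINT x|M. \<bar>u x\<bar>) \<le> (LINT x|M. e + e powr (1 - p) * \<bar>u x\<bar> powr p)"
    using i by (intro integral_mono) auto
  also have "\<dots> = e * measure M (space M) + e powr (1 - p) * (LINT x|M. \<bar>u x\<bar> powr p)"
    using i by (simp add: mult.commute)
  finally show ?thesis .
qed

lemma L1_small_if_p_norm_small:
  assumes M: "finite_measure M" and p: "1 \<le> p" and e: "0 < e"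
  obtains d where "0 < d" "\<And>u. p_integrable M p u \<Longrightarrow> (LINT x|M. \<bar>u x\<bar> powr p) < d \<Longrightarrow> (LINT x|M. \<bar>u x\<bar>) < e"
proof -
  \<comment> \<open>The height \<open>s\<close> keeps the contribution of the total measure below e
    / 2, where adding 1 covers a measure space of measure zero. Then \<open>d\<close> makes the
    other term less than e / 2.\<close>
  define s where "s = e / 2 / (measure M (space M) + 1)"
  have V: "0 < measure M (space M) + 1" by (rule add_nonneg_pos) simp_all
  have s: "0 < s" unfolding s_def using e V by (intro divide_pos_pos) auto
  have "e / 2 = s * (measure M (space M) + 1)"
    unfolding s_def by (rule nonzero_divide_eq_eq[THEN iffD1, OF _ refl]) (use V in linarith)
  then have sV: "s * measure M (space M) < e / 2"
    using s by (simp add: distrib_left)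
  define d where "d = e / (2 * s powr (1 - p))"
  have d: "0 < d" using s e by (simp add: d_def)
  show ?thesis
  proof (rule that[OF d])
    fix u assume u: "p_integrable M p u" "(LINT x|M. \<bar>u x\<bar> powr p) < d"
    have "s powr (1 - p) * (LINT x|M. \<bar>u x\<bar> powr p) < s powr (1 - p) * d"
      using u(2) s by (intro mult_strict_left_mono) auto
    also have "\<dots> = e / 2" using s by (simp add: d_def)
    finally show "(LINT x|M. \<bar>u x\<bar>) < e"
      using L1_norm_le_p_norm[OF M p u(1) s] sV by linarith
  qed
qed

lemma L1_tendsto_0_if_p_norm_tendsto_0:
  assumes M: "finite_measure M" and p: "1 \<le> p" and u: "\<And>n. p_integrable M p (u n)"
    and lim: "(\<lambda>n. LINT x|M. \<bar>u n x\<bar> powr p) \<longlonglongrightarrow> 0"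
  shows "(\<lambda>n. LINT x|M. \<bar>u n x\<bar>) \<longlonglongrightarrow> 0"
proof (rule LIMSEQ_I)
  fix r :: real assume "0 < r"
  then obtain d where d: "0 < d" "\<And>u. p_integrable M p u \<Longrightarrow> (LINT x|M. \<bar>u x\<bar> powr p) < d \<Longrightarrow> (LINT x|M. \<bar>u x\<bar>) < r"
    using L1_small_if_p_norm_small[OF M p] by blast
  obtain N where "\<And>n. n \<ge> N \<Longrightarrow> norm ((LINT x|M. \<bar>u n x\<bar> powr p) - 0) < d"
    using LIMSEQ_D[OF lim d(1)] by blast
  then have "norm ((LINT x|M. \<bar>u n x\<bar>) - 0) < r" if "n \<ge> N" for n
    using d(2)[OF u[of n]] that by force
  then show "\<exists>N. \<forall>n\<ge>N. norm ((LINT x|M. \<bar>u n x\<bar>) - 0) < r" by blast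
qed

text \<open>Fatou's lemma for extended nonnegative integrals, brought back to real integrals: the
  finite limit of the bounds is what makes the limit function integrable.\<close>

lemma fatou_real:
  fixes f :: "nat \<Rightarrow> 'a \<Rightarrow> real"
  assumes i: "\<And>n. integrable M (f n)" and nn: "\<And>n. AE x in M. 0 \<le> f n x"
    and lim: "AE x in M. (\<lambda>n. f n x) \<longlonglongrightarrow> g x" and g: "g \<in> borel_measurable M"
    and le: "\<And>n. (LINT x|M. f n x) \<le> c n" and c: "c \<longlonglongrightarrow> C"
  shows "integrable M g \<and> (LINT x|M. g x) \<le> C"
proof -
  have nn': "AE x in M. \<forall>n. 0 \<le> f n x" using nn by (simp add: AE_all_countable)
  have g0: "AE x in M. 0 \<le> g x"
    using lim nn' by eventually_elim (meson LIMSEQ_le_const)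
  have nonneg: "0 \<le> (LINT x|M. f n x)" for n by (rule integral_nonneg_AE[OF nn])
  then have c0: "0 \<le> c n" for n using le order_trans by blast
  then have C0: "0 \<le> C" using c by (meson LIMSEQ_le_const)
  have "(\<integral>\<^sup>+x. ennreal (g x) \<partial>M) = (\<integral>\<^sup>+x. liminf (\<lambda>n. ennreal (f n x)) \<partial>M)"
  proof (rule nn_integral_cong_AE)
    show "AE x in M. ennreal (g x) = liminf (\<lambda>n. ennreal (f n x))"
      using lim by eventually_elim (metis lim_imp_Liminf tendsto_ennrealI trivial_limit_sequentially)
  qed
  also have "\<dots> \<le> liminf (\<lambda>n. \<integral>\<^sup>+x. ennreal (f n x) \<partial>M)"
    using i by (intro nn_integral_liminf) auto
  also have "\<dots> \<le> liminf (\<lambda>n. ennreal (c n))"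
  proof (intro Liminf_mono always_eventually allI)
    fix n
    have "(\<integral>\<^sup>+x. ennreal (f n x) \<partial>M) = ennreal (LINT x|M. f n x)"
      by (rule nn_integral_eq_integral[OF i nn])
    then show "(\<integral>\<^sup>+x. ennreal (f n x) \<partial>M) \<le> ennreal (c n)" using le by (simp add: ennreal_leI)
  qed
  also have "\<dots> = ennreal C"
    by (rule lim_imp_Liminf) (auto intro: tendsto_ennrealI c)
  finally have le: "(\<integral>\<^sup>+x. ennreal (g x) \<partial>M) \<le> ennreal C" .
  have gi: "integrable M g"
  proof (rule integrableI_nonneg[OF g g0])
    show "(\<integral>\<^sup>+x. ennreal (g x) \<partial>M) < \<infinity>" using le by (simp add: order_le_less_trans)
  qed
  have "ennreal (LINT x|M. g x) \<le> ennreal C"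
    using le nn_integral_eq_integral[OF gi g0] by simp
  then show ?thesis using gi C0 by simp
qed

text \<open>On a finite measure space a Cauchy sequence in the p-norm is Cauchy in the mean, so a
  subsequence converges almost everywhere. Its pointwise limit is the limit of the whole sequence in
  the p-norm.\<close>

lemma p_integrable_complete:
  assumes M: "finite_measure M" and p: "1 \<le> p" and u: "\<And>n. p_integrable M p (u n)"
    and cauchy: "\<And>e. 0 < e \<Longrightarrow> \<exists>N. \<forall>i\<ge>N. \<forall>j\<ge>N. (LINT x|M. \<bar>u i x - u j x\<bar> powr p) < e"
  obtains v where "p_integrable M p v" "(\<lambda>n. LINT x|M. \<bar>u n x - v x\<bar> powr p) \<longlonglongrightarrow> 0"
proof -
  have ud: "p_integrable M p (\<lambda>x. u i x - u j x)" for i j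
    using p u by (intro p_integrable_diff) auto
  have "\<exists>N. \<forall>i\<ge>N. \<forall>j\<ge>N. LINT x|M. norm (u i x - u j x) < e" if e: "0 < e" for e
  proof -
    obtain d where d: "0 < d" "\<And>u. p_integrable M p u \<Longrightarrow> (LINT x|M. \<bar>u x\<bar> powr p) < d \<Longrightarrow> (LINT x|M. \<bar>u x\<bar>) < e"
      using L1_small_if_p_norm_small[OF M p e] by blast
    obtain N where "\<forall>i\<ge>N. \<forall>j\<ge>N. (LINT x|M. \<bar>u i x - u j x\<bar> powr p) < d" using cauchy[OF d(1)] by blast
    then have "\<forall>i\<ge>N. \<forall>j\<ge>N. LINT x|M. norm (u i x - u j x) < e"
      using d(2)[OF ud] unfolding real_norm_def by blast
    then show ?thesis ..
  qed
  then obtain r where r: "strict_mono r" "AE x in M. Cauchy (\<lambda>i. u (r i) x)"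
    using cauchy_L1_AE_cauchy_subseq[of M u] p_integrable_imp_integrable[OF M p u] by metis
  define v where "v x = lim (\<lambda>i. u (r i) x)" for x
  have um: "u n \<in> borel_measurable M" for n using u by (simp add: p_integrable_def)
  have vm: "v \<in> borel_measurable M" unfolding v_def using um by (intro borel_measurable_lim_metric)
  have lim: "AE x in M. (\<lambda>i. u (r i) x) \<longlonglongrightarrow> v x"
    using r(2) by eventually_elim (simp add: v_def Cauchy_convergent_iff convergent_LIMSEQ_iff)
  \<comment> \<open>Fatou's lemma with the first index fixed and the second running through the
    subsequence turns the Cauchy bound into a bound for the distance to \<open>v\<close>. The shift
    by \<open>N\<close> keeps \<open>r (k + N)\<close> at least \<open>N\<close>.\<close>
  have est: "integrable M (\<lambda>x. \<bar>u i x - v x\<bar> powr p) \<and> (LINT x|M. \<bar>u i x - v x\<bar> powr p) \<le> e"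
    if N: "\<And>j. j \<ge> N \<Longrightarrow> (LINT x|M. \<bar>u i x - u j x\<bar> powr p) < e" for i N e
  proof (rule fatou_real[where f = "\<lambda>k x. \<bar>u i x - u (r (k + N)) x\<bar> powr p" and c = "\<lambda>_. e"])
    show "integrable M (\<lambda>x. \<bar>u i x - u (r (k + N)) x\<bar> powr p)" for k
      using ud by (simp add: p_integrable_def)
    show "AE x in M. (\<lambda>k. \<bar>u i x - u (r (k + N)) x\<bar> powr p) \<longlonglongrightarrow> \<bar>u i x - v x\<bar> powr p"
      using lim
    proof eventually_elim
      case (elim x)
      have "(\<lambda>k. u (r (k + N)) x) \<longlonglongrightarrow> v x" using LIMSEQ_ignore_initial_segment[OF elim] .
      then show ?case using p by (intro tendsto_powr' tendsto_rabs tendsto_diff tendsto_const) auto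
    qed
    show "(\<lambda>x. \<bar>u i x - v x\<bar> powr p) \<in> borel_measurable M"
      using um vm by (intro borel_measurable_abs_powr) auto
    have "r (k + N) \<ge> N" for k using seq_suble[OF r(1), of "k + N"] by linarith
    then show "(LINT x|M. \<bar>u i x - u (r (k + N)) x\<bar> powr p) \<le> e" for k
      using N[of "r (k + N)"] by (simp add: less_imp_le)
  qed auto
  have conv: "\<exists>N. \<forall>i\<ge>N. integrable M (\<lambda>x. \<bar>u i x - v x\<bar> powr p) \<and> (LINT x|M. \<bar>u i x - v x\<bar> powr p) \<le> e"
    if "0 < e" for e
    using cauchy[OF that] est by meson
  obtain N where N: "integrable M (\<lambda>x. \<bar>u N x - v x\<bar> powr p)" using conv[of 1] by auto
  then have "p_integrable M p (\<lambda>x. u N x - v x)" using um vm by (simp add: p_integrable_def)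
  from p_integrable_diff[OF _ u this, of N] p have v: "p_integrable M p v" by simp
  have "(\<lambda>n. LINT x|M. \<bar>u n x - v x\<bar> powr p) \<longlonglongrightarrow> 0"
  proof (rule LIMSEQ_I)
    fix e :: real assume e: "0 < e"
    then obtain N where "\<forall>i\<ge>N. (LINT x|M. \<bar>u i x - v x\<bar> powr p) \<le> e / 2" using conv[of "e / 2"] by auto
    then show "\<exists>N. \<forall>n\<ge>N. norm ((LINT x|M. \<bar>u n x - v x\<bar> powr p) - 0) < e"
      using e by (intro exI[of _ N]) (auto simp: abs_of_nonneg intro: order_le_less_trans)
  qed
  with v show ?thesis using that by blast
qed

text \<open>Integrate the tangent inequality of the power at the mean \<open>m\<close> of |h|; the
  linear term has integral zero. The case m = 0 is separate because tangents are available at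
  positive points only.\<close>

lemma jensen_powr_integral:
  fixes h :: "'a \<Rightarrow> real"
  assumes M: "finite_measure M" and V: "measure M (space M) = V" "0 < V" and p: "1 < p"
    and h: "p_integrable M p h"
  shows "\<bar>LINT x|M. h x\<bar> powr p \<le> V powr (p - 1) * (LINT x|M. \<bar>h x\<bar> powr p)"
proof -
  have i: "integrable M h" using p_integrable_imp_integrable[OF M _ h] p by simp
  have ip: "integrable M (\<lambda>x. \<bar>h x\<bar> powr p)" using h by (simp add: p_integrable_def)
  define m where "m = (LINT x|M. \<bar>h x\<bar>) / V"
  have m0: "0 \<le> m" using V by (simp add: m_def)
  have hm: "(LINT x|M. \<bar>h x\<bar>) = m * V" using V by (simp add: m_def)
  have ip0: "0 \<le> (LINT x|M. \<bar>h x\<bar> powr p)" by simp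
  have "\<bar>LINT x|M. h x\<bar> \<le> m * V" using hm integral_norm_bound[of M h] by simp
  then have "\<bar>LINT x|M. h x\<bar> powr p \<le> (m * V) powr p" using p by (intro powr_mono2) auto
  also have "\<dots> = V powr (p - 1) * (m powr p * V)"
    using V m0 by (simp add: powr_mult powr_diff)
  also have "\<dots> \<le> V powr (p - 1) * (LINT x|M. \<bar>h x\<bar> powr p)"
  proof (intro mult_left_mono)
    show "m powr p * V \<le> (LINT x|M. \<bar>h x\<bar> powr p)"
    proof (cases "m = 0")
      case False
      then have mp: "0 < m" using m0 by simp
      have c: "integrable M (\<lambda>x. c :: real)" for c using M by (rule finite_measure.integrable_const)
      have "m powr p + p * m powr (p - 1) * (\<bar>h x\<bar> - m) \<le> \<bar>h x\<bar> powr p" for x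
        using powr_above_tangent[OF p mp, of "\<bar>h x\<bar>"] by (cases "\<bar>h x\<bar> = m") (auto simp: less_imp_le)
      then have "(LINT x|M. m powr p + p * m powr (p - 1) * (\<bar>h x\<bar> - m)) \<le> (LINT x|M. \<bar>h x\<bar> powr p)"
        using i ip c by (intro integral_mono) auto
      also have "(LINT x|M. m powr p + p * m powr (p - 1) * (\<bar>h x\<bar> - m)) = m powr p * V + p * m powr (p - 1) * (m * V - m * V)"
        using i c V hm by (simp add: mult.commute)
      finally show ?thesis by simp
    qed (use ip0 in simp)
  qed simp
  finally show ?thesis .
qed

section \<open>Elliptic operators on symmetric matrices\<close>

lemma sym_matrices_iff: "M \<in> sym_matrices \<longleftrightarrow> (\<forall>i j. M $ i $ j = M $ j $ i)"
  unfolding sym_matrices_def by (auto simp: transpose_def vec_eq_iff)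

lemma sym_matrices_add: "M \<in> sym_matrices \<Longrightarrow> N \<in> sym_matrices \<Longrightarrow> M + N \<in> sym_matrices"
  and sym_matrices_diff: "M \<in> sym_matrices \<Longrightarrow> N \<in> sym_matrices \<Longrightarrow> M - N \<in> sym_matrices"
  and sym_matrices_scaleR: "M \<in> sym_matrices \<Longrightarrow> c *\<^sub>R M \<in> sym_matrices"
  and sym_matrices_0: "0 \<in> sym_matrices"
  and sym_matrices_id: "mat 1 \<in> sym_matrices"
  by (auto simp: sym_matrices_iff mat_def)

lemma closed_sym_matrices: "closed (sym_matrices :: (real ^ 'n ^ 'n) set)"
proof -
  have eq: "(sym_matrices :: (real ^ 'n ^ 'n) set) = (\<Inter>i. \<Inter>j. {M. M $ i $ j = M $ j $ i})"
    by (auto simp: sym_matrices_iff)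
  show ?thesis
    unfolding eq by (intro closed_INT ballI closed_Collect_eq continuous_intros)
qed

lemma quadratic_form_eq:
  fixes M :: "real ^ 'n ^ 'n"
  shows "x \<bullet> (M *v x) = (\<Sum>i\<in>UNIV. \<Sum>j\<in>UNIV. x $ i * x $ j * M $ i $ j)"
  by (simp add: inner_vec_def matrix_vector_mult_def sum_distrib_left mult_ac)

lemma matrix_entry_le_norm:
  fixes M :: "real ^ 'n ^ 'n"
  shows "\<bar>M $ i $ j\<bar> \<le> norm M"
  using order_trans[OF component_le_norm_cart Finite_Cartesian_Product.norm_nth_le] .

lemma quadratic_form_bound:
  fixes M :: "real ^ 'n ^ 'n"
  shows "\<bar>x \<bullet> (M *v x)\<bar> \<le> (real CARD('n))\<^sup>2 * norm M * (x \<bullet> x)"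
proof -
  have "\<bar>x \<bullet> (M *v x)\<bar> \<le> (\<Sum>i\<in>UNIV. \<Sum>j\<in>UNIV. \<bar>x $ i * x $ j * M $ i $ j\<bar>)"
    unfolding quadratic_form_eq by (rule order_trans[OF sum_abs sum_mono]) (rule sum_abs)
  also have "\<dots> \<le> (\<Sum>i\<in>(UNIV :: 'n set). \<Sum>j\<in>(UNIV :: 'n set). norm x * norm x * norm M)"
    unfolding abs_mult
    by (intro sum_mono mult_mono matrix_entry_le_norm) (use component_le_norm_cart[of x] in auto)
  also have "\<dots> = (real CARD('n))\<^sup>2 * norm M * (x \<bullet> x)"
    by (simp add: power2_eq_square dot_square_norm)
  finally show ?thesis .
qed

lemma nonneg_definite_scaled_id: "0 \<le> c \<Longrightarrow> nonneg_definite (c *\<^sub>R mat 1)"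
  by (simp add: nonneg_definite_def scaleR_matrix_vector_assoc[symmetric])

text \<open>The quadratic form of \<open>S\<close> is at most the number of entries times
  \<open>norm S\<close> times |x|^2 in absolute value, which is exactly what the multiple of the
  identity compensates.\<close>

lemma nonneg_definite_shift:
  fixes S :: "real ^ 'n ^ 'n"
  shows "nonneg_definite (S + ((real CARD('n))\<^sup>2 * norm S) *\<^sub>R mat 1)"
  unfolding nonneg_definite_def
proof
  fix x :: "real ^ 'n"
  show "0 \<le> x \<bullet> ((S + ((real CARD('n))\<^sup>2 * norm S) *\<^sub>R mat 1) *v x)"
    using quadratic_form_bound[of x S]
    by (simp add: matrix_vector_mult_add_rdistrib inner_add_right scaleR_matrix_vector_assoc[symmetric])
qed

lemma norm_on_sym_matrices_triangle:
  "norm_on_sym_matrices nrm \<Longrightarrow> M \<in> sym_matrices \<Longrightarrow> N \<in> sym_matrices \<Longrightarrow> nrm (M + N) \<le> nrm M + nrm N"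
  by (simp add: norm_on_sym_matrices_def)

lemma norm_on_sym_matrices_nonneg: "norm_on_sym_matrices nrm \<Longrightarrow> M \<in> sym_matrices \<Longrightarrow> 0 \<le> nrm M"
  and norm_on_sym_matrices_eq_0: "norm_on_sym_matrices nrm \<Longrightarrow> M \<in> sym_matrices \<Longrightarrow> nrm M = 0 \<longleftrightarrow> M = 0"
  and norm_on_sym_matrices_scaleR: "norm_on_sym_matrices nrm \<Longrightarrow> M \<in> sym_matrices \<Longrightarrow> nrm (c *\<^sub>R M) = \<bar>c\<bar> * nrm M"
  by (simp_all add: norm_on_sym_matrices_def)

lemma norm_on_sym_matrices_sum:
  fixes nrm :: "real ^ 'n ^ 'n \<Rightarrow> real"
  assumes "norm_on_sym_matrices nrm" "finite I" "\<And>i. i \<in> I \<Longrightarrow> f i \<in> sym_matrices"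
  shows "(\<Sum>i\<in>I. f i) \<in> sym_matrices \<and> nrm (\<Sum>i\<in>I. f i) \<le> (\<Sum>i\<in>I. nrm (f i))"
  using assms(2,3)
proof (induction I rule: finite_induct)
  case empty
  have "nrm 0 = 0" using norm_on_sym_matrices_eq_0[OF assms(1) sym_matrices_0] by simp
  then show ?case by (simp add: sym_matrices_0)
next
  case (insert a I)
  have a: "f a \<in> sym_matrices" and I: "(\<Sum>i\<in>I. f i) \<in> sym_matrices \<and> nrm (\<Sum>i\<in>I. f i) \<le> (\<Sum>i\<in>I. nrm (f i))"
    using insert.prems insert.IH by blast+
  have "nrm (f a + (\<Sum>i\<in>I. f i)) \<le> nrm (f a) + nrm (\<Sum>i\<in>I. f i)"
    by (rule norm_on_sym_matrices_triangle[OF assms(1) a conjunct1[OF I]])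
  then have "nrm (f a + (\<Sum>i\<in>I. f i)) \<le> nrm (f a) + (\<Sum>i\<in>I. nrm (f i))" using I by linarith
  moreover have "f a + (\<Sum>i\<in>I. f i) \<in> sym_matrices" using a I by (intro sym_matrices_add) auto
  ultimately show ?case unfolding sum.insert[OF insert(1,2)] by (rule conjI[rotated])
qed

text \<open>Nothing is known of \<open>nrm\<close> off the symmetric matrices. So the expansion uses
  the symmetrized units \<open>e i j\<close>, half the unit at (i, j) plus half the unit at (j, i),
  and it reproduces \<open>M\<close> because \<open>M\<close> is symmetric.\<close>

lemma norm_on_sym_matrices_upper:
  fixes nrm :: "real ^ 'n ^ 'n \<Rightarrow> real"
  assumes nrm: "norm_on_sym_matrices nrm"
  obtains C where "0 \<le> C" "\<And>M. M \<in> sym_matrices \<Longrightarrow> nrm M \<le> C * norm M"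
proof -
  define e :: "'n \<Rightarrow> 'n \<Rightarrow> real ^ 'n ^ 'n" where
    "e i j = (\<chi> a b. (if a = i \<and> b = j then 1/2 else 0) + (if a = j \<and> b = i then 1/2 else 0))" for i j
  have e: "e i j \<in> sym_matrices" for i j
    unfolding sym_matrices_iff e_def vec_lambda_beta
    by (intro allI) (subst add.commute, rule arg_cong2[where f = "(+)"]; rule if_cong; blast)
  have half: "c * ((if P then 1/2 else 0) + (if Q then 1/2 else 0)) = (if P then c / 2 else 0) + (if Q then c / 2 else 0)"
    for c :: real and P Q by (cases P; cases Q) simp_all
  have entry: "(c *\<^sub>R e i j) $ a $ b = (if a = i \<and> b = j then c / 2 else 0) + (if a = j \<and> b = i then c / 2 else 0)"
    for c i j a b
    unfolding e_def vector_scaleR_component vec_lambda_beta real_scaleR_def by (rule half)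
  define C where "C = (\<Sum>i\<in>UNIV. \<Sum>j\<in>UNIV. nrm (e i j))"
  have nn: "0 \<le> nrm (e i j)" for i j by (rule norm_on_sym_matrices_nonneg[OF nrm e])
  show ?thesis
  proof (rule that[of C])
    show "0 \<le> C" unfolding C_def using nn by (intro sum_nonneg) auto
    fix M :: "real ^ 'n ^ 'n" assume M: "M \<in> sym_matrices"
    note row = norm_on_sym_matrices_sum[OF nrm finite_class.finite_UNIV sym_matrices_scaleR[OF e]]
    have "M = (\<Sum>i\<in>UNIV. \<Sum>j\<in>UNIV. M $ i $ j *\<^sub>R e i j)"
    proof -
      have "(\<Sum>i\<in>UNIV. \<Sum>j\<in>UNIV. M $ i $ j *\<^sub>R e i j) $ a $ b = M $ a $ b" for a b
      proof -
        have 1: "(\<Sum>i\<in>UNIV. \<Sum>j\<in>UNIV. if a = i \<and> b = j then M $ i $ j / 2 else 0) = M $ a $ b / 2"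
        proof -
          have "(\<Sum>j\<in>UNIV. if a = i \<and> b = j then M $ i $ j / 2 else 0) = (if a = i then M $ i $ b / 2 else 0)" for i
            by (cases "a = i") simp_all
          then show ?thesis by simp
        qed
        have 2: "(\<Sum>i\<in>UNIV. \<Sum>j\<in>UNIV. if a = j \<and> b = i then M $ i $ j / 2 else 0) = M $ b $ a / 2"
        proof -
          have "(\<Sum>j\<in>UNIV. if a = j \<and> b = i then M $ i $ j / 2 else 0) = (if b = i then M $ i $ a / 2 else 0)" for i
            by (cases "b = i") simp_all
          then show ?thesis by simp
        qed
        have "(\<Sum>i\<in>UNIV. \<Sum>j\<in>UNIV. M $ i $ j *\<^sub>R e i j) $ a $ b
          = (\<Sum>i\<in>UNIV. \<Sum>j\<in>UNIV. (if a = i \<and> b = j then M $ i $ j / 2 else 0) + (if a = j \<and> b = i then M $ i $ j / 2 else 0))"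
          by (simp only: sum_component entry)
        also have "\<dots> = M $ a $ b / 2 + M $ b $ a / 2" by (simp only: sum.distrib 1 2)
        also have "M $ b $ a = M $ a $ b" using M unfolding sym_matrices_iff by blast
        finally show ?thesis by simp
      qed
      then show ?thesis by (simp add: vec_eq_iff)
    qed
    then have "nrm M = nrm (\<Sum>i\<in>UNIV. \<Sum>j\<in>UNIV. M $ i $ j *\<^sub>R e i j)" by simp
    also have "\<dots> \<le> (\<Sum>i\<in>UNIV. nrm (\<Sum>j\<in>UNIV. M $ i $ j *\<^sub>R e i j))"
      by (rule conjunct2[OF norm_on_sym_matrices_sum[OF nrm finite_class.finite_UNIV conjunct1[OF row]]])
    also have "\<dots> \<le> (\<Sum>i\<in>UNIV. \<Sum>j\<in>UNIV. nrm (M $ i $ j *\<^sub>R e i j))"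
      by (intro sum_mono conjunct2[OF row])
    also have "\<dots> = (\<Sum>i\<in>UNIV. \<Sum>j\<in>UNIV. \<bar>M $ i $ j\<bar> * nrm (e i j))"
      by (simp only: norm_on_sym_matrices_scaleR[OF nrm e])
    also have "\<dots> \<le> (\<Sum>i\<in>UNIV. \<Sum>j\<in>UNIV. norm M * nrm (e i j))"
      by (intro sum_mono mult_right_mono matrix_entry_le_norm nn)
    also have "\<dots> = C * norm M" by (simp add: C_def sum_distrib_left mult.commute)
    finally show "nrm M \<le> C * norm M" .
  qed
qed

text \<open>The upper bound makes \<open>nrm\<close> Lipschitz on the symmetric matrices, hence it
  attains a positive minimum on their compact unit sphere; homogeneity extends the bound.\<close>

lemma norm_on_sym_matrices_lower:
  fixes nrm :: "real ^ 'n ^ 'n \<Rightarrow> real"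
  assumes nrm: "norm_on_sym_matrices nrm"
  obtains c where "0 < c" "\<And>M. M \<in> sym_matrices \<Longrightarrow> c * norm M \<le> nrm M"
proof -
  obtain C where C: "0 \<le> C" "\<And>M. M \<in> sym_matrices \<Longrightarrow> nrm M \<le> C * norm M"
    using norm_on_sym_matrices_upper[OF nrm] by blast
  have sc: "nrm (a *\<^sub>R M) = \<bar>a\<bar> * nrm M" if "M \<in> sym_matrices" for M a
    by (rule norm_on_sym_matrices_scaleR[OF nrm that])
  have diff: "nrm M - nrm N \<le> C * norm (M - N)" if "M \<in> sym_matrices" "N \<in> sym_matrices" for M N
  proof -
    have "nrm (N + (M - N)) \<le> nrm N + nrm (M - N)"
      using that by (intro norm_on_sym_matrices_triangle[OF nrm] sym_matrices_diff)
    then show ?thesis using C(2)[OF sym_matrices_diff[OF that]] by simp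
  qed
  have "C-lipschitz_on sym_matrices nrm"
  proof (rule lipschitz_onI[OF _ C(1)])
    fix M N :: "real ^ 'n ^ 'n" assume "M \<in> sym_matrices" "N \<in> sym_matrices"
    then show "dist (nrm M) (nrm N) \<le> C * dist M N"
      using diff[of M N] diff[of N M] by (simp add: dist_norm norm_minus_commute abs_le_iff)
  qed
  then have cont: "continuous_on sym_matrices nrm" by (rule lipschitz_on_continuous_on)
  define S where "S = sym_matrices \<inter> sphere (0 :: real ^ 'n ^ 'n) 1"
  have S: "compact S" unfolding S_def by (rule closed_Int_compact[OF closed_sym_matrices compact_sphere])
  have pos: "0 < nrm M" if "M \<in> S" for M
  proof -
    have M: "M \<in> sym_matrices" "M \<noteq> 0" using that by (auto simp: S_def)
    then have "0 \<le> nrm M" "nrm M \<noteq> 0"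
      using norm_on_sym_matrices_nonneg[OF nrm] norm_on_sym_matrices_eq_0[OF nrm] by auto
    then show ?thesis by simp
  qed
  obtain c where c: "0 < c" "\<And>M. M \<in> S \<Longrightarrow> c \<le> nrm M"
  proof (cases "S = {}")
    case True
    then show ?thesis using that[of 1] by auto
  next
    case False
    have "continuous_on S nrm" using continuous_on_subset[OF cont] by (simp add: S_def)
    then obtain M where "M \<in> S" "\<forall>N\<in>S. nrm M \<le> nrm N"
      using continuous_attains_inf[OF S False] by blast
    then show ?thesis using that[of "nrm M"] pos by blast
  qed
  show ?thesis
  proof (rule that[OF c(1)])
    fix M :: "real ^ 'n ^ 'n" assume M: "M \<in> sym_matrices"
    show "c * norm M \<le> nrm M"
    proof (cases "M = 0")
      case True
      then show ?thesis using norm_on_sym_matrices_nonneg[OF nrm M] by simp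
    next
      case False
      then have "(1 / norm M) *\<^sub>R M \<in> S" using M by (simp add: S_def sym_matrices_scaleR)
      from c(2)[OF this] show ?thesis using False sc[OF M] by (simp add: field_simps)
    qed
  qed
qed

locale elliptic_operator =
  fixes F :: "real ^ 'n ^ 'n \<Rightarrow> real" and nrm :: "real ^ 'n ^ 'n \<Rightarrow> real" and lam Lam :: real
  assumes lam: "0 < lam" "lam \<le> Lam"
    and nrm: "norm_on_sym_matrices nrm"
    and F_convex: "convex_on sym_matrices F" and F_0: "F 0 = 0"
    and F_elliptic: "\<And>M N. M \<in> sym_matrices \<Longrightarrow> N \<in> sym_matrices \<Longrightarrow> nonneg_definite N \<Longrightarrow>
           lam * nrm N \<le> F (M + N) - F M \<and> F (M + N) - F M \<le> Lam * nrm N"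
begin

lemma F_midpoint:
  assumes "M \<in> sym_matrices" "N \<in> sym_matrices"
  shows "F ((1 / 2) *\<^sub>R M + (1 / 2) *\<^sub>R N) \<le> (F M + F N) / 2"
  using convex_onD[OF F_convex, of "1/2" M N] assms by simp

lemma nrm_nonneg: "M \<in> sym_matrices \<Longrightarrow> 0 \<le> nrm M"
  by (rule norm_on_sym_matrices_nonneg[OF nrm])

lemma F_nonneg:
  assumes "M \<in> sym_matrices" "nonneg_definite M" shows "0 \<le> F M"
proof -
  have "lam * nrm M \<le> F (0 + M) - F 0" using F_elliptic[OF sym_matrices_0 assms] by blast
  moreover have "0 \<le> lam * nrm M" using lam nrm_nonneg[OF assms(1)] by simp
  ultimately show ?thesis by (simp add: F_0)
qed

text \<open>Ellipticity at the zero matrix bounds \<open>nrm M\<close>, and equivalence of norms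
  passes this on to single entries, the form needed to compare the energy with the p-norms of the
  second derivatives.\<close>

lemma F_coercive:
  obtains c where "0 < c" "\<And>M i j. M \<in> sym_matrices \<Longrightarrow> nonneg_definite M \<Longrightarrow> c * \<bar>M $ i $ j\<bar> \<le> F M"
proof -
  obtain c where c: "0 < c" "\<And>M. M \<in> sym_matrices \<Longrightarrow> c * norm M \<le> nrm M"
    using norm_on_sym_matrices_lower[OF nrm] by blast
  show ?thesis
  proof (rule that[of "lam * c"])
    show "0 < lam * c" using lam c by simp
    fix M :: "real ^ 'n ^ 'n" and i j assume M: "M \<in> sym_matrices" "nonneg_definite M"
    have "lam * c * \<bar>M $ i $ j\<bar> \<le> lam * c * norm M"
      using lam c matrix_entry_le_norm by (intro mult_left_mono) auto
    also have "\<dots> \<le> lam * nrm M" using lam c(2)[OF M(1)] by simp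
    also have "\<dots> \<le> F M" using F_elliptic[OF sym_matrices_0 M] by (simp add: F_0)
    finally show "lam * c * \<bar>M $ i $ j\<bar> \<le> F M" .
  qed
qed

text \<open>A symmetric increment becomes nonnegative definite after adding a multiple of the identity
  comparable to its norm.\<close>

lemma F_lipschitz:
  obtains L where "L-lipschitz_on sym_matrices F"
proof -
  obtain C where C: "0 \<le> C" "\<And>M. M \<in> sym_matrices \<Longrightarrow> nrm M \<le> C * norm M"
    using norm_on_sym_matrices_upper[OF nrm] by blast
  define K where "K = (real CARD('n))\<^sup>2"
  define L where "L = Lam * (C * (1 + K * norm (mat 1 :: real ^ 'n ^ 'n)))"
  have L0: "0 \<le> L" using lam C by (simp add: L_def K_def)
  have diff: "F M - F N \<le> L * norm (M - N)" if M: "M \<in> sym_matrices" and N: "N \<in> sym_matrices" for M N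
  proof -
    define S where "S = M - N"
    define I where "I = (K * norm S) *\<^sub>R (mat 1 :: real ^ 'n ^ 'n)"
    have S: "S \<in> sym_matrices" using M N by (simp add: S_def sym_matrices_diff)
    have I: "I \<in> sym_matrices" "nonneg_definite I"
      by (auto simp: I_def K_def sym_matrices_scaleR sym_matrices_id nonneg_definite_scaled_id)
    have SI: "S + I \<in> sym_matrices" "nonneg_definite (S + I)"
      using S I nonneg_definite_shift[of S] by (auto simp: sym_matrices_add I_def K_def)
    \<comment> \<open>\<open>M\<close> and \<open>N\<close> need not be comparable, but
      \<open>M + I\<close> lies above both in the matrix order: going up from \<open>M\<close> does
      not lower \<open>F\<close>, and going up from \<open>N\<close> raises it by at most
      \<open>Lam * nrm (S + I)\<close>.\<close>
    have "0 \<le> lam * nrm I" using lam nrm_nonneg[OF I(1)] by simp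
    then have "F M \<le> F (M + I)" using F_elliptic[OF M I] by linarith
    also have "M + I = N + (S + I)" by (simp add: S_def)
    also have "F (N + (S + I)) \<le> F N + Lam * nrm (S + I)" using F_elliptic[OF N SI] by linarith
    also have "Lam * nrm (S + I) \<le> Lam * (C * norm (S + I))"
      using lam C(2)[OF SI(1)] by (intro mult_left_mono) auto
    also have "\<dots> \<le> Lam * (C * (norm S + K * norm S * norm (mat 1 :: real ^ 'n ^ 'n)))"
      using lam C(1) norm_triangle_ineq[of S I] by (intro mult_left_mono) (auto simp: I_def K_def)
    also have "\<dots> = L * norm S" by (simp add: L_def algebra_simps)
    finally show ?thesis by (simp add: S_def)
  qed
  have "L-lipschitz_on sym_matrices F"
  proof (rule lipschitz_onI[OF _ L0])
    fix M N :: "real ^ 'n ^ 'n" assume "M \<in> sym_matrices" "N \<in> sym_matrices"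
    then show "dist (F M) (F N) \<le> L * dist M N"
      using diff[of M N] diff[of N M] by (simp add: dist_norm norm_minus_commute abs_le_iff)
  qed
  with that show ?thesis .
qed

lemma F_continuous: "continuous_on sym_matrices F"
  using F_lipschitz lipschitz_on_continuous_on by blast

end

section \<open>Poincare inequalities\<close>

text \<open>A Borel representative of the extension by zero. Lebesgue measurability is not preserved
  under composition with maps such as (s, x) to x + s h, so the Fubini arguments below need Borel
  functions on the whole space.\<close>

definition borel_version :: "'a::euclidean_space set \<Rightarrow> ('a \<Rightarrow> real) \<Rightarrow> ('a \<Rightarrow> real) \<Rightarrow> bool" where
  "borel_version \<Omega> u u0 \<longleftrightarrow> u0 \<in> borel_measurable borel \<and>
     (AE x in lborel. (if x \<in> \<Omega> then u x else 0) = u0 x)"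

lemma borel_version_exists:
  fixes u :: "'a::euclidean_space \<Rightarrow> real"
  assumes "u \<in> borel_measurable (lebesgue_on \<Omega>)" "\<Omega> \<in> sets lebesgue"
  obtains u0 where "borel_version \<Omega> u u0"
proof -
  have "(\<lambda>x. if x \<in> \<Omega> then u x else 0) \<in> borel_measurable lebesgue"
    using assms by (rule borel_measurable_if_I)
  from completion_ex_borel_measurable_real[OF this] show ?thesis
    using that unfolding borel_version_def by auto
qed

lemma borel_version_integral:
  fixes u :: "'a::euclidean_space \<Rightarrow> real"
  assumes u: "borel_version \<Omega> u u0" "u \<in> borel_measurable (lebesgue_on \<Omega>)" and \<Omega>: "\<Omega> \<in> sets lebesgue"
  shows "integrable (lebesgue_on \<Omega>) u \<longleftrightarrow> integrable lborel u0"
    and "(LINT x|lebesgue_on \<Omega>. u x) = (LINT x|lborel. u0 x)"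
proof -
  have b: "u0 \<in> borel_measurable lborel" using u(1) by (simp add: borel_version_def)
  have m: "(\<lambda>x. if x \<in> \<Omega> then u x else 0) \<in> borel_measurable lebesgue"
    using u(2) \<Omega> by (rule borel_measurable_if_I)
  have b': "u0 \<in> borel_measurable lebesgue" using b by (rule measurable_completion)
  have ae: "AE x in lebesgue. (if x \<in> \<Omega> then u x else 0) = u0 x"
    using u(1) unfolding borel_version_def by (intro AE_completion) blast
  show "integrable (lebesgue_on \<Omega>) u \<longleftrightarrow> integrable lborel u0"
    using integrable_cong_AE[OF m b' ae] integrable_completion[OF b]
      Lebesgue_Measure.integrable_restrict_UNIV[OF \<Omega>, of u] by simp
  show "(LINT x|lebesgue_on \<Omega>. u x) = (LINT x|lborel. u0 x)"
    using integral_cong_AE[OF m b' ae] integral_completion[OF b]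
      Lebesgue_Measure.integral_restrict_UNIV[OF \<Omega>, of u] by simp
qed

lemma borel_version_compose:
  fixes u :: "'a::euclidean_space \<Rightarrow> real"
  assumes "borel_version \<Omega> u u0" "c \<in> borel_measurable borel" "c 0 = 0"
  shows "borel_version \<Omega> (\<lambda>x. c (u x)) (\<lambda>x. c (u0 x))"
  unfolding borel_version_def
proof
  have "u0 \<in> borel_measurable borel" using assms(1) by (simp add: borel_version_def)
  then show "(\<lambda>x. c (u0 x)) \<in> borel_measurable borel" using assms(2) by (rule measurable_compose)
  have "AE x in lborel. (if x \<in> \<Omega> then u x else 0) = u0 x"
    using assms(1) by (simp add: borel_version_def)
  then show "AE x in lborel. (if x \<in> \<Omega> then c (u x) else 0) = c (u0 x)"
    by eventually_elim (use assms(3) in \<open>auto split: if_splits\<close>)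
qed

lemma borel_version_mult:
  fixes u :: "'a::euclidean_space \<Rightarrow> real"
  assumes "borel_version \<Omega> u u0" "c \<in> borel_measurable borel"
  shows "borel_version \<Omega> (\<lambda>x. u x * c x) (\<lambda>x. u0 x * c x)"
  unfolding borel_version_def
proof
  show "(\<lambda>x. u0 x * c x) \<in> borel_measurable borel"
    using assms by (auto simp: borel_version_def)
  have "AE x in lborel. (if x \<in> \<Omega> then u x else 0) = u0 x"
    using assms(1) by (simp add: borel_version_def)
  then show "AE x in lborel. (if x \<in> \<Omega> then u x * c x else 0) = u0 x * c x"
    by eventually_elim auto
qed

lemma lborel_integral_translate:
  fixes f :: "'a::euclidean_space \<Rightarrow> real"
  assumes "f \<in> borel_measurable borel"
  shows "(LINT x|lborel. f (x + h)) = (LINT x|lborel. f x)"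
    and "integrable lborel (\<lambda>x. f (x + h)) \<longleftrightarrow> integrable lborel f"
proof -
  have m: "(+) h \<in> lborel \<rightarrow>\<^sub>M borel" by simp
  have "(LINT x|lborel. f x) = (LINT x|distr lborel borel ((+) h). f x)" by (simp add: lborel_distr_plus)
  also have "\<dots> = (LINT x|lborel. f (h + x))" by (rule integral_distr[OF m assms])
  finally show "(LINT x|lborel. f (x + h)) = (LINT x|lborel. f x)" by (simp add: add.commute)
  have "integrable lborel f \<longleftrightarrow> integrable (distr lborel borel ((+) h)) f" by (simp add: lborel_distr_plus)
  also have "\<dots> \<longleftrightarrow> integrable lborel (\<lambda>x. f (h + x))" by (rule integrable_distr_eq[OF m assms])
  finally show "integrable lborel (\<lambda>x. f (x + h)) \<longleftrightarrow> integrable lborel f" by (simp add: add.commute)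
qed

text \<open>On a bounded range of \<open>s\<close> a uniform bound for the integrals of |\<psi> s|
  already gives integrability on the product space, and Fubini's theorem applies.\<close>

lemma Fubini_unit_interval:
  fixes \<psi> :: "real \<Rightarrow> 'a::euclidean_space \<Rightarrow> real"
  assumes m[measurable]: "case_prod \<psi> \<in> borel_measurable (borel \<Otimes>\<^sub>M borel)"
    and i: "\<And>s. integrable lborel (\<psi> s)"
    and B: "\<And>s. (LINT x|lborel. \<bar>\<psi> s x\<bar>) \<le> B"
  shows "(LINT s|lborel. indicator {0..1} s * (LINT x|lborel. \<psi> s x)) = (LINT x|lborel. (LINT s|lborel. indicator {0..1} s * \<psi> s x))"
    and "AE x in lborel. integrable lborel (\<lambda>s. indicator {0..1} s * \<psi> s x)"
    and "integrable lborel (\<lambda>x. LINT s|lborel. indicator {0..1} s * \<psi> s x)"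
proof -
  let ?\<Phi> = "\<lambda>s x. indicator {0..1} s * \<psi> s x"
  have m': "case_prod ?\<Phi> \<in> borel_measurable (lborel \<Otimes>\<^sub>M lborel)" by measurable
  have "integrable (lborel \<Otimes>\<^sub>M lborel) (case_prod ?\<Phi>)"
  proof (rule lborel_pair.Fubini_integrable[OF m'])
    show "AE s in lborel. integrable lborel (\<lambda>x. case_prod ?\<Phi> (s, x))" using i by simp
    show "integrable lborel (\<lambda>s. LINT x|lborel. norm (case_prod ?\<Phi> (s, x)))"
    proof (rule Bochner_Integration.integrable_bound)
      show "integrable lborel (\<lambda>s :: real. B * indicator {0..1} s)" by simp
      show "(\<lambda>s. LINT x|lborel. norm (case_prod ?\<Phi> (s, x))) \<in> borel_measurable lborel"
        using m' by measurable
      show "AE s in lborel. norm (LINT x|lborel. norm (case_prod ?\<Phi> (s, x))) \<le> norm (B * indicator {0..1} s)"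
      proof (rule AE_I2)
        fix s :: real
        have "norm (LINT x|lborel. norm (case_prod ?\<Phi> (s, x))) = (LINT x|lborel. indicator {0..1} s * \<bar>\<psi> s x\<bar>)"
          by (simp add: abs_mult)
        also have "\<dots> = indicator {0..1} s * (LINT x|lborel. \<bar>\<psi> s x\<bar>)" by simp
        also have "\<dots> \<le> indicator {0..1} s * B" using B by (intro mult_left_mono) auto
        also have "\<dots> \<le> norm (B * indicator {0..1} s)"
          unfolding mult.commute[of "indicator {0..1} s" B] real_norm_def by (rule abs_ge_self)
        finally show "norm (LINT x|lborel. norm (case_prod ?\<Phi> (s, x))) \<le> norm (B * indicator {0..1} s)" .
      qed
    qed
  qed
  note int = this
  show "AE x in lborel. integrable lborel (\<lambda>s. indicator {0..1} s * \<psi> s x)"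
    by (rule lborel_pair.AE_integrable_snd[OF int])
  show "integrable lborel (\<lambda>x. LINT s|lborel. indicator {0..1} s * \<psi> s x)"
    by (rule lborel_pair.integrable_snd[OF int])
  have "(LINT s|lborel. indicator {0..1} s * (LINT x|lborel. \<psi> s x)) = (LINT s|lborel. (LINT x|lborel. ?\<Phi> s x))"
    by simp
  also have "\<dots> = (LINT x|lborel. (LINT s|lborel. ?\<Phi> s x))"
    by (rule lborel_pair.Fubini_integral[OF int, symmetric])
  finally show "(LINT s|lborel. indicator {0..1} s * (LINT x|lborel. \<psi> s x)) = (LINT x|lborel. (LINT s|lborel. ?\<Phi> s x))" .
qed

lemma weak_directional_deriv:
  fixes f :: "real ^ 'n \<Rightarrow> real"
  assumes op: "open \<Omega>" and G: "\<And>k. weak_deriv \<Omega> [k] f (G k)" and t: "test_function \<Omega> \<phi>"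
  shows "(LINT x|lebesgue_on \<Omega>. f x * (\<Sum>k\<in>UNIV. h $ k * partial_deriv [k] \<phi> x))
      = - (LINT x|lebesgue_on \<Omega>. (\<Sum>k\<in>UNIV. h $ k * G k x) * \<phi> x)"
proof -
  have li: "locally_integrable \<Omega> f" "locally_integrable \<Omega> (G k)" for k
    using G[of k] by (auto simp: weak_deriv_def)
  have i: "integrable (lebesgue_on \<Omega>) (\<lambda>x. f x * partial_deriv [k] \<phi> x)"
    "integrable (lebesgue_on \<Omega>) (\<lambda>x. G k x * \<phi> x)" for k
    using integrable_on_test[OF op li(1) test_function_partial_deriv[OF t]] integrable_on_test[OF op li(2) t] by auto
  have "(LINT x|lebesgue_on \<Omega>. f x * (\<Sum>k\<in>UNIV. h $ k * partial_deriv [k] \<phi> x))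
      = (LINT x|lebesgue_on \<Omega>. (\<Sum>k\<in>UNIV. h $ k * (f x * partial_deriv [k] \<phi> x)))"
    by (simp add: sum_distrib_left mult_ac)
  also have "\<dots> = (\<Sum>k\<in>UNIV. h $ k * (LINT x|lebesgue_on \<Omega>. f x * partial_deriv [k] \<phi> x))"
    using i by simp
  also have "\<dots> = (\<Sum>k\<in>UNIV. h $ k * (- (LINT x|lebesgue_on \<Omega>. G k x * \<phi> x)))"
    using G t unfolding weak_deriv_def by simp
  also have "\<dots> = - (\<Sum>k\<in>UNIV. h $ k * (LINT x|lebesgue_on \<Omega>. G k x * \<phi> x))"
    by (simp add: sum_negf)
  also have "(\<Sum>k\<in>UNIV. h $ k * (LINT x|lebesgue_on \<Omega>. G k x * \<phi> x))
      = (LINT x|lebesgue_on \<Omega>. (\<Sum>k\<in>UNIV. h $ k * (G k x * \<phi> x)))"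
    using i by simp
  also have "\<dots> = (LINT x|lebesgue_on \<Omega>. (\<Sum>k\<in>UNIV. h $ k * G k x) * \<phi> x)"
    by (simp add: sum_distrib_left sum_distrib_right mult_ac)
  finally show ?thesis .
qed

lemma integrable_lborel_mult_bounded:
  fixes f :: "'a::euclidean_space \<Rightarrow> real"
  assumes "integrable lborel f" "c \<in> borel_measurable borel" "\<And>x. \<bar>c x\<bar> \<le> C"
  shows "integrable lborel (\<lambda>x. f x * c x)" "(LINT x|lborel. \<bar>f x * c x\<bar>) \<le> C * (LINT x|lborel. \<bar>f x\<bar>)"
proof -
  have C: "0 \<le> C" using assms(3) abs_ge_zero order_trans by blast
  have le: "\<bar>f x * c x\<bar> \<le> C * \<bar>f x\<bar>" for x
    using assms(3)[of x] by (simp add: abs_mult mult.commute[of C] mult_left_mono)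
  show i: "integrable lborel (\<lambda>x. f x * c x)"
  proof (rule Bochner_Integration.integrable_bound)
    show "integrable lborel (\<lambda>x. C * \<bar>f x\<bar>)" using assms(1) by simp
    show "AE x in lborel. norm (f x * c x) \<le> norm (C * \<bar>f x\<bar>)"
      using le C by (intro AE_I2) (simp add: abs_mult)
  qed (use assms borel_measurable_integrable[OF assms(1)] in simp)
  have "(LINT x|lborel. \<bar>f x * c x\<bar>) \<le> (LINT x|lborel. C * \<bar>f x\<bar>)"
    using i assms(1) le by (intro integral_mono) auto
  then show "(LINT x|lborel. \<bar>f x * c x\<bar>) \<le> C * (LINT x|lborel. \<bar>f x\<bar>)" by simp
qed

text \<open>Test against functions supported where the whole segment stays in the convex domain.\<close>

lemma weak_deriv_segment:
  fixes f :: "real ^ 'n \<Rightarrow> real"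
  assumes op: "open \<Omega>" and conv: "convex \<Omega>"
    and G: "\<And>k. weak_deriv \<Omega> [k] f (G k)"
    and fi: "integrable (lebesgue_on \<Omega>) f" and Gi: "\<And>k. integrable (lebesgue_on \<Omega>) (G k)"
    and f0: "borel_version \<Omega> f f0" and g0: "borel_version \<Omega> (\<lambda>x. \<Sum>k\<in>UNIV. h $ k * G k x) g0"
  shows "AE x in lebesgue. x \<in> \<Omega> \<longrightarrow> x + h \<in> \<Omega> \<longrightarrow>
     f0 (x + h) - f0 x = (LINT s|lborel. indicator {0..1} s * g0 (x + s *\<^sub>R h))"
proof -
  have \<Omega>: "\<Omega> \<in> sets lebesgue" using op by auto
  let ?g = "\<lambda>x. \<Sum>k\<in>UNIV. h $ k * G k x"
  have gi: "integrable (lebesgue_on \<Omega>) ?g" using Gi by simp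
  have fm: "f \<in> borel_measurable (lebesgue_on \<Omega>)" and gm: "?g \<in> borel_measurable (lebesgue_on \<Omega>)"
    using fi gi by (auto intro: borel_measurable_integrable)
  have [measurable]: "f0 \<in> borel_measurable borel" "g0 \<in> borel_measurable borel"
    using f0 g0 by (auto simp: borel_version_def)
  have f0i: "integrable lborel f0" using borel_version_integral(1)[OF f0 fm \<Omega>] fi by blast
  have g0i: "integrable lborel g0" using borel_version_integral(1)[OF g0 gm \<Omega>] gi by blast
  have g0s: "integrable lborel (\<lambda>x. g0 (x + v))" for v
    using lborel_integral_translate(2)[of g0 v] g0i by simp
  have f0s: "integrable lborel (\<lambda>x. f0 (x + v))" for v
    using lborel_integral_translate(2)[of f0 v] f0i by simp
  define D where "D x = (LINT s|lborel. indicator {0..1} s * g0 (x + s *\<^sub>R h))" for x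
  have g0B: "(LINT x|lborel. \<bar>g0 (x + v)\<bar>) \<le> (LINT x|lborel. \<bar>g0 x\<bar>)" for v
    using lborel_integral_translate(1)[of "\<lambda>x. \<bar>g0 x\<bar>" v] by simp
  have mg: "case_prod (\<lambda>s x. g0 (x + s *\<^sub>R h)) \<in> borel_measurable (borel \<Otimes>\<^sub>M borel)" by measurable
  have Di: "integrable lborel D"
    unfolding D_def by (rule Fubini_unit_interval(3)[OF mg g0s g0B])
  define \<Omega>h where "\<Omega>h = \<Omega> \<inter> {x. x + h \<in> \<Omega>}"
  have oph: "open \<Omega>h"
  proof -
    have "open ((\<lambda>x. x + h) -` \<Omega>)" by (intro open_vimage op continuous_intros)
    moreover have "(\<lambda>x. x + h) -` \<Omega> = {x. x + h \<in> \<Omega>}" by auto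
    ultimately show ?thesis unfolding \<Omega>h_def using op by auto
  qed
  \<comment> \<open>The goal is v = 0 almost everywhere on \<open>\<Omega>h\<close>. As
    \<open>f0\<close>, its translate and \<open>D\<close> are integrable over the whole space, the
    three parts can be tested separately.\<close>
  define v where "v x = f0 (x + h) - f0 x - D x" for x
  have vi: "integrable lborel v" unfolding v_def using f0i f0s Di by simp
  have vb: "v \<in> borel_measurable borel" using borel_measurable_integrable[OF vi] by simp
  have "integrable lebesgue v" using vi vb by (simp add: integrable_completion)
  then have "integrable (lebesgue_on UNIV) v" by (simp add: lebesgue_on_UNIV_eq)
  then have li: "locally_integrable UNIV v" by (rule integrable_imp_locally_integrable) simp
  then have li: "locally_integrable \<Omega>h v" by (simp add: locally_integrable_def)
  have "AE x in lebesgue_on \<Omega>h. v x = 0"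
  proof (rule AE_zero_if_test_zero[OF oph li])
    fix \<phi> assume t: "test_function \<Omega>h \<phi>"
    obtain K where K: "smooth \<phi>" "compact K" "K \<subseteq> \<Omega>h" "\<And>x. x \<notin> K \<Longrightarrow> \<phi> x = 0"
      using test_functionE[OF t] by metis
    define D\<phi> where "D\<phi> y = (\<Sum>k\<in>UNIV. h $ k * partial_deriv [k] \<phi> y)" for y
    have c\<phi>: "continuous_on UNIV \<phi>" by (rule smooth_continuous_on[OF K(1)])
    have cD: "continuous_on UNIV D\<phi>"
      unfolding D\<phi>_def by (intro continuous_intros smooth_continuous_on smooth_partial_deriv K(1))
    have [measurable]: "\<phi> \<in> borel_measurable borel" "D\<phi> \<in> borel_measurable borel"
      using c\<phi> cD by (auto intro: borel_measurable_continuous_onI)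
    obtain C where C: "\<And>x. \<bar>\<phi> x\<bar> \<le> C" using continuous_compact_support_bounded[OF c\<phi> K(2,4)] by blast
    have "D\<phi> y = 0" if "y \<notin> K" for y
      unfolding D\<phi>_def using partial_deriv_outside[OF compact_imp_closed[OF K(2)] K(4) that] by simp
    then obtain C' where C': "\<And>x. \<bar>D\<phi> x\<bar> \<le> C'" using continuous_compact_support_bounded[OF cD K(2)] by blast
    \<comment> \<open>For \<open>s\<close> between 0 and 1 convexity keeps the shifted support in
      \<open>\<Omega>\<close>, so the shifted function may be used to test the weak
      derivative.\<close>
    have t': "test_function \<Omega> (\<lambda>x. \<phi> (x + - (s *\<^sub>R h)))" if s: "0 \<le> s" "s \<le> 1" for s
    proof (rule test_function_translate[OF t])
      show "x \<in> (+) (s *\<^sub>R h) ` K" if "\<phi> (x + - (s *\<^sub>R h)) \<noteq> 0" for x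
        using K(4)[of "x + - (s *\<^sub>R h)"] that by (intro image_eqI[of _ _ "x + - (s *\<^sub>R h)"]) auto
      show "compact ((+) (s *\<^sub>R h) ` K)" by (rule compact_translation[OF K(2)])
      show "(+) (s *\<^sub>R h) ` K \<subseteq> \<Omega>"
      proof
        fix y assume "y \<in> (+) (s *\<^sub>R h) ` K"
        then obtain x where x: "x \<in> K" "y = s *\<^sub>R h + x" by auto
        then have "x \<in> \<Omega>" "x + h \<in> \<Omega>" using K(3) by (auto simp: \<Omega>h_def)
        then have "(1 - s) *\<^sub>R x + s *\<^sub>R (x + h) \<in> \<Omega>" using conv s by (intro convexD) auto
        moreover have "(1 - s) *\<^sub>R x + s *\<^sub>R (x + h) = y" by (simp add: x algebra_simps)
        ultimately show "y \<in> \<Omega>" by simp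
      qed
    qed
    have B: "(LINT y|lborel. f0 y * D\<phi> (y + - (s *\<^sub>R h))) = - (LINT y|lborel. g0 y * \<phi> (y + - (s *\<^sub>R h)))"
      if s: "0 \<le> s" "s \<le> 1" for s
    proof -
      let ?\<phi> = "\<lambda>y. \<phi> (y + - (s *\<^sub>R h))" and ?D = "\<lambda>y. D\<phi> (y + - (s *\<^sub>R h))"
      have m: "?\<phi> \<in> borel_measurable borel" "?D \<in> borel_measurable borel" by measurable
      have m': "?\<phi> \<in> borel_measurable (lebesgue_on \<Omega>)" "?D \<in> borel_measurable (lebesgue_on \<Omega>)"
        using m by (auto intro!: measurable_restrict_space1 measurable_completion)
      have "(LINT y|lborel. f0 y * ?D y) = (LINT y|lebesgue_on \<Omega>. f y * ?D y)"
        using borel_version_integral(2)[OF borel_version_mult[OF f0 m(2)] borel_measurable_times[OF fm m'(2)] \<Omega>] by simp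
      also have "\<dots> = (LINT y|lebesgue_on \<Omega>. f y * (\<Sum>k\<in>UNIV. h $ k * partial_deriv [k] ?\<phi> y))"
        unfolding D\<phi>_def partial_deriv_translate[OF K(1)] ..
      also have "\<dots> = - (LINT y|lebesgue_on \<Omega>. ?g y * ?\<phi> y)"
        by (rule weak_directional_deriv[OF op G t'[OF s]])
      also have "(LINT y|lebesgue_on \<Omega>. ?g y * ?\<phi> y) = (LINT y|lborel. g0 y * ?\<phi> y)"
        using borel_version_integral(2)[OF borel_version_mult[OF g0 m(1)] borel_measurable_times[OF gm m'(1)] \<Omega>] by simp
      finally show ?thesis .
    qed
    have A: "(LINT s|lborel. indicator {0..1} s * (LINT y|lborel. f0 y * D\<phi> (y + - (s *\<^sub>R h))))
        = (LINT y|lborel. f0 y * (\<phi> y - \<phi> (y - h)))"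
    proof -
      have "(LINT s|lborel. indicator {0..1} s * (LINT y|lborel. f0 y * D\<phi> (y + - (s *\<^sub>R h))))
        = (LINT y|lborel. (LINT s|lborel. indicator {0..1} s * (f0 y * D\<phi> (y + - (s *\<^sub>R h)))))"
      proof (rule Fubini_unit_interval(1))
        show "case_prod (\<lambda>s y. f0 y * D\<phi> (y + - (s *\<^sub>R h))) \<in> borel_measurable (borel \<Otimes>\<^sub>M borel)" by measurable
        show "integrable lborel (\<lambda>y. f0 y * D\<phi> (y + - (s *\<^sub>R h)))" for s
          by (rule integrable_lborel_mult_bounded(1)[OF f0i _ C']) measurable
        show "(LINT y|lborel. \<bar>f0 y * D\<phi> (y + - (s *\<^sub>R h))\<bar>) \<le> C' * (LINT x|lborel. \<bar>f0 x\<bar>)" for s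
          by (rule integrable_lborel_mult_bounded(2)[OF f0i _ C']) measurable
      qed
      also have "\<dots> = (LINT y|lborel. f0 y * (\<phi> y - \<phi> (y - h)))"
      proof (rule Bochner_Integration.integral_cong[OF refl])
        fix y
        \<comment> \<open>Fundamental theorem of calculus along the backward shift: the
          \<open>s\<close>-derivative of \<phi>(y - s h) is minus the directional derivative there,
          hence the primitive with the minus sign.\<close>
        have "(LINT s|lborel. D\<phi> (y + - (s *\<^sub>R h)) * indicator {0..1} s) = - \<phi> (y + 1 *\<^sub>R (- h)) - - \<phi> (y + 0 *\<^sub>R (- h))"
        proof (rule integral_FTC_Icc_real)
          fix s :: real
          have "((\<lambda>s. \<phi> (y + s *\<^sub>R (- h))) has_real_derivative (\<Sum>k\<in>UNIV. (- h) $ k * partial_deriv [k] \<phi> (y + s *\<^sub>R (- h)))) (at s)"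
            by (rule has_real_derivative_line[OF smooth_differentiable[OF K(1)]])
          from DERIV_minus[OF this]
          show "((\<lambda>s. - \<phi> (y + s *\<^sub>R (- h))) has_real_derivative D\<phi> (y + - (s *\<^sub>R h))) (at s)"
            by (simp add: D\<phi>_def sum_negf)
          have "isCont (\<lambda>s. y + - (s *\<^sub>R h)) s" by (intro continuous_intros)
          moreover have "isCont D\<phi> x" for x
            using cD continuous_on_eq_continuous_at[OF open_UNIV] by blast
          ultimately show "isCont (\<lambda>s. D\<phi> (y + - (s *\<^sub>R h))) s"
            by (rule isCont_o2[where g = D\<phi>])
        qed simp
        then have "(LINT s|lborel. D\<phi> (y + - (s *\<^sub>R h)) * indicator {0..1} s) = \<phi> y - \<phi> (y - h)" by simp
        moreover have "(LINT s|lborel. indicator {0..1} s * (f0 y * D\<phi> (y + - (s *\<^sub>R h))))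
          = f0 y * (LINT s|lborel. D\<phi> (y + - (s *\<^sub>R h)) * indicator {0..1} s)"
        proof -
          have "(LINT s|lborel. indicator {0..1} s * (f0 y * D\<phi> (y + - (s *\<^sub>R h))))
            = (LINT s|lborel. f0 y * (D\<phi> (y + - (s *\<^sub>R h)) * indicator {0..1} s))"
            by (simp only: mult_ac)
          then show ?thesis by (simp only: integral_mult_right_zero)
        qed
        ultimately show "(LINT s|lborel. indicator {0..1} s * (f0 y * D\<phi> (y + - (s *\<^sub>R h)))) = f0 y * (\<phi> y - \<phi> (y - h))"
          by simp
      qed
      finally show ?thesis .
    qed
    have Cc: "(LINT s|lborel. indicator {0..1} s * (LINT x|lborel. g0 (x + s *\<^sub>R h) * \<phi> x)) = (LINT x|lborel. D x * \<phi> x)"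
    proof -
      have "(LINT s|lborel. indicator {0..1} s * (LINT x|lborel. g0 (x + s *\<^sub>R h) * \<phi> x))
        = (LINT x|lborel. (LINT s|lborel. indicator {0..1} s * (g0 (x + s *\<^sub>R h) * \<phi> x)))"
      proof (rule Fubini_unit_interval(1))
        show "case_prod (\<lambda>s x. g0 (x + s *\<^sub>R h) * \<phi> x) \<in> borel_measurable (borel \<Otimes>\<^sub>M borel)" by measurable
        show "integrable lborel (\<lambda>x. g0 (x + s *\<^sub>R h) * \<phi> x)" for s
          by (rule integrable_lborel_mult_bounded(1)[OF g0s _ C]) measurable
        have "0 \<le> C" using C abs_ge_zero order_trans by blast
        then have "C * (LINT x|lborel. \<bar>g0 (x + s *\<^sub>R h)\<bar>) \<le> C * (LINT x|lborel. \<bar>g0 x\<bar>)" for s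
          using g0B by (rule mult_left_mono[rotated])
        moreover have "(LINT x|lborel. \<bar>g0 (x + s *\<^sub>R h) * \<phi> x\<bar>) \<le> C * (LINT x|lborel. \<bar>g0 (x + s *\<^sub>R h)\<bar>)" for s
          by (rule integrable_lborel_mult_bounded(2)[OF g0s _ C]) measurable
        ultimately show "(LINT x|lborel. \<bar>g0 (x + s *\<^sub>R h) * \<phi> x\<bar>) \<le> C * (LINT x|lborel. \<bar>g0 x\<bar>)" for s
          using order_trans by blast
      qed
      also have "\<dots> = (LINT x|lborel. D x * \<phi> x)"
        unfolding D_def by (simp add: mult.assoc[symmetric])
      finally show ?thesis .
    qed
    have tr: "(LINT x|lborel. g0 (x + s *\<^sub>R h) * \<phi> x) = (LINT y|lborel. g0 y * \<phi> (y + - (s *\<^sub>R h)))" for s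
      using lborel_integral_translate(1)[of "\<lambda>y. g0 y * \<phi> (y + - (s *\<^sub>R h))" "s *\<^sub>R h"] by simp
    have trf: "(LINT x|lborel. f0 (x + h) * \<phi> x) = (LINT y|lborel. f0 y * \<phi> (y - h))"
      using lborel_integral_translate(1)[of "\<lambda>y. f0 y * \<phi> (y - h)" h] by simp
    \<comment> \<open>The identity \<open>B\<close> is integrated over the segment. Its left side
      has become a difference of shifts by \<open>A\<close>, and its right side is the pairing of
      \<open>D\<close> with \<open>\<phi>\<close> after a translation.\<close>
    have "(LINT y|lborel. f0 y * (\<phi> y - \<phi> (y - h))) = (LINT s|lborel. - (indicator {0..1} s * (LINT x|lborel. g0 (x + s *\<^sub>R h) * \<phi> x)))"
      unfolding A[symmetric]
    proof (rule Bochner_Integration.integral_cong[OF refl])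
      fix s :: real
      show "indicator {0..1} s * (LINT y|lborel. f0 y * D\<phi> (y + - (s *\<^sub>R h))) = - (indicator {0..1} s * (LINT x|lborel. g0 (x + s *\<^sub>R h) * \<phi> x))"
        using B[of s] unfolding tr by (cases "s \<in> {0..1}") auto
    qed
    also have "\<dots> = - (LINT x|lborel. D x * \<phi> x)" using Cc by simp
    finally have e: "(LINT y|lborel. f0 y * (\<phi> y - \<phi> (y - h))) = - (LINT x|lborel. D x * \<phi> x)" .
    have i1: "integrable lborel (\<lambda>y. f0 y * \<phi> y)"
      by (rule integrable_lborel_mult_bounded(1)[OF f0i _ C]) measurable
    have i2: "integrable lborel (\<lambda>y. f0 y * \<phi> (y - h))"
      by (rule integrable_lborel_mult_bounded(1)[OF f0i _ C]) measurable
    have i3: "integrable lborel (\<lambda>y. f0 (y + h) * \<phi> y)"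
      by (rule integrable_lborel_mult_bounded(1)[OF f0s _ C]) measurable
    have i4: "integrable lborel (\<lambda>y. D y * \<phi> y)"
      by (rule integrable_lborel_mult_bounded(1)[OF Di _ C]) measurable
    have "(LINT x|lborel. v x * \<phi> x) = (LINT x|lborel. f0 (x + h) * \<phi> x - f0 x * \<phi> x - D x * \<phi> x)"
      by (simp add: v_def left_diff_distrib)
    also have "\<dots> = (LINT y|lborel. f0 y * \<phi> (y - h)) - (LINT y|lborel. f0 y * \<phi> y) - (LINT x|lborel. D x * \<phi> x)"
      using i1 i3 i4 trf by simp
    also have "\<dots> = - (LINT y|lborel. f0 y * (\<phi> y - \<phi> (y - h))) - (LINT x|lborel. D x * \<phi> x)"
      using i1 i2 by (simp add: right_diff_distrib)
    also have "\<dots> = 0" using e by simp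
    finally have "(LINT x|lborel. v x * \<phi> x) = 0" .
    moreover have "(LINT x|lebesgue. v x * \<phi> x) = (LINT x|lborel. v x * \<phi> x)"
      using vb by (intro integral_completion) simp
    ultimately show "(LINT x|lebesgue_on \<Omega>h. v x * \<phi> x) = 0"
      using integral_test_function(1)[OF oph t] by simp
  qed
  then have "AE x in lebesgue. x \<in> \<Omega>h \<longrightarrow> v x = 0" using oph by (simp add: AE_restrict_space_iff)
  then show ?thesis by eventually_elim (auto simp: \<Omega>h_def v_def D_def)
qed

section \<open>Translation estimate and the two Poincare inequalities\<close>

lemma sum_powr_le:
  fixes a :: "'k \<Rightarrow> real"
  assumes fin: "finite A" and a: "\<And>k. k \<in> A \<Longrightarrow> 0 \<le> a k" and p: "0 \<le> p"
  shows "(\<Sum>k\<in>A. a k) powr p \<le> real (card A) powr p * (\<Sum>k\<in>A. a k powr p)"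
proof (cases "A = {}")
  case False
  define m where "m = Max (a ` A)"
  have m: "m \<in> a ` A" unfolding m_def using fin False by (intro Max_in) auto
  then obtain j where j: "j \<in> A" "m = a j" by blast
  have "(\<Sum>k\<in>A. a k) \<le> real (card A) * m"
    using fin by (intro sum_bounded_above) (auto simp: m_def)
  then have "(\<Sum>k\<in>A. a k) powr p \<le> (real (card A) * m) powr p"
    using p a by (intro powr_mono2) (auto intro: sum_nonneg)
  also have "\<dots> = real (card A) powr p * m powr p" using a j by (simp add: powr_mult)
  also have "m powr p \<le> (\<Sum>k\<in>A. a k powr p)"
    unfolding j(2) using j(1) fin by (intro member_le_sum) auto
  finally show ?thesis by (simp add: mult_left_mono)
qed simp

lemma lborel_nn_integral_translate:
  fixes f :: "'a::euclidean_space \<Rightarrow> ennreal"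
  assumes "f \<in> borel_measurable borel"
  shows "(\<integral>\<^sup>+x. f (x + h) \<partial>lborel) = (\<integral>\<^sup>+x. f x \<partial>lborel)"
proof -
  have m: "(+) h \<in> lborel \<rightarrow>\<^sub>M borel" by simp
  have "(\<integral>\<^sup>+x. f x \<partial>lborel) = (\<integral>\<^sup>+x. f x \<partial>distr lborel borel ((+) h))" by (simp add: lborel_distr_plus)
  also have "\<dots> = (\<integral>\<^sup>+x. f (h + x) \<partial>lborel)" using assms by (intro nn_integral_distr[OF m]) simp
  finally show ?thesis by (simp add: add.commute)
qed

lemma p_norm_borel_version:
  fixes u :: "'a::euclidean_space \<Rightarrow> real"
  assumes u: "borel_version \<Omega> u u0" "p_integrable (lebesgue_on \<Omega>) p u" and \<Omega>: "\<Omega> \<in> sets lebesgue"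
  shows "integrable lborel (\<lambda>x. \<bar>u0 x\<bar> powr p)"
    and "(LINT x|lborel. \<bar>u0 x\<bar> powr p) = (LINT x|lebesgue_on \<Omega>. \<bar>u x\<bar> powr p)"
proof -
  have v: "borel_version \<Omega> (\<lambda>x. \<bar>u x\<bar> powr p) (\<lambda>x. \<bar>u0 x\<bar> powr p)"
    by (rule borel_version_compose[OF u(1)]) auto
  have m: "(\<lambda>x. \<bar>u x\<bar> powr p) \<in> borel_measurable (lebesgue_on \<Omega>)"
    using u(2) by (auto simp: p_integrable_def intro: borel_measurable_integrable)
  show "integrable lborel (\<lambda>x. \<bar>u0 x\<bar> powr p)"
    using borel_version_integral(1)[OF v m \<Omega>] u(2) by (simp add: p_integrable_def)
  show "(LINT x|lborel. \<bar>u0 x\<bar> powr p) = (LINT x|lebesgue_on \<Omega>. \<bar>u x\<bar> powr p)"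
    using borel_version_integral(2)[OF v m \<Omega>] by simp
qed

text \<open>The increment is the average of the directional derivative over the segment from
  \<open>x\<close> to x + h. Jensen's inequality in \<open>s\<close>, Fubini's theorem and
  translation invariance leave the p-norm of the directional derivative, which is bounded by the
  norm of \<open>h\<close> times the partial derivatives. The extended integral is the form that
  Tonelli's theorem takes up later.\<close>

lemma translation_estimate:
  fixes f :: "real ^ 'n \<Rightarrow> real"
  assumes op: "open \<Omega>" and conv: "convex \<Omega>" and p: "1 < p"
    and G: "\<And>k. weak_deriv \<Omega> [k] f (G k)"
    and fi: "integrable (lebesgue_on \<Omega>) f" and Gi: "\<And>k. integrable (lebesgue_on \<Omega>) (G k)"
    and Gp: "\<And>k. p_integrable (lebesgue_on \<Omega>) p (G k)"
    and f0: "borel_version \<Omega> f f0"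
  shows "(\<integral>\<^sup>+x. indicator {x. x \<in> \<Omega> \<and> x + h \<in> \<Omega>} x * ennreal (\<bar>f0 (x + h) - f0 x\<bar> powr p) \<partial>lborel)
      \<le> ennreal (real CARD('n) powr p * norm h powr p * (\<Sum>k\<in>UNIV. LINT x|lebesgue_on \<Omega>. \<bar>G k x\<bar> powr p))"
proof -
  have \<Omega>: "\<Omega> \<in> sets lebesgue" using op by auto
  let ?g = "\<lambda>x. \<Sum>k\<in>UNIV. h $ k * G k x"
  have gm: "?g \<in> borel_measurable (lebesgue_on \<Omega>)"
    using Gi by (intro borel_measurable_integrable) simp
  obtain g0 where g0: "borel_version \<Omega> ?g g0" using borel_version_exists[OF gm \<Omega>] .
  have [measurable]: "g0 \<in> borel_measurable borel" using g0 by (simp add: borel_version_def)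
  have pw: "\<bar>?g x\<bar> powr p \<le> real CARD('n) powr p * norm h powr p * (\<Sum>k\<in>UNIV. \<bar>G k x\<bar> powr p)" for x
  proof -
    have "\<bar>?g x\<bar> \<le> (\<Sum>k\<in>UNIV. \<bar>h $ k * G k x\<bar>)" by (rule sum_abs)
    also have "\<dots> \<le> (\<Sum>k\<in>UNIV. norm h * \<bar>G k x\<bar>)"
      unfolding abs_mult by (intro sum_mono mult_right_mono component_le_norm_cart) auto
    finally have "\<bar>?g x\<bar> powr p \<le> (\<Sum>k\<in>UNIV. norm h * \<bar>G k x\<bar>) powr p"
      using p by (intro powr_mono2) auto
    also have "\<dots> \<le> real CARD('n) powr p * (\<Sum>k\<in>UNIV. (norm h * \<bar>G k x\<bar>) powr p)"
      using p by (intro sum_powr_le) auto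
    also have "\<dots> = real CARD('n) powr p * norm h powr p * (\<Sum>k\<in>UNIV. \<bar>G k x\<bar> powr p)"
      by (simp add: powr_mult sum_distrib_left mult.assoc)
    finally show ?thesis .
  qed
  have Gpi: "integrable (lebesgue_on \<Omega>) (\<lambda>x. \<bar>G k x\<bar> powr p)" for k using Gp by (simp add: p_integrable_def)
  have gp: "p_integrable (lebesgue_on \<Omega>) p ?g"
    by (rule p_integrable_bound[where g = "\<lambda>x. real CARD('n) powr p * norm h powr p * (\<Sum>k\<in>UNIV. \<bar>G k x\<bar> powr p)"])
      (use Gpi gm pw in auto)
  note g0p = p_norm_borel_version[OF g0 gp \<Omega>]
  have g0s: "integrable lborel (\<lambda>x. \<bar>g0 (x + v)\<bar> powr p)" for v
    using lborel_integral_translate(2)[of "\<lambda>x. \<bar>g0 x\<bar> powr p" v] g0p(1) by simp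
  have g0e: "(LINT x|lborel. \<bar>g0 (x + v)\<bar> powr p) = (LINT x|lborel. \<bar>g0 x\<bar> powr p)" for v
    using lborel_integral_translate(1)[of "\<lambda>x. \<bar>g0 x\<bar> powr p" v] by simp
  let ?\<psi> = "\<lambda>s x. \<bar>g0 (x + s *\<^sub>R h)\<bar> powr p"
  have m\<psi>: "case_prod ?\<psi> \<in> borel_measurable (borel \<Otimes>\<^sub>M borel)" by measurable
  have B: "(LINT x|lborel. \<bar>?\<psi> s x\<bar>) \<le> (LINT x|lborel. \<bar>g0 x\<bar> powr p)" for s
    using g0e by simp
  note F = Fubini_unit_interval[of ?\<psi>, OF m\<psi> g0s B]
  define Dp where "Dp x = (LINT s|lborel. indicator {0..1} s * ?\<psi> s x)" for x
  have Dpi: "integrable lborel Dp" unfolding Dp_def using F(3) .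
  have Dp0: "0 \<le> Dp x" for x unfolding Dp_def by (intro Bochner_Integration.integral_nonneg) auto
  have Dpe: "(LINT x|lborel. Dp x) = (LINT x|lborel. \<bar>g0 x\<bar> powr p)"
    unfolding Dp_def F(1)[symmetric] g0e by simp
  \<comment> \<open>The unit interval has measure 1, so Jensen's inequality holds there without a
    factor.\<close>
  let ?M = "restrict_space lborel {0..1::real}"
  have M: "finite_measure ?M"
    by (intro finite_measureI) (simp add: emeasure_restrict_space space_restrict_space)
  have M1: "measure ?M (space ?M) = 1"
    by (simp add: measure_restrict_space space_restrict_space)
  have seg: "AE x in lborel. x \<in> \<Omega> \<longrightarrow> x + h \<in> \<Omega> \<longrightarrow>
     f0 (x + h) - f0 x = (LINT s|lborel. indicator {0..1} s * g0 (x + s *\<^sub>R h))"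
    using weak_deriv_segment[OF op conv G fi Gi f0 g0] by (simp add: AE_completion_iff)
  have "AE x in lborel. indicator {x. x \<in> \<Omega> \<and> x + h \<in> \<Omega>} x * ennreal (\<bar>f0 (x + h) - f0 x\<bar> powr p) \<le> ennreal (Dp x)"
    using seg F(2)
  proof eventually_elim
    case (elim x)
    show ?case
    proof (cases "x \<in> \<Omega> \<and> x + h \<in> \<Omega>")
      case True
      have mm: "(\<lambda>s. g0 (x + s *\<^sub>R h)) \<in> borel_measurable ?M"
        by (intro measurable_restrict_space1) measurable
      have int: "integral\<^sup>L ?M k = (LINT s|lborel. indicator {0..1} s * k s)" for k :: "real \<Rightarrow> real"
        by (subst integral_restrict_space) auto
      have "p_integrable ?M p (\<lambda>s. g0 (x + s *\<^sub>R h))"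
        unfolding p_integrable_def using mm elim(2) by (subst integrable_restrict_space) auto
      from jensen_powr_integral[OF M M1 _ p this]
      have "\<bar>LINT s|?M. g0 (x + s *\<^sub>R h)\<bar> powr p \<le> (LINT s|?M. \<bar>g0 (x + s *\<^sub>R h)\<bar> powr p)" by simp
      then have "\<bar>f0 (x + h) - f0 x\<bar> powr p \<le> Dp x"
        using elim(1) True unfolding int Dp_def by simp
      then show ?thesis using True by (simp add: ennreal_leI)
    qed simp
  qed
  then have "(\<integral>\<^sup>+x. indicator {x. x \<in> \<Omega> \<and> x + h \<in> \<Omega>} x * ennreal (\<bar>f0 (x + h) - f0 x\<bar> powr p) \<partial>lborel)
      \<le> (\<integral>\<^sup>+x. ennreal (Dp x) \<partial>lborel)"
    by (rule nn_integral_mono_AE)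
  also have "\<dots> = ennreal (LINT x|lborel. Dp x)"
    by (rule nn_integral_eq_integral[OF Dpi]) (simp add: Dp0)
  also have "(LINT x|lborel. Dp x) = (LINT x|lebesgue_on \<Omega>. \<bar>?g x\<bar> powr p)"
    unfolding Dpe g0p(2) ..
  also have "\<dots> \<le> (LINT x|lebesgue_on \<Omega>. real CARD('n) powr p * norm h powr p * (\<Sum>k\<in>UNIV. \<bar>G k x\<bar> powr p))"
    using gp Gpi pw by (intro integral_mono) (auto simp: p_integrable_def)
  also have "\<dots> = real CARD('n) powr p * norm h powr p * (\<Sum>k\<in>UNIV. LINT x|lebesgue_on \<Omega>. \<bar>G k x\<bar> powr p)"
    using Gpi by simp
  finally show ?thesis by (simp add: ennreal_leI)
qed

text \<open>A function of mean zero equals at each \<open>x\<close> the average of f(x) - f(y) over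
  \<open>y\<close>. With y = x + h the double integral is rearranged so that \<open>h\<close> is
  outermost, and each \<open>h\<close> is covered by the translation estimate.\<close>

lemma poincare_mean_zero:
  fixes \<Omega> :: "(real ^ 'n) set"
  assumes op: "open \<Omega>" and conv: "convex \<Omega>" and bdd: "bounded \<Omega>" and ne: "\<Omega> \<noteq> {}" and p: "1 < p"
  obtains C where "0 \<le> C" "\<And>f G. (\<And>k. weak_deriv \<Omega> [k] f (G k)) \<Longrightarrow> p_integrable (lebesgue_on \<Omega>) p f \<Longrightarrow>
    (\<And>k. p_integrable (lebesgue_on \<Omega>) p (G k)) \<Longrightarrow> (LINT x|lebesgue_on \<Omega>. f x) = 0 \<Longrightarrow>
    (LINT x|lebesgue_on \<Omega>. \<bar>f x\<bar> powr p) \<le> C * (\<Sum>k\<in>UNIV. LINT x|lebesgue_on \<Omega>. \<bar>G k x\<bar> powr p)"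
proof -
  have \<Omega>m: "\<Omega> \<in> lmeasurable" using lmeasurable_open[OF bdd op] .
  have \<Omega>: "\<Omega> \<in> sets lebesgue" using op by auto
  have [measurable]: "\<Omega> \<in> sets borel" using op by simp
  define V where "V = measure lebesgue \<Omega>"
  have fin: "finite_measure (lebesgue_on \<Omega>)" by (rule finite_measure_lebesgue_on[OF \<Omega>m])
  have MV: "measure (lebesgue_on \<Omega>) (space (lebesgue_on \<Omega>)) = V"
    using \<Omega> by (simp add: V_def measure_restrict_space space_restrict_space)
  have V: "0 < V"
  proof -
    have "\<not> negligible \<Omega>" using open_not_negligible[OF op ne] .
    then have "measure lebesgue \<Omega> \<noteq> 0" using \<Omega>m negligible_iff_measure by blast
    then show ?thesis unfolding V_def by (simp add: zero_less_measure_iff)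
  qed
  obtain R where R: "0 < R" "\<And>x. x \<in> \<Omega> \<Longrightarrow> norm x \<le> R" using bounded_pos[of \<Omega>] bdd by auto
  \<comment> \<open>Differences of points of the domain lie in the ball of radius 2 R, so only such
    \<open>h\<close> contribute: \<open>W\<close> is the volume of that ball, and \<open>Q\<close>
    bounds the factor of the translation estimate on it.\<close>
  define W where "W = measure lborel (cball (0 :: real ^ 'n) (2 * R))"
  define Q where "Q = real CARD('n) powr p * (2 * R) powr p"
  show ?thesis
  proof (rule that)
    show "0 \<le> 1 / V * (Q * W)" using V by (simp add: Q_def W_def)
    fix f :: "real ^ 'n \<Rightarrow> real" and G
    assume G: "\<And>k. weak_deriv \<Omega> [k] f (G k)" and fp: "p_integrable (lebesgue_on \<Omega>) p f"
      and Gp: "\<And>k. p_integrable (lebesgue_on \<Omega>) p (G k)" and mean: "(LINT x|lebesgue_on \<Omega>. f x) = 0"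
    have fi: "integrable (lebesgue_on \<Omega>) f" and Gi: "\<And>k. integrable (lebesgue_on \<Omega>) (G k)"
      using p_integrable_imp_integrable[OF fin _ fp] p_integrable_imp_integrable[OF fin _ Gp] p by auto
    have fm: "f \<in> borel_measurable (lebesgue_on \<Omega>)" using fi by simp
    obtain f0 where f0: "borel_version \<Omega> f f0" using borel_version_exists[OF fm \<Omega>] .
    have f0m[measurable]: "f0 \<in> borel_measurable borel" using f0 by (simp add: borel_version_def)
    define A where "A = (\<Sum>k\<in>UNIV. LINT x|lebesgue_on \<Omega>. \<bar>G k x\<bar> powr p)"
    have A0: "0 \<le> A" unfolding A_def by (intro sum_nonneg Bochner_Integration.integral_nonneg) auto
    have QAW: "0 \<le> Q * A" "0 \<le> W" using A0 by (simp_all add: Q_def W_def)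
    note f0p = p_norm_borel_version[OF f0 fp \<Omega>]
    have ae0: "AE x in lborel. x \<notin> \<Omega> \<longrightarrow> f0 x = 0"
    proof -
      have "AE x in lborel. (if x \<in> \<Omega> then f x else 0) = f0 x" using f0 by (simp add: borel_version_def)
      then show ?thesis by eventually_elim auto
    qed
    have aeq: "AE x in lebesgue_on \<Omega>. f0 x = f x"
    proof -
      have "AE x in lebesgue. (if x \<in> \<Omega> then f x else 0) = f0 x"
        using f0 unfolding borel_version_def by (intro AE_completion) blast
      then have "AE x in lebesgue. x \<in> \<Omega> \<longrightarrow> f0 x = f x" by eventually_elim auto
      then show ?thesis using \<Omega> by (simp add: AE_restrict_space_iff)
    qed
    have f0M: "f0 \<in> borel_measurable (lebesgue_on \<Omega>)"
      using f0m by (intro measurable_restrict_space1 measurable_completion) simp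
    have f0P: "p_integrable (lebesgue_on \<Omega>) p f0"
      using p_integrable_cong_AE[OF fp f0M] aeq by (simp add: eq_commute)
    have f0mean: "(LINT x|lebesgue_on \<Omega>. f0 x) = 0"
      using integral_cong_AE[OF f0M fm aeq] mean by simp
    have cP: "p_integrable (lebesgue_on \<Omega>) p (\<lambda>y. c)" for c
      unfolding p_integrable_def using finite_measure.integrable_const[OF fin] by auto
    \<comment> \<open>As the mean vanishes, V f0(x) is the integral of f0(x) - f0(y) over
      \<open>y\<close>. Jensen's inequality brings the factor V^(p-1), which cancels and leaves 1 /
      V.\<close>
    have pt: "\<bar>f0 x\<bar> powr p \<le> 1 / V * (LINT y|lebesgue_on \<Omega>. \<bar>f0 x - f0 y\<bar> powr p)" for x
    proof -
      have dP: "p_integrable (lebesgue_on \<Omega>) p (\<lambda>y. f0 x - f0 y)"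
        using p by (intro p_integrable_diff cP f0P) simp
      have f0I: "integrable (lebesgue_on \<Omega>) f0" using p_integrable_imp_integrable[OF fin _ f0P] p by simp
      have "(LINT y|lebesgue_on \<Omega>. f0 x - f0 y) = V * f0 x"
        using f0I f0mean MV finite_measure.integrable_const[OF fin, of "f0 x"] by simp
      then have "\<bar>V * f0 x\<bar> powr p \<le> V powr (p - 1) * (LINT y|lebesgue_on \<Omega>. \<bar>f0 x - f0 y\<bar> powr p)"
        using jensen_powr_integral[OF fin MV V p dP] by simp
      also have "\<bar>V * f0 x\<bar> powr p = V powr (p - 1) * (V * \<bar>f0 x\<bar> powr p)"
        using V by (simp add: abs_mult powr_mult powr_diff)
      finally have "V * \<bar>f0 x\<bar> powr p \<le> (LINT y|lebesgue_on \<Omega>. \<bar>f0 x - f0 y\<bar> powr p)"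
        using V by simp
      then show ?thesis using V by (simp add: field_simps)
    qed
    have ptn: "ennreal (\<bar>f0 x\<bar> powr p) \<le> ennreal (1 / V) * (\<integral>\<^sup>+y. indicator \<Omega> y * ennreal (\<bar>f0 x - f0 y\<bar> powr p) \<partial>lborel)" for x
    proof -
      have dP: "p_integrable (lebesgue_on \<Omega>) p (\<lambda>y. f0 x - f0 y)"
        using p by (intro p_integrable_diff cP f0P) simp
      have "ennreal (\<bar>f0 x\<bar> powr p) \<le> ennreal (1 / V * (LINT y|lebesgue_on \<Omega>. \<bar>f0 x - f0 y\<bar> powr p))"
        by (rule ennreal_leI[OF pt])
      also have "\<dots> = ennreal (1 / V) * ennreal (LINT y|lebesgue_on \<Omega>. \<bar>f0 x - f0 y\<bar> powr p)"
        using V by (intro ennreal_mult) auto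
      also have "ennreal (LINT y|lebesgue_on \<Omega>. \<bar>f0 x - f0 y\<bar> powr p) = (\<integral>\<^sup>+y. ennreal (\<bar>f0 x - f0 y\<bar> powr p) \<partial>lebesgue_on \<Omega>)"
        using dP by (intro nn_integral_eq_integral[symmetric]) (auto simp: p_integrable_def)
      also have "\<dots> = (\<integral>\<^sup>+y. ennreal (\<bar>f0 x - f0 y\<bar> powr p) * indicator \<Omega> y \<partial>lebesgue)"
        using \<Omega> by (intro nn_integral_restrict_space) auto
      also have "\<dots> = (\<integral>\<^sup>+y. ennreal (\<bar>f0 x - f0 y\<bar> powr p) * indicator \<Omega> y \<partial>lborel)"
        by (intro nn_integral_completion)
      finally show ?thesis by (simp add: mult.commute)
    qed
    let ?\<Phi> = "\<lambda>x h. indicator \<Omega> x * (indicator \<Omega> (h + x) * ennreal (\<bar>f0 x - f0 (h + x)\<bar> powr p))"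
    have "ennreal (LINT x|lborel. \<bar>f0 x\<bar> powr p) = (\<integral>\<^sup>+x. ennreal (\<bar>f0 x\<bar> powr p) \<partial>lborel)"
      using f0p(1) by (intro nn_integral_eq_integral[symmetric]) auto
    also have "\<dots> = (\<integral>\<^sup>+x. indicator \<Omega> x * ennreal (\<bar>f0 x\<bar> powr p) \<partial>lborel)"
    proof (rule nn_integral_cong_AE)
      show "AE x in lborel. ennreal (\<bar>f0 x\<bar> powr p) = indicator \<Omega> x * ennreal (\<bar>f0 x\<bar> powr p)"
        using ae0 by eventually_elim (auto simp: indicator_def)
    qed
    also have "\<dots> \<le> (\<integral>\<^sup>+x. ennreal (1 / V) * (\<integral>\<^sup>+y. indicator \<Omega> x * (indicator \<Omega> y * ennreal (\<bar>f0 x - f0 y\<bar> powr p)) \<partial>lborel) \<partial>lborel)"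
    proof (rule nn_integral_mono)
      fix x
      show "indicator \<Omega> x * ennreal (\<bar>f0 x\<bar> powr p) \<le> ennreal (1 / V) * (\<integral>\<^sup>+y. indicator \<Omega> x * (indicator \<Omega> y * ennreal (\<bar>f0 x - f0 y\<bar> powr p)) \<partial>lborel)"
        using ptn[of x] by (cases "x \<in> \<Omega>") auto
    qed
    also have "\<dots> = (\<integral>\<^sup>+x. ennreal (1 / V) * (\<integral>\<^sup>+h. ?\<Phi> x h \<partial>lborel) \<partial>lborel)"
    proof (rule nn_integral_cong, rule arg_cong2[where f = "(*)", OF refl])
      fix x
      have "(\<lambda>y. indicator \<Omega> x * (indicator \<Omega> y * ennreal (\<bar>f0 x - f0 y\<bar> powr p))) \<in> borel_measurable borel" by measurable
      from lborel_nn_integral_translate[OF this, of x]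
      show "(\<integral>\<^sup>+y. indicator \<Omega> x * (indicator \<Omega> y * ennreal (\<bar>f0 x - f0 y\<bar> powr p)) \<partial>lborel) = (\<integral>\<^sup>+h. ?\<Phi> x h \<partial>lborel)"
        by simp
    qed
    also have "\<dots> = ennreal (1 / V) * (\<integral>\<^sup>+x. (\<integral>\<^sup>+h. ?\<Phi> x h \<partial>lborel) \<partial>lborel)"
      by (rule nn_integral_cmult) measurable
    \<comment> \<open>Tonelli's theorem moves \<open>h\<close> outside, so that the inner integral
      over \<open>x\<close> is the one in the translation estimate.\<close>
    also have "(\<integral>\<^sup>+x. (\<integral>\<^sup>+h. ?\<Phi> x h \<partial>lborel) \<partial>lborel) = (\<integral>\<^sup>+h. (\<integral>\<^sup>+x. ?\<Phi> x h \<partial>lborel) \<partial>lborel)"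
      by (rule lborel_pair.Fubini'[symmetric]) measurable
    also have "\<dots> \<le> (\<integral>\<^sup>+h. ennreal (Q * A) * indicator (cball 0 (2 * R)) (h :: real ^ 'n) \<partial>lborel)"
    proof (rule nn_integral_mono)
      fix h :: "real ^ 'n"
      have "(\<integral>\<^sup>+x. ?\<Phi> x h \<partial>lborel) = (\<integral>\<^sup>+x. indicator {x. x \<in> \<Omega> \<and> x + h \<in> \<Omega>} x * ennreal (\<bar>f0 (x + h) - f0 x\<bar> powr p) \<partial>lborel)"
        by (intro nn_integral_cong) (auto simp: indicator_def add.commute abs_minus_commute)
      also have "\<dots> \<le> ennreal (Q * A) * indicator (cball 0 (2 * R)) h"
      proof (cases "norm h \<le> 2 * R")
        case True
        have "(\<integral>\<^sup>+x. indicator {x. x \<in> \<Omega> \<and> x + h \<in> \<Omega>} x * ennreal (\<bar>f0 (x + h) - f0 x\<bar> powr p) \<partial>lborel)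
          \<le> ennreal (real CARD('n) powr p * norm h powr p * A)"
          unfolding A_def by (rule translation_estimate[OF op conv p G fi Gi Gp f0])
        also have "\<dots> \<le> ennreal (Q * A)"
          unfolding Q_def using A0 True p by (intro ennreal_leI mult_right_mono mult_left_mono powr_mono2) auto
        finally show ?thesis using True by simp
      next
        case False
        have "{x. x \<in> \<Omega> \<and> x + h \<in> \<Omega>} = {}"
        proof (rule ccontr)
          assume "{x. x \<in> \<Omega> \<and> x + h \<in> \<Omega>} \<noteq> {}"
          then obtain x where "norm x \<le> R" "norm (x + h) \<le> R" using R(2) by blast
          then show False using False norm_triangle_ineq4[of "x + h" x] by simp
        qed
        then show ?thesis by simp
      qed
      finally show "(\<integral>\<^sup>+x. ?\<Phi> x h \<partial>lborel) \<le> ennreal (Q * A) * indicator (cball 0 (2 * R)) h" .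
    qed
    also have "\<dots> = ennreal (Q * A) * emeasure lborel (cball (0 :: real ^ 'n) (2 * R))"
      by (rule nn_integral_cmult_indicator) simp
    also have "\<dots> = ennreal (Q * A) * ennreal W"
      unfolding W_def using emeasure_lborel_cball_finite[of "0 :: real ^ 'n" "2 * R"] by (simp add: emeasure_eq_ennreal_measure top.not_eq_extremum)
    finally have "ennreal (LINT x|lborel. \<bar>f0 x\<bar> powr p) \<le> ennreal (1 / V) * (ennreal (Q * A) * ennreal W)"
      by (simp add: mult_left_mono)
    also have "\<dots> = ennreal (1 / V * (Q * A * W))"
      using V QAW ennreal_mult[OF QAW] ennreal_mult[of "1 / V" "Q * A * W"] by simp
    finally have "(LINT x|lborel. \<bar>f0 x\<bar> powr p) \<le> 1 / V * (Q * A * W)"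
      using V QAW by (subst (asm) ennreal_le_iff) auto
    then show "(LINT x|lebesgue_on \<Omega>. \<bar>f x\<bar> powr p) \<le> 1 / V * (Q * W) * (\<Sum>k\<in>UNIV. LINT x|lebesgue_on \<Omega>. \<bar>G k x\<bar> powr p)"
      unfolding f0p(2) A_def by (simp add: mult_ac)
  qed
qed

text \<open>Translation by a vector as long as the diameter moves the support off the ball.\<close>

lemma poincare_test_function:
  fixes \<phi> :: "real ^ 'n \<Rightarrow> real"
  assumes p: "1 < p" and t: "test_function (ball 0 1) \<phi>"
  shows "(LINT x|lebesgue_on (ball 0 1). \<bar>\<phi> x\<bar> powr p)
    \<le> real CARD('n) powr p * 2 powr p * (\<Sum>k\<in>UNIV. LINT x|lebesgue_on (ball 0 1). \<bar>partial_deriv [k] \<phi> x\<bar> powr p)"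
proof -
  let ?B = "ball (0 :: real ^ 'n) 1"
  have B: "?B \<in> sets lebesgue" by simp
  obtain K where K: "smooth \<phi>" "compact K" "K \<subseteq> ?B" "\<And>x. x \<notin> K \<Longrightarrow> \<phi> x = 0"
    using test_functionE[OF t] by metis
  have Kz: "partial_deriv ks \<phi> x = 0" if "x \<notin> K" for ks x
    by (rule partial_deriv_outside[OF compact_imp_closed[OF K(2)] _ that]) (rule K(4))
  have zero: "partial_deriv ks \<phi> x = 0" if "x \<notin> ?B" for ks x
    using Kz K(3) that by blast
  have c: "continuous_on A (partial_deriv ks \<phi>)" for ks A
    by (intro smooth_continuous_on smooth_partial_deriv K(1))
  have i: "integrable lebesgue (partial_deriv ks \<phi>)" for ks
    by (rule integrable_continuous_compact_support[OF c K(2) Kz])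
  have cp: "continuous_on UNIV (\<lambda>x. \<bar>partial_deriv ks \<phi> x\<bar> powr p)" for ks
    using p by (intro continuous_on_powr' continuous_on_rabs c continuous_on_const) auto
  have ip: "integrable lebesgue (\<lambda>x. \<bar>partial_deriv ks \<phi> x\<bar> powr p)" for ks
    by (rule integrable_continuous_compact_support[OF cp K(2)]) (simp add: Kz)
  have b[measurable]: "\<phi> \<in> borel_measurable borel"
    using c[of UNIV "[]"] by (auto intro: borel_measurable_continuous_onI)
  have restrict: "(LINT x|lebesgue. \<bar>partial_deriv ks \<phi> x\<bar> powr p) = (LINT x|lebesgue_on ?B. \<bar>partial_deriv ks \<phi> x\<bar> powr p)" for ks
  proof -
    have "(\<lambda>x. if x \<in> ?B then \<bar>partial_deriv ks \<phi> x\<bar> powr p else 0) = (\<lambda>x. \<bar>partial_deriv ks \<phi> x\<bar> powr p)"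
      using zero by auto
    then show ?thesis using Lebesgue_Measure.integral_restrict_UNIV[OF B, of "\<lambda>x. \<bar>partial_deriv ks \<phi> x\<bar> powr p"] by simp
  qed
  obtain i0 :: 'n where True by blast
  define h where "h = 2 *\<^sub>R axis i0 (1 :: real)"
  have h: "norm h = 2" by (simp add: h_def)
  \<comment> \<open>The whole space serves as domain here. Then no restriction to points whose
    translate stays inside the ball appears.\<close>
  have est: "(\<integral>\<^sup>+x. indicator {x. x \<in> UNIV \<and> x + h \<in> UNIV} x * ennreal (\<bar>\<phi> (x + h) - \<phi> x\<bar> powr p) \<partial>lborel)
      \<le> ennreal (real CARD('n) powr p * norm h powr p * (\<Sum>k\<in>UNIV. LINT x|lebesgue_on UNIV. \<bar>partial_deriv [k] \<phi> x\<bar> powr p))"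
  proof (rule translation_estimate[OF open_UNIV convex_UNIV p])
    show "weak_deriv UNIV [k] \<phi> (partial_deriv [k] \<phi>)" for k
      by (rule weak_deriv_test(2)[OF open_UNIV K(1)])
    show "integrable (lebesgue_on UNIV) \<phi>" using i[of "[]"] by (simp add: lebesgue_on_UNIV_eq)
    show "integrable (lebesgue_on UNIV) (partial_deriv [k] \<phi>)" for k using i by (simp add: lebesgue_on_UNIV_eq)
    show "p_integrable (lebesgue_on UNIV) p (partial_deriv [k] \<phi>)" for k
      using i[of "[k]"] ip[of "[k]"] by (auto simp: p_integrable_def lebesgue_on_UNIV_eq)
    show "borel_version UNIV \<phi> \<phi>" by (simp add: borel_version_def)
  qed
  have "ennreal (LINT x|lebesgue_on ?B. \<bar>\<phi> x\<bar> powr p) = ennreal (LINT x|lebesgue. \<bar>\<phi> x\<bar> powr p)"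
    using restrict[of "[]"] by simp
  also have "\<dots> = (\<integral>\<^sup>+x. ennreal (\<bar>\<phi> x\<bar> powr p) \<partial>lebesgue)"
    using ip[of "[]"] by (intro nn_integral_eq_integral[symmetric]) auto
  also have "\<dots> = (\<integral>\<^sup>+x. ennreal (\<bar>\<phi> x\<bar> powr p) \<partial>lborel)"
    by (intro nn_integral_completion)
  also have "\<dots> \<le> (\<integral>\<^sup>+x. indicator {x. x \<in> UNIV \<and> x + h \<in> UNIV} x * ennreal (\<bar>\<phi> (x + h) - \<phi> x\<bar> powr p) \<partial>lborel)"
  proof (rule nn_integral_mono)
    fix x
    show "ennreal (\<bar>\<phi> x\<bar> powr p) \<le> indicator {x. x \<in> UNIV \<and> x + h \<in> UNIV} x * ennreal (\<bar>\<phi> (x + h) - \<phi> x\<bar> powr p)"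
    proof (cases "x \<in> ?B")
      case True
      then have "x + h \<notin> ?B" using norm_triangle_ineq4[of "x + h" x] h by auto
      then have "\<phi> (x + h) = 0" using zero[of _ "[]"] by simp
      then show ?thesis by simp
    next
      case False
      then show ?thesis using zero[of _ "[]"] by simp
    qed
  qed
  also note est
  finally have "(LINT x|lebesgue_on ?B. \<bar>\<phi> x\<bar> powr p)
    \<le> real CARD('n) powr p * 2 powr p * (\<Sum>k\<in>UNIV. LINT x|lebesgue_on UNIV. \<bar>partial_deriv [k] \<phi> x\<bar> powr p)"
    unfolding h by (subst (asm) ennreal_le_iff) (auto intro!: mult_nonneg_nonneg sum_nonneg Bochner_Integration.integral_nonneg)
  then show ?thesis by (simp add: lebesgue_on_UNIV_eq restrict)
qed

section \<open>The weak Hessian of a convex function\<close>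

text \<open>Taylor's formula of order two at 0 for the even function of \<open>s\<close> given by
  \<phi>(x + s \<xi>) + \<phi>(x - s \<xi>) - 2 \<phi>(x): its value and its first derivative vanish
  at 0.\<close>

lemma second_difference:
  fixes \<phi> :: "real ^ 'n \<Rightarrow> real"
  assumes s: "smooth \<phi>" and h: "0 < h"
  obtains t where "0 < t" "t < h"
    "\<phi> (x + h *\<^sub>R \<xi>) + \<phi> (x - h *\<^sub>R \<xi>) - 2 * \<phi> x
      = ((\<Sum>i\<in>UNIV. \<Sum>j\<in>UNIV. \<xi> $ i * \<xi> $ j * partial_deriv [i, j] \<phi> (x + t *\<^sub>R \<xi>))
        + (\<Sum>i\<in>UNIV. \<Sum>j\<in>UNIV. \<xi> $ i * \<xi> $ j * partial_deriv [i, j] \<phi> (x - t *\<^sub>R \<xi>))) / 2 * h\<^sup>2"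
proof -
  define D1 where "D1 y = (\<Sum>j\<in>UNIV. \<xi> $ j * partial_deriv [j] \<phi> y)" for y
  define D2 where "D2 y = (\<Sum>i\<in>UNIV. \<Sum>j\<in>UNIV. \<xi> $ i * \<xi> $ j * partial_deriv [i, j] \<phi> y)" for y
  have d1: "((\<lambda>s. \<phi> (x + s *\<^sub>R \<xi>)) has_real_derivative D1 (x + s *\<^sub>R \<xi>)) (at s)" for s
    unfolding D1_def by (rule has_real_derivative_line[OF smooth_differentiable[OF s]])
  have d2: "((\<lambda>s. D1 (x + s *\<^sub>R \<xi>)) has_real_derivative D2 (x + s *\<^sub>R \<xi>)) (at s)" for s
  proof -
    have "((\<lambda>s. \<Sum>j\<in>UNIV. \<xi> $ j * partial_deriv [j] \<phi> (x + s *\<^sub>R \<xi>)) has_real_derivative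
       (\<Sum>j\<in>UNIV. \<xi> $ j * (\<Sum>i\<in>UNIV. \<xi> $ i * partial_deriv [i] (partial_deriv [j] \<phi>) (x + s *\<^sub>R \<xi>)))) (at s)"
      by (intro DERIV_sum DERIV_cmult has_real_derivative_line smooth_differentiable smooth_partial_deriv s)
    moreover have "(\<Sum>j\<in>UNIV. \<xi> $ j * (\<Sum>i\<in>UNIV. \<xi> $ i * partial_deriv [i] (partial_deriv [j] \<phi>) (x + s *\<^sub>R \<xi>))) = D2 (x + s *\<^sub>R \<xi>)"
      unfolding D2_def partial_deriv_Cons[of _ "[_]"]
      by (subst sum.swap) (simp add: sum_distrib_left mult_ac)
    ultimately show ?thesis by (simp add: D1_def)
  qed
  have neg: "((\<lambda>s. c (- s)) has_real_derivative - c') (at s)" if "(c has_real_derivative c') (at (- s))" for c c' s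
    using DERIV_chain2[OF that DERIV_minus[OF DERIV_ident]] by simp
  \<comment> \<open>The derivatives of that even function in the indexed form expected by
    \<open>Maclaurin\<close>; indices beyond 2 merely repeat the second derivative, as only orders 0
    to 2 are consulted.\<close>
  define diff where "diff m s = (if m = 0 then \<phi> (x + s *\<^sub>R \<xi>) + \<phi> (x + (- s) *\<^sub>R \<xi>) - 2 * \<phi> x
     else if m = 1 then D1 (x + s *\<^sub>R \<xi>) - D1 (x + (- s) *\<^sub>R \<xi>)
     else D2 (x + s *\<^sub>R \<xi>) + D2 (x + (- s) *\<^sub>R \<xi>))" for m :: nat and s
  have "DERIV (diff m) s :> diff (Suc m) s" if "m < 2" for m s
  proof (cases "m = 0")
    case True
    have "((\<lambda>s. \<phi> (x + s *\<^sub>R \<xi>) + \<phi> (x + (- s) *\<^sub>R \<xi>) - 2 * \<phi> x) has_real_derivative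
       D1 (x + s *\<^sub>R \<xi>) + - D1 (x + (- s) *\<^sub>R \<xi>) - 0) (at s)"
      by (intro DERIV_diff DERIV_add DERIV_const d1 neg)
    then show ?thesis using True by (simp add: diff_def[abs_def])
  next
    case False
    then have m: "m = 1" using that by simp
    have "((\<lambda>s. D1 (x + s *\<^sub>R \<xi>) - D1 (x + (- s) *\<^sub>R \<xi>)) has_real_derivative
       D2 (x + s *\<^sub>R \<xi>) - - D2 (x + (- s) *\<^sub>R \<xi>)) (at s)"
      by (intro DERIV_diff d2 neg)
    then show ?thesis using m by (simp add: diff_def[abs_def])
  qed
  then have "\<exists>t. 0 < t \<and> t < h \<and> diff 0 h = (\<Sum>m<2. diff m 0 / fact m * h ^ m) + diff 2 t / fact 2 * h ^ 2"
    by (intro Maclaurin h) auto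
  then obtain t where t: "0 < t" "t < h"
    and e: "diff 0 h = (\<Sum>m<2. diff m 0 / fact m * h ^ m) + diff 2 t / fact 2 * h ^ 2" by blast
  have "(\<Sum>m<2. diff m 0 / fact m * h ^ m) = 0" by (simp add: numeral_2_eq_2 diff_def)
  then have "\<phi> (x + h *\<^sub>R \<xi>) + \<phi> (x - h *\<^sub>R \<xi>) - 2 * \<phi> x = (D2 (x + t *\<^sub>R \<xi>) + D2 (x - t *\<^sub>R \<xi>)) / 2 * h\<^sup>2"
    using e by (simp add: diff_def)
  with t show ?thesis using that unfolding D2_def by blast
qed

lemma convex_second_difference_nonneg:
  fixes u :: "'a::real_vector \<Rightarrow> real"
  assumes "convex_on \<Omega> u" "x + v \<in> \<Omega>" "x - v \<in> \<Omega>"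
  shows "0 \<le> u (x + v) + u (x - v) - 2 * u x"
proof -
  have "u ((1 - 1 / 2) *\<^sub>R (x + v) + (1 / 2) *\<^sub>R (x - v)) \<le> (1 - 1 / 2) * u (x + v) + (1 / 2) * u (x - v)"
    using assms by (intro convex_onD) auto
  moreover have "(1 - 1 / 2) *\<^sub>R (x + v) + (1 / 2) *\<^sub>R (x - v) = x"
    by (simp add: algebra_simps flip: scaleR_add_left)
  ultimately show ?thesis by simp
qed

text \<open>Both derivatives are moved onto the test function and replaced there by symmetric second
  difference quotients. Translation moves the quotients back to \<open>u\<close>, where convexity
  gives the sign, and dominated convergence recovers the derivative.\<close>

lemma convex_weak_second_deriv_nonneg:
  fixes u :: "real ^ 'n \<Rightarrow> real"
  assumes op: "open \<Omega>" and cv: "convex_on \<Omega> u" and H: "\<And>i j. weak_deriv \<Omega> [i, j] u (H i j)"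
  shows "AE x in lebesgue_on \<Omega>. 0 \<le> (\<Sum>i\<in>UNIV. \<Sum>j\<in>UNIV. \<xi> $ i * \<xi> $ j * H i j x)"
proof (rule AE_nonneg_if_test_nonneg[OF op])
  have liu: "locally_integrable \<Omega> u" and liH: "locally_integrable \<Omega> (H i j)" for i j
    using H[of i j] by (auto simp: weak_deriv_def)
  have liS: "locally_integrable \<Omega> (\<lambda>x. \<Sum>i\<in>A. f i x)" if "\<And>i. locally_integrable \<Omega> (f i)" "finite A"
    for f :: "'n \<Rightarrow> real ^ 'n \<Rightarrow> real" and A
    using that(2)
  proof (induction A rule: finite_induct)
    case empty
    show ?case by (simp add: continuous_imp_locally_integrable)
  next
    case (insert a A)
    from locally_integrable_lincomb[OF that(1)[of a] insert.IH, of 1 1] insert(1,2) show ?case by simp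
  qed
  have liC: "locally_integrable \<Omega> (\<lambda>x. c * f x)" if "locally_integrable \<Omega> f" for c and f :: "real ^ 'n \<Rightarrow> real"
    using locally_integrable_lincomb[OF that that, of c 0] by simp
  show "locally_integrable \<Omega> (\<lambda>x. \<Sum>i\<in>UNIV. \<Sum>j\<in>UNIV. \<xi> $ i * \<xi> $ j * H i j x)"
    by (intro liS liC liH) auto
  fix \<phi> assume t: "test_function \<Omega> \<phi>" and nn: "\<And>x. 0 \<le> \<phi> x"
  obtain K where K: "smooth \<phi>" "compact K" "K \<subseteq> \<Omega>" "\<And>x. x \<notin> K \<Longrightarrow> \<phi> x = 0"
    using test_functionE[OF t] by metis
  define D2 where "D2 y = (\<Sum>i\<in>UNIV. \<Sum>j\<in>UNIV. \<xi> $ i * \<xi> $ j * partial_deriv [i, j] \<phi> y)" for y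
  have iu: "integrable (lebesgue_on \<Omega>) (\<lambda>x. u x * partial_deriv [i, j] \<phi> x)" for i j
    by (rule integrable_on_test[OF op liu test_function_partial_deriv[OF t]])
  have iH: "integrable (lebesgue_on \<Omega>) (\<lambda>x. H i j x * \<phi> x)" for i j
    by (rule integrable_on_test[OF op liH t])
  have cD: "continuous_on UNIV D2"
    unfolding D2_def by (intro continuous_intros smooth_continuous_on smooth_partial_deriv K(1))
  have D2z: "D2 y = 0" if "y \<notin> K" for y
  proof -
    have "partial_deriv [i, j] \<phi> y = 0" for i j
      by (rule partial_deriv_outside[OF compact_imp_closed[OF K(2)] _ that]) (rule K(4))
    then show ?thesis by (simp add: D2_def)
  qed
  obtain C where C: "0 \<le> C" "\<And>x. \<bar>D2 x\<bar> \<le> C"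
    using continuous_compact_support_bounded[OF cD K(2) D2z] by blast
  have "(LINT x|lebesgue_on \<Omega>. (\<Sum>i\<in>UNIV. \<Sum>j\<in>UNIV. \<xi> $ i * \<xi> $ j * H i j x) * \<phi> x)
      = (LINT x|lebesgue_on \<Omega>. (\<Sum>i\<in>UNIV. \<Sum>j\<in>UNIV. \<xi> $ i * \<xi> $ j * (H i j x * \<phi> x)))"
    by (simp add: sum_distrib_right mult.assoc)
  also have "\<dots> = (\<Sum>i\<in>UNIV. \<Sum>j\<in>UNIV. \<xi> $ i * \<xi> $ j * (LINT x|lebesgue_on \<Omega>. H i j x * \<phi> x))"
    using iH by simp
  also have "\<dots> = (\<Sum>i\<in>UNIV. \<Sum>j\<in>UNIV. \<xi> $ i * \<xi> $ j * (LINT x|lebesgue_on \<Omega>. u x * partial_deriv [i, j] \<phi> x))"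
    using H t unfolding weak_deriv_def by simp
  also have "\<dots> = (LINT x|lebesgue_on \<Omega>. (\<Sum>i\<in>UNIV. \<Sum>j\<in>UNIV. \<xi> $ i * \<xi> $ j * (u x * partial_deriv [i, j] \<phi> x)))"
    using iu by simp
  also have "\<dots> = (LINT x|lebesgue_on \<Omega>. u x * D2 x)"
    by (simp add: D2_def sum_distrib_left mult_ac)
  also have "\<dots> = (LINT x|lebesgue. u x * D2 x)"
  proof -
    have "(\<lambda>x. if x \<in> \<Omega> then u x * D2 x else 0) = (\<lambda>x. u x * D2 x)"
      using D2z K(3) by (metis mult_zero_right subset_eq)
    moreover have "\<Omega> \<in> sets lebesgue" using op by auto
    ultimately show ?thesis
      using Lebesgue_Measure.integral_restrict_UNIV[of \<Omega> "\<lambda>x. u x * D2 x"] by simp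
  qed
  finally have eq: "(LINT x|lebesgue_on \<Omega>. (\<Sum>i\<in>UNIV. \<Sum>j\<in>UNIV. \<xi> $ i * \<xi> $ j * H i j x) * \<phi> x) = (LINT x|lebesgue. u x * D2 x)" .
  obtain \<delta> where \<delta>: "0 < \<delta>" "(\<Union>x\<in>K. cball x \<delta>) \<subseteq> \<Omega>"
    using compact_subset_open_imp_cball_epsilon_subset[OF K(2) op K(3)] .
  let ?L = "\<Union>x\<in>K. cball x \<delta>"
  have L: "compact ?L" by (rule compact_thickening[OF K(2)])
  \<comment> \<open>The scaling keeps every shift \<open>h n *\<^sub>R \<xi>\<close> within
    \<open>\<delta>\<close>; the 1 added to the norm covers the zero direction.\<close>
  define h where "h n = \<delta> / (norm \<xi> + 1) * inverse (real (Suc n))" for n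
  have h: "0 < h n" "norm (h n *\<^sub>R \<xi>) \<le> \<delta>" for n
  proof -
    show "0 < h n" unfolding h_def using \<delta>(1) by (intro mult_pos_pos divide_pos_pos add_nonneg_pos) auto
    have "inverse (real (Suc n)) \<le> 1" by (simp add: inverse_le_1_iff)
    then have "h n \<le> \<delta> / (norm \<xi> + 1)"
      unfolding h_def using \<delta>(1) by (intro mult_left_le) auto
    then have "h n * norm \<xi> \<le> \<delta> / (norm \<xi> + 1) * norm \<xi>" by (rule mult_right_mono) simp
    also have "\<dots> \<le> \<delta> / (norm \<xi> + 1) * (norm \<xi> + 1)" using \<delta>(1) by (intro mult_left_mono) auto
    also have "\<dots> = \<delta>" by (simp add: add_nonneg_eq_0_iff)
    finally show "norm (h n *\<^sub>R \<xi>) \<le> \<delta>" using \<open>0 < h n\<close> by simp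
  qed
  have h0: "h \<longlonglongrightarrow> 0"
    unfolding h_def using tendsto_mult_right_zero[OF LIMSEQ_inverse_real_of_nat] .
  have inL: "x + v \<in> ?L" "x - v \<in> ?L" if "x \<in> K" "norm v \<le> \<delta>" for x v
    using that by (auto simp: dist_norm intro!: bexI[of _ x])
  have inL': "x \<in> ?L" if "x + v \<in> K" "norm v \<le> \<delta>" for x v
    using inL(2)[OF that] by simp
  define q where "q n x = (\<phi> (x + h n *\<^sub>R \<xi>) + \<phi> (x - h n *\<^sub>R \<xi>) - 2 * \<phi> x) / (h n)\<^sup>2" for n x
  have qt: "\<exists>t. 0 < t \<and> t < h n \<and> q n x = (D2 (x + t *\<^sub>R \<xi>) + D2 (x - t *\<^sub>R \<xi>)) / 2" for n x
  proof -
    obtain t where t: "0 < t" "t < h n"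
      "\<phi> (x + h n *\<^sub>R \<xi>) + \<phi> (x - h n *\<^sub>R \<xi>) - 2 * \<phi> x = (D2 (x + t *\<^sub>R \<xi>) + D2 (x - t *\<^sub>R \<xi>)) / 2 * (h n)\<^sup>2"
      using second_difference[OF K(1) h(1)[of n], of x \<xi>] unfolding D2_def[symmetric] by blast
    then have "q n x = (D2 (x + t *\<^sub>R \<xi>) + D2 (x - t *\<^sub>R \<xi>)) / 2"
      unfolding q_def t(3) using h(1)[of n] by simp
    with t show ?thesis by blast
  qed
  have qb: "\<bar>q n x\<bar> \<le> C" for n x
  proof -
    obtain t where t: "q n x = (D2 (x + t *\<^sub>R \<xi>) + D2 (x - t *\<^sub>R \<xi>)) / 2" using qt by blast
    have "\<bar>D2 (x + t *\<^sub>R \<xi>) + D2 (x - t *\<^sub>R \<xi>)\<bar> \<le> C + C"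
      by (rule order_trans[OF abs_triangle_ineq]) (intro add_mono C(2))
    then show ?thesis unfolding t by simp
  qed
  have qz: "q n x = 0" if "x \<notin> ?L" for n x
  proof -
    have "x \<notin> K" using that \<delta>(1) by force
    moreover have "x + h n *\<^sub>R \<xi> \<notin> K" using inL'[of x "h n *\<^sub>R \<xi>"] h(2) that by blast
    moreover have "x - h n *\<^sub>R \<xi> \<notin> K" using inL'[of x "- (h n *\<^sub>R \<xi>)"] h(2) that by auto
    ultimately show ?thesis using K(4) by (simp add: q_def)
  qed
  have qlim: "(\<lambda>n. q n x) \<longlonglongrightarrow> D2 x" for x
  proof -
    obtain t where t: "\<And>n. 0 < t n" "\<And>n. t n < h n" "\<And>n. q n x = (D2 (x + t n *\<^sub>R \<xi>) + D2 (x - t n *\<^sub>R \<xi>)) / 2"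
      using qt[of _ x] by metis
    have t0: "t \<longlonglongrightarrow> 0"
      by (rule tendsto_sandwich[OF _ _ tendsto_const h0]) (use t(1,2) in \<open>auto intro!: always_eventually less_imp_le\<close>)
    have c: "isCont D2 x" using cD continuous_on_eq_continuous_at[OF open_UNIV] by blast
    have "(\<lambda>n. x + t n *\<^sub>R \<xi>) \<longlonglongrightarrow> x + 0 *\<^sub>R \<xi>" "(\<lambda>n. x - t n *\<^sub>R \<xi>) \<longlonglongrightarrow> x - 0 *\<^sub>R \<xi>"
      by (intro tendsto_add tendsto_diff tendsto_scaleR tendsto_const t0)+
    then have "(\<lambda>n. D2 (x + t n *\<^sub>R \<xi>)) \<longlonglongrightarrow> D2 x" "(\<lambda>n. D2 (x - t n *\<^sub>R \<xi>)) \<longlonglongrightarrow> D2 x"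
      using isCont_tendsto_compose[OF c] by auto
    then have "(\<lambda>n. (D2 (x + t n *\<^sub>R \<xi>) + D2 (x - t n *\<^sub>R \<xi>)) / 2) \<longlonglongrightarrow> (D2 x + D2 x) / 2"
      by (intro tendsto_divide tendsto_add tendsto_const) auto
    then show ?thesis unfolding t(3) by simp
  qed
  have tt: "test_function \<Omega> (\<lambda>x. \<phi> (x + v))" if "norm v \<le> \<delta>" for v
    by (rule test_function_translate[OF t _ L \<delta>(2)]) (use inL'[OF _ that] K(4) in blast)
  have iq: "0 \<le> (LINT x|lebesgue. u x * q n x) \<and> integrable lebesgue (\<lambda>x. u x * q n x)" for n
  proof -
    let ?v = "h n *\<^sub>R \<xi>"
    have v: "norm ?v \<le> \<delta>" "norm (- ?v) \<le> \<delta>" using h(2)[of n] by auto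
    have i: "integrable lebesgue (\<lambda>x. u x * \<phi> (x + ?v))" "integrable lebesgue (\<lambda>x. u x * \<phi> (x + - ?v))"
      "integrable lebesgue (\<lambda>x. u x * \<phi> x)"
      using locally_integrable_test[OF liu tt[OF v(1)]] locally_integrable_test[OF liu tt[OF v(2)]]
        locally_integrable_test[OF liu t] by auto
    have tr: "(LINT x|lebesgue. u x * \<phi> (x + ?v)) = (LINT x|lebesgue. u (x - ?v) * \<phi> x)"
      "(LINT x|lebesgue. u x * \<phi> (x + - ?v)) = (LINT x|lebesgue. u (x + ?v) * \<phi> x)"
      using integral_translate[OF borel_measurable_integrable[OF i(1)], of "- ?v"]
        integral_translate[OF borel_measurable_integrable[OF i(2)], of "?v"] by simp_all
    have i': "integrable lebesgue (\<lambda>x. u (x - ?v) * \<phi> x)" "integrable lebesgue (\<lambda>x. u (x + ?v) * \<phi> x)"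
      using integrable_translate[OF i(1), of "- ?v"] integrable_translate[OF i(2), of "?v"] by simp_all
    have qe: "u x * q n x = (u x * \<phi> (x + ?v) + u x * \<phi> (x + - ?v) - 2 * (u x * \<phi> x)) / (h n)\<^sup>2" for x
      by (simp add: q_def algebra_simps)
    have "(LINT x|lebesgue. u x * q n x) = ((LINT x|lebesgue. u (x - ?v) * \<phi> x) + (LINT x|lebesgue. u (x + ?v) * \<phi> x) - 2 * (LINT x|lebesgue. u x * \<phi> x)) / (h n)\<^sup>2"
      unfolding qe using i tr by simp
    also have "\<dots> = (LINT x|lebesgue. (u (x - ?v) * \<phi> x + u (x + ?v) * \<phi> x - 2 * (u x * \<phi> x))) / (h n)\<^sup>2"
      using i i' by simp
    finally have e: "(LINT x|lebesgue. u x * q n x) = (LINT x|lebesgue. (u (x - ?v) * \<phi> x + u (x + ?v) * \<phi> x - 2 * (u x * \<phi> x))) / (h n)\<^sup>2" .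
    \<comment> \<open>After the change of variables the second difference falls on \<open>u\<close>.
      Only points of \<open>K\<close> matter, and there both shifted points lie in the domain, so
      convexity applies.\<close>
    have "0 \<le> (LINT x|lebesgue. (u (x - ?v) * \<phi> x + u (x + ?v) * \<phi> x - 2 * (u x * \<phi> x)))"
    proof (rule Bochner_Integration.integral_nonneg)
      fix x
      show "0 \<le> u (x - ?v) * \<phi> x + u (x + ?v) * \<phi> x - 2 * (u x * \<phi> x)"
      proof (cases "x \<in> K")
        case True
        then have "x + ?v \<in> \<Omega>" "x - ?v \<in> \<Omega>" using inL[OF True v(1)] \<delta>(2) by blast+
        from mult_nonneg_nonneg[OF convex_second_difference_nonneg[OF cv this] nn[of x]]
        show ?thesis by (simp add: algebra_simps)
      next
        case False
        then show ?thesis using K(4) by simp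
      qed
    qed
    moreover have "integrable lebesgue (\<lambda>x. u x * q n x)" unfolding qe using i by simp
    ultimately show ?thesis using e by simp
  qed
  have iL: "integrable lebesgue (\<lambda>x. u x * indicator ?L x)"
    using liu L \<delta>(2) unfolding locally_integrable_def set_integrable_def by (simp add: mult.commute)
  have "(\<lambda>n. LINT x|lebesgue. u x * q n x) \<longlonglongrightarrow> (LINT x|lebesgue. u x * D2 x)"
  proof (rule integral_dominated_convergence[where w = "\<lambda>x. norm (C * (u x * indicator ?L x))"])
    show "(\<lambda>x. u x * D2 x) \<in> borel_measurable lebesgue"
      using locally_integrable_mult[OF liu K(2,3) cD D2z] by (rule borel_measurable_integrable)
    show "(\<lambda>x. u x * q n x) \<in> borel_measurable lebesgue" for n
      using iq[of n] by (intro borel_measurable_integrable) blast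
    show "integrable lebesgue (\<lambda>x. norm (C * (u x * indicator ?L x)))"
      using iL by (intro integrable_norm integrable_mult_right)
    show "AE x in lebesgue. (\<lambda>n. u x * q n x) \<longlonglongrightarrow> u x * D2 x"
      by (intro AE_I2 tendsto_mult tendsto_const qlim)
    show "AE x in lebesgue. norm (u x * q n x) \<le> norm (C * (u x * indicator ?L x))" for n
    proof (rule AE_I2)
      fix x
      show "norm (u x * q n x) \<le> norm (C * (u x * indicator ?L x))"
      proof (cases "x \<in> ?L")
        case True
        have "\<bar>u x\<bar> * \<bar>q n x\<bar> \<le> \<bar>u x\<bar> * C" using qb by (intro mult_left_mono) auto
        then show ?thesis using True C(1) by (simp only: indicator_simps) (simp add: abs_mult mult.commute)
      next
        case False
        then show ?thesis using qz by simp
      qed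
    qed
  qed
  then have "0 \<le> (LINT x|lebesgue. u x * D2 x)"
    using iq by (meson LIMSEQ_le_const)
  then show "0 \<le> (LINT x|lebesgue_on \<Omega>. (\<Sum>i\<in>UNIV. \<Sum>j\<in>UNIV. \<xi> $ i * \<xi> $ j * H i j x) * \<phi> x)"
    unfolding eq .
qed

text \<open>For each direction the quadratic form is nonnegative off a null set that depends on the
  direction. A countable dense set of directions gives one null set, and continuity of the form in
  the direction covers the rest.\<close>

lemma convex_weak_hessian:
  fixes u :: "real ^ 'n \<Rightarrow> real"
  assumes op: "open \<Omega>" and cv: "convex_on \<Omega> u"
    and H: "\<And>i j. weak_deriv \<Omega> [i, j] u (wderiv \<Omega> [i, j] u)"
  shows "AE x in lebesgue_on \<Omega>. weak_hessian \<Omega> u x \<in> sym_matrices \<and> nonneg_definite (weak_hessian \<Omega> u x)"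
proof -
  have "AE x in lebesgue_on \<Omega>. wderiv \<Omega> [i, j] u x = wderiv \<Omega> [j, i] u x" for i j
    by (rule weak_deriv_unique[OF op H weak_deriv_commute[OF H]])
  then have "AE x in lebesgue_on \<Omega>. \<forall>i\<in>UNIV. \<forall>j\<in>UNIV. wderiv \<Omega> [i, j] u x = wderiv \<Omega> [j, i] u x"
    by (intro AE_finite_allI finite_class.finite_UNIV)
  moreover obtain D :: "(real ^ 'n) set" where D: "countable D" "\<And>X. open X \<Longrightarrow> X \<noteq> {} \<Longrightarrow> \<exists>d\<in>D. d \<in> X"
    using countable_dense_exists by metis
  have "AE x in lebesgue_on \<Omega>. \<forall>\<xi>\<in>D. 0 \<le> (\<Sum>i\<in>UNIV. \<Sum>j\<in>UNIV. \<xi> $ i * \<xi> $ j * wderiv \<Omega> [i, j] u x)"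
    using convex_weak_second_deriv_nonneg[OF op cv H] by (simp add: AE_ball_countable[OF D(1)])
  ultimately show ?thesis
  proof eventually_elim
    case (elim x)
    let ?S = "{\<xi> :: real ^ 'n. 0 \<le> (\<Sum>i\<in>UNIV. \<Sum>j\<in>UNIV. \<xi> $ i * \<xi> $ j * wderiv \<Omega> [i, j] u x)}"
    have op: "open (- ?S)" by (intro open_Compl closed_Collect_le continuous_intros)
    have "D \<subseteq> ?S" using elim(2) by blast
    with D(2)[OF op] have "- ?S = {}" by blast
    then have "\<xi> \<in> ?S" for \<xi> by blast
    then show ?case
      using elim(1) by (simp add: sym_matrices_iff weak_hessian_def nonneg_definite_def quadratic_form_eq)
  qed
qed

section \<open>Sobolev spaces\<close>

text \<open>Working with p-th powers instead of norms avoids roots. The price is a factor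
  \<open>2 powr p\<close> in the triangle inequality, harmless for boundedness and for convergence
  to zero.\<close>

definition deriv_energy :: "(real ^ 'n) set \<Rightarrow> real \<Rightarrow> 'n list \<Rightarrow> (real ^ 'n \<Rightarrow> real) \<Rightarrow> real" where
  "deriv_energy \<Omega> p ks u = (LINT x|lebesgue_on \<Omega>. \<bar>wderiv \<Omega> ks u x\<bar> powr p)"

definition sobolev_energy :: "(real ^ 'n) set \<Rightarrow> nat \<Rightarrow> real \<Rightarrow> (real ^ 'n \<Rightarrow> real) \<Rightarrow> real" where
  "sobolev_energy \<Omega> m p u = (\<Sum>ks | length ks \<le> m. deriv_energy \<Omega> p ks u)"

lemma deriv_energy_nonneg: "0 \<le> deriv_energy \<Omega> p ks u"
  unfolding deriv_energy_def by (intro Bochner_Integration.integral_nonneg) auto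

lemma sobolev_energy_nonneg: "0 \<le> sobolev_energy \<Omega> m p u"
  unfolding sobolev_energy_def by (intro sum_nonneg deriv_energy_nonneg)

lemma finite_multi_indices: "finite {ks :: 'n::finite list. length ks \<le> m}"
  using finite_lists_length_le[of "UNIV :: 'n set" m] by simp

lemma deriv_energy_le_sobolev_energy:
  assumes "length ks \<le> m" shows "deriv_energy \<Omega> p ks u \<le> sobolev_energy \<Omega> m p u"
  unfolding sobolev_energy_def
  using assms by (intro member_le_sum finite_multi_indices deriv_energy_nonneg) auto

lemma sobolev_norm_energy: "sobolev_norm \<Omega> m p u = sobolev_energy \<Omega> m p u powr (1 / p)"
  by (simp add: sobolev_norm_def sobolev_energy_def deriv_energy_def)

text \<open>The derivative picked by \<open>SOME\<close> need not be the p-integrable witness. The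
  two agree almost everywhere, and measurability of the picked one follows from local
  integrability.\<close>

lemma sobolev_wderiv:
  fixes u :: "real ^ 'n \<Rightarrow> real"
  assumes op: "open \<Omega>" and u: "u \<in> sobolev \<Omega> m p" and ks: "length ks \<le> m"
  shows "weak_deriv \<Omega> ks u (wderiv \<Omega> ks u)" "p_integrable (lebesgue_on \<Omega>) p (wderiv \<Omega> ks u)"
proof -
  obtain v where v: "p_integrable (lebesgue_on \<Omega>) p v" "weak_deriv \<Omega> ks u v"
    using u ks unfolding sobolev_def Lp_space_iff[abs_def] by (auto simp: Lp_space_iff)
  show w: "weak_deriv \<Omega> ks u (wderiv \<Omega> ks u)" by (rule weak_deriv_wderiv[OF v(2)])
  have "wderiv \<Omega> ks u \<in> borel_measurable (lebesgue_on \<Omega>)"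
    using w by (intro locally_integrable_measurable[OF op]) (simp add: weak_deriv_def)
  then show "p_integrable (lebesgue_on \<Omega>) p (wderiv \<Omega> ks u)"
    by (rule p_integrable_cong_AE[OF v(1)])
      (use weak_deriv_unique[OF op v(2) w] in auto)
qed

lemma sobolevI:
  fixes u :: "real ^ 'n \<Rightarrow> real"
  assumes "p_integrable (lebesgue_on \<Omega>) p u"
    and "\<And>ks. length ks \<le> m \<Longrightarrow> weak_deriv \<Omega> ks u (v ks) \<and> p_integrable (lebesgue_on \<Omega>) p (v ks)"
  shows "u \<in> sobolev \<Omega> m p"
proof -
  have "\<exists>w\<in>Lp_space \<Omega> p. weak_deriv \<Omega> ks u w" if "length ks \<le> m" for ks
    using assms(2)[OF that] by (intro bexI[of _ "v ks"]) (simp_all add: Lp_space_iff)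
  then show ?thesis using assms(1) unfolding sobolev_def by (simp add: Lp_space_iff)
qed

lemma sobolev_p_integrable: "u \<in> sobolev \<Omega> m p \<Longrightarrow> p_integrable (lebesgue_on \<Omega>) p u"
  unfolding sobolev_def by (simp add: Lp_space_iff)

lemma sobolev_mono: "u \<in> sobolev \<Omega> m p \<Longrightarrow> k \<le> m \<Longrightarrow> u \<in> sobolev \<Omega> k p"
  unfolding sobolev_def by auto

text \<open>The derivative of order zero is also picked by \<open>SOME\<close>, hence agrees with
  the function only almost everywhere.\<close>

lemma wderiv_Nil:
  fixes u :: "real ^ 'n \<Rightarrow> real"
  assumes op: "open \<Omega>" and u: "u \<in> sobolev \<Omega> m p"
  shows "AE x in lebesgue_on \<Omega>. wderiv \<Omega> [] u x = u x"
proof -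
  have "weak_deriv \<Omega> [] u (wderiv \<Omega> [] u)" using sobolev_wderiv(1)[OF op u] by simp
  then have "locally_integrable \<Omega> u" by (simp add: weak_deriv_def)
  then have "weak_deriv \<Omega> [] u u" by (simp add: weak_deriv_def)
  then show ?thesis by (rule wderiv_AE[OF op])
qed

lemma deriv_energy_eq:
  fixes u :: "real ^ 'n \<Rightarrow> real"
  assumes op: "open \<Omega>" and u: "u \<in> sobolev \<Omega> m p" and ks: "length ks \<le> m"
    and v: "AE x in lebesgue_on \<Omega>. wderiv \<Omega> ks u x = v x" "v \<in> borel_measurable (lebesgue_on \<Omega>)"
  shows "deriv_energy \<Omega> p ks u = (LINT x|lebesgue_on \<Omega>. \<bar>v x\<bar> powr p)"
  unfolding deriv_energy_def
  by (rule p_integral_cong_AE[OF _ v(2,1)])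
    (use sobolev_wderiv(2)[OF op u ks] in \<open>simp add: p_integrable_def\<close>)

lemma sobolev_lincomb:
  fixes u w :: "real ^ 'n \<Rightarrow> real"
  assumes op: "open \<Omega>" and p: "0 \<le> p" and u: "u \<in> sobolev \<Omega> m p" and w: "w \<in> sobolev \<Omega> m p"
  shows "(\<lambda>x. a * u x + b * w x) \<in> sobolev \<Omega> m p"
proof (rule sobolevI[where v = "\<lambda>ks x. a * wderiv \<Omega> ks u x + b * wderiv \<Omega> ks w x"])
  show "p_integrable (lebesgue_on \<Omega>) p (\<lambda>x. a * u x + b * w x)"
    using p u w by (intro p_integrable_lincomb sobolev_p_integrable)
  fix ks :: "'n list" assume ks: "length ks \<le> m"
  show "weak_deriv \<Omega> ks (\<lambda>x. a * u x + b * w x) (\<lambda>x. a * wderiv \<Omega> ks u x + b * wderiv \<Omega> ks w x)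
    \<and> p_integrable (lebesgue_on \<Omega>) p (\<lambda>x. a * wderiv \<Omega> ks u x + b * wderiv \<Omega> ks w x)"
    using sobolev_wderiv[OF op u ks] sobolev_wderiv[OF op w ks]
    by (auto intro: weak_deriv_lincomb[OF op] p_integrable_lincomb[OF p])
qed

lemma wderiv_lincomb:
  fixes u w :: "real ^ 'n \<Rightarrow> real"
  assumes op: "open \<Omega>" and u: "u \<in> sobolev \<Omega> m p" and w: "w \<in> sobolev \<Omega> m p" and ks: "length ks \<le> m"
  shows "AE x in lebesgue_on \<Omega>. wderiv \<Omega> ks (\<lambda>x. a * u x + b * w x) x = a * wderiv \<Omega> ks u x + b * wderiv \<Omega> ks w x"
  by (rule wderiv_AE[OF op weak_deriv_lincomb[OF op sobolev_wderiv(1)[OF op u ks] sobolev_wderiv(1)[OF op w ks]]])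

lemma deriv_energy_lincomb:
  fixes u w :: "real ^ 'n \<Rightarrow> real"
  assumes op: "open \<Omega>" and p: "0 \<le> p" and u: "u \<in> sobolev \<Omega> m p" and w: "w \<in> sobolev \<Omega> m p" and ks: "length ks \<le> m"
  shows "deriv_energy \<Omega> p ks (\<lambda>x. a * u x + b * w x) = (LINT x|lebesgue_on \<Omega>. \<bar>a * wderiv \<Omega> ks u x + b * wderiv \<Omega> ks w x\<bar> powr p)"
    and "deriv_energy \<Omega> p ks (\<lambda>x. a * u x + b * w x)
      \<le> 2 powr p * (\<bar>a\<bar> powr p * deriv_energy \<Omega> p ks u + \<bar>b\<bar> powr p * deriv_energy \<Omega> p ks w)"
proof -
  note U = sobolev_wderiv(2)[OF op u ks] and W = sobolev_wderiv(2)[OF op w ks]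
  have UW: "p_integrable (lebesgue_on \<Omega>) p (\<lambda>x. a * wderiv \<Omega> ks u x + b * wderiv \<Omega> ks w x)"
    by (rule p_integrable_lincomb[OF p U W])
  show eq: "deriv_energy \<Omega> p ks (\<lambda>x. a * u x + b * w x) = (LINT x|lebesgue_on \<Omega>. \<bar>a * wderiv \<Omega> ks u x + b * wderiv \<Omega> ks w x\<bar> powr p)"
    by (rule deriv_energy_eq[OF op sobolev_lincomb[OF op p u w] ks wderiv_lincomb[OF op u w ks]])
      (use UW in \<open>simp add: p_integrable_def\<close>)
  also have "\<dots> \<le> (LINT x|lebesgue_on \<Omega>. 2 powr p * (\<bar>a\<bar> powr p * \<bar>wderiv \<Omega> ks u x\<bar> powr p + \<bar>b\<bar> powr p * \<bar>wderiv \<Omega> ks w x\<bar> powr p))"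
  proof (rule integral_mono)
    show "\<bar>a * wderiv \<Omega> ks u x + b * wderiv \<Omega> ks w x\<bar> powr p
      \<le> 2 powr p * (\<bar>a\<bar> powr p * \<bar>wderiv \<Omega> ks u x\<bar> powr p + \<bar>b\<bar> powr p * \<bar>wderiv \<Omega> ks w x\<bar> powr p)" for x
      using abs_powr_add_le[OF p, of "a * wderiv \<Omega> ks u x" "b * wderiv \<Omega> ks w x"]
      by (simp add: abs_mult powr_mult)
  qed (use U W UW in \<open>auto simp: p_integrable_def\<close>)
  also have "\<dots> = 2 powr p * (\<bar>a\<bar> powr p * deriv_energy \<Omega> p ks u + \<bar>b\<bar> powr p * deriv_energy \<Omega> p ks w)"
    using U W by (simp add: p_integrable_def deriv_energy_def)
  finally show "deriv_energy \<Omega> p ks (\<lambda>x. a * u x + b * w x)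
      \<le> 2 powr p * (\<bar>a\<bar> powr p * deriv_energy \<Omega> p ks u + \<bar>b\<bar> powr p * deriv_energy \<Omega> p ks w)" .
qed

lemma sobolev_energy_lincomb:
  fixes u w :: "real ^ 'n \<Rightarrow> real"
  assumes op: "open \<Omega>" and p: "0 \<le> p" and u: "u \<in> sobolev \<Omega> m p" and w: "w \<in> sobolev \<Omega> m p"
  shows "sobolev_energy \<Omega> m p (\<lambda>x. a * u x + b * w x)
      \<le> 2 powr p * (\<bar>a\<bar> powr p * sobolev_energy \<Omega> m p u + \<bar>b\<bar> powr p * sobolev_energy \<Omega> m p w)"
proof -
  have "sobolev_energy \<Omega> m p (\<lambda>x. a * u x + b * w x)
    \<le> (\<Sum>ks | length ks \<le> m. 2 powr p * (\<bar>a\<bar> powr p * deriv_energy \<Omega> p ks u + \<bar>b\<bar> powr p * deriv_energy \<Omega> p ks w))"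
    unfolding sobolev_energy_def by (intro sum_mono deriv_energy_lincomb(2)[OF op p u w]) simp
  also have "\<dots> = 2 powr p * (\<bar>a\<bar> powr p * sobolev_energy \<Omega> m p u + \<bar>b\<bar> powr p * sobolev_energy \<Omega> m p w)"
    by (simp add: sobolev_energy_def sum_distrib_left[symmetric] sum.distrib)
  finally show ?thesis .
qed

text \<open>This permits replacing a Sobolev limit by its convex representative.\<close>

lemma sobolev_cong_AE:
  fixes u u' :: "real ^ 'n \<Rightarrow> real"
  assumes op: "open \<Omega>" and u: "u \<in> sobolev \<Omega> m p" and eq: "AE x in lebesgue_on \<Omega>. u x = u' x"
  shows "u' \<in> sobolev \<Omega> m p"
    and "length ks \<le> m \<Longrightarrow> AE x in lebesgue_on \<Omega>. wderiv \<Omega> ks u' x = wderiv \<Omega> ks u x"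
proof -
  have w: "weak_deriv \<Omega> ks u' (wderiv \<Omega> ks u)" if "length ks \<le> m" for ks
    by (rule weak_deriv_cong_AE[OF op sobolev_wderiv(1)[OF op u that] eq]) simp
  have "u' \<in> borel_measurable (lebesgue_on \<Omega>)"
    using w[of "[]"] by (intro locally_integrable_measurable[OF op]) (simp add: weak_deriv_def)
  then have "p_integrable (lebesgue_on \<Omega>) p u'"
    by (rule p_integrable_cong_AE[OF sobolev_p_integrable[OF u] _ eq])
  then show "u' \<in> sobolev \<Omega> m p"
    by (rule sobolevI) (use w sobolev_wderiv(2)[OF op u] in blast)
  show "AE x in lebesgue_on \<Omega>. wderiv \<Omega> ks u' x = wderiv \<Omega> ks u x" if "length ks \<le> m"
    by (rule wderiv_AE[OF op w[OF that]])
qed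

lemma test_function_p_integrable:
  fixes \<phi> :: "real ^ 'n \<Rightarrow> real"
  assumes op: "open \<Omega>" and t: "test_function \<Omega> \<phi>" and p: "0 < p"
  shows "p_integrable (lebesgue_on \<Omega>) p \<phi>"
proof -
  obtain K where K: "smooth \<phi>" "compact K" "K \<subseteq> \<Omega>" "\<And>x. x \<notin> K \<Longrightarrow> \<phi> x = 0"
    using test_functionE[OF t] by metis
  have c: "continuous_on UNIV (\<lambda>x. \<bar>\<phi> x\<bar> powr p)"
    using p by (intro continuous_on_powr' continuous_on_rabs smooth_continuous_on K(1) continuous_on_const) auto
  have i: "integrable lebesgue (\<lambda>x. \<bar>\<phi> x\<bar> powr p)"
    by (rule integrable_continuous_compact_support[OF c K(2)]) (simp add: K(4))
  have \<Omega>: "\<Omega> \<in> sets lebesgue" using op by auto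
  have "integrable (lebesgue_on \<Omega>) (\<lambda>x. \<bar>\<phi> x\<bar> powr p)"
    using integrable_mult_indicator[OF \<Omega> i] \<Omega> by (subst integrable_restrict_space) auto
  then show ?thesis using test_function_measurable(2)[OF t] by (simp add: p_integrable_def)
qed

lemma test_function_sobolev:
  fixes \<phi> :: "real ^ 'n \<Rightarrow> real"
  assumes op: "open \<Omega>" and t: "test_function \<Omega> \<phi>" and p: "0 < p"
  shows "\<phi> \<in> sobolev \<Omega> 1 p" and "AE x in lebesgue_on \<Omega>. wderiv \<Omega> [k] \<phi> x = partial_deriv [k] \<phi> x"
proof -
  have s: "smooth \<phi>" using t by (simp add: test_function_def)
  have w: "weak_deriv \<Omega> ks \<phi> (partial_deriv ks \<phi>)" if "length ks \<le> 1" for ks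
    using that weak_deriv_test[OF op s] by (cases ks) auto
  show "\<phi> \<in> sobolev \<Omega> 1 p"
    by (rule sobolevI[OF test_function_p_integrable[OF op t p]])
      (use w test_function_p_integrable[OF op test_function_partial_deriv[OF t] p] in blast)
  show "AE x in lebesgue_on \<Omega>. wderiv \<Omega> [k] \<phi> x = partial_deriv [k] \<phi> x"
    by (rule wderiv_AE[OF op w]) simp
qed

section \<open>Zero boundary values, completeness, and bounds by the Hessian\<close>

lemma sobolev0_iff:
  fixes v :: "real ^ 'n \<Rightarrow> real"
  assumes p: "0 < p"
  shows "v \<in> sobolev0 \<Omega> m p \<longleftrightarrow> v \<in> sobolev \<Omega> m p \<and>
    (\<exists>\<phi>. (\<forall>j::nat. test_function \<Omega> (\<phi> j)) \<and> (\<lambda>j. sobolev_energy \<Omega> m p (\<lambda>x. v x - \<phi> j x)) \<longlonglongrightarrow> 0)"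
proof -
  have "(\<lambda>j. e j powr (1 / p)) \<longlonglongrightarrow> 0 \<longleftrightarrow> e \<longlonglongrightarrow> 0" if e: "\<And>j. 0 \<le> e j" for e :: "nat \<Rightarrow> real"
  proof
    assume "(\<lambda>j. e j powr (1 / p)) \<longlonglongrightarrow> 0"
    then have "(\<lambda>j. (e j powr (1 / p)) powr p) \<longlonglongrightarrow> 0 powr p"
      using p by (intro tendsto_powr' tendsto_const) auto
    then show "e \<longlonglongrightarrow> 0" using p e by (simp add: powr_powr)
  next
    assume "e \<longlonglongrightarrow> 0"
    then have "(\<lambda>j. e j powr (1 / p)) \<longlonglongrightarrow> 0 powr (1 / p)"
      using p e by (intro tendsto_powr' tendsto_const) auto
    then show "(\<lambda>j. e j powr (1 / p)) \<longlonglongrightarrow> 0" by simp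
  qed
  then have "(\<lambda>j. sobolev_norm \<Omega> m p (\<lambda>x. v x - \<phi> j x)) \<longlonglongrightarrow> 0
      \<longleftrightarrow> (\<lambda>j. sobolev_energy \<Omega> m p (\<lambda>x. v x - \<phi> j x)) \<longlonglongrightarrow> 0" for \<phi> :: "nat \<Rightarrow> real ^ 'n \<Rightarrow> real"
    unfolding sobolev_norm_energy by (simp add: sobolev_energy_nonneg)
  then show ?thesis by (simp add: sobolev0_def)
qed

lemma sobolev0_sobolev: "v \<in> sobolev0 \<Omega> m p \<Longrightarrow> v \<in> sobolev \<Omega> m p"
  by (simp add: sobolev0_def)

lemma sobolev0_lincomb:
  fixes v w :: "real ^ 'n \<Rightarrow> real"
  assumes op: "open \<Omega>" and p: "0 < p" and v: "v \<in> sobolev0 \<Omega> 1 p" and w: "w \<in> sobolev0 \<Omega> 1 p"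
  shows "(\<lambda>x. a * v x + b * w x) \<in> sobolev0 \<Omega> 1 p"
proof -
  obtain \<phi> where \<phi>: "\<And>j::nat. test_function \<Omega> (\<phi> j)" "(\<lambda>j. sobolev_energy \<Omega> 1 p (\<lambda>x. v x - \<phi> j x)) \<longlonglongrightarrow> 0"
    using v unfolding sobolev0_iff[OF p] by blast
  obtain \<psi> where \<psi>: "\<And>j::nat. test_function \<Omega> (\<psi> j)" "(\<lambda>j. sobolev_energy \<Omega> 1 p (\<lambda>x. w x - \<psi> j x)) \<longlonglongrightarrow> 0"
    using w unfolding sobolev0_iff[OF p] by blast
  have p0: "0 \<le> p" using p by simp
  have sv: "v \<in> sobolev \<Omega> 1 p" "w \<in> sobolev \<Omega> 1 p" using v w by (auto intro: sobolev0_sobolev)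
  have d: "(\<lambda>x. v x - \<phi> j x) \<in> sobolev \<Omega> 1 p" "(\<lambda>x. w x - \<psi> j x) \<in> sobolev \<Omega> 1 p" for j
    using sobolev_lincomb[where a = 1 and b = "-1", OF op p0 sv(1) test_function_sobolev(1)[OF op \<phi>(1) p]]
      sobolev_lincomb[where a = 1 and b = "-1", OF op p0 sv(2) test_function_sobolev(1)[OF op \<psi>(1) p]] by auto
  have le: "sobolev_energy \<Omega> 1 p (\<lambda>x. a * v x + b * w x - (a * \<phi> j x + b * \<psi> j x))
    \<le> 2 powr p * (\<bar>a\<bar> powr p * sobolev_energy \<Omega> 1 p (\<lambda>x. v x - \<phi> j x) + \<bar>b\<bar> powr p * sobolev_energy \<Omega> 1 p (\<lambda>x. w x - \<psi> j x))" for j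
  proof -
    have "(\<lambda>x. a * v x + b * w x - (a * \<phi> j x + b * \<psi> j x)) = (\<lambda>x. a * (v x - \<phi> j x) + b * (w x - \<psi> j x))"
      by (simp add: algebra_simps)
    then show ?thesis using sobolev_energy_lincomb[OF op p0 d] by simp
  qed
  have "(\<lambda>j. 2 powr p * (\<bar>a\<bar> powr p * sobolev_energy \<Omega> 1 p (\<lambda>x. v x - \<phi> j x) + \<bar>b\<bar> powr p * sobolev_energy \<Omega> 1 p (\<lambda>x. w x - \<psi> j x)))
    \<longlonglongrightarrow> 2 powr p * (\<bar>a\<bar> powr p * 0 + \<bar>b\<bar> powr p * 0)"
    by (intro tendsto_mult tendsto_add tendsto_const \<phi>(2) \<psi>(2))
  then have lim: "(\<lambda>j. 2 powr p * (\<bar>a\<bar> powr p * sobolev_energy \<Omega> 1 p (\<lambda>x. v x - \<phi> j x) + \<bar>b\<bar> powr p * sobolev_energy \<Omega> 1 p (\<lambda>x. w x - \<psi> j x))) \<longlonglongrightarrow> 0"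
    by simp
  have "(\<lambda>j. sobolev_energy \<Omega> 1 p (\<lambda>x. a * v x + b * w x - (a * \<phi> j x + b * \<psi> j x))) \<longlonglongrightarrow> 0"
    by (rule tendsto_sandwich[OF _ _ tendsto_const lim])
      (use le sobolev_energy_nonneg in \<open>auto intro!: always_eventually\<close>)
  then show ?thesis
    unfolding sobolev0_iff[OF p]
    using sobolev_lincomb[OF op p0 sv] test_function_lincomb[OF \<phi>(1) \<psi>(1)]
    by (intro conjI exI[of _ "\<lambda>j x. a * \<phi> j x + b * \<psi> j x"]) auto
qed

text \<open>For each \<open>n\<close> one test function within 1 / (n + 1) of \<open>w n\<close> is
  selected; this sequence then approximates \<open>v\<close>.\<close>

lemma sobolev0_limit:
  fixes v :: "real ^ 'n \<Rightarrow> real"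
  assumes op: "open \<Omega>" and p: "0 < p" and v: "v \<in> sobolev \<Omega> 1 p" and w: "\<And>n::nat. w n \<in> sobolev0 \<Omega> 1 p"
    and lim: "(\<lambda>n. sobolev_energy \<Omega> 1 p (\<lambda>x. v x - w n x)) \<longlonglongrightarrow> 0"
  shows "v \<in> sobolev0 \<Omega> 1 p"
proof -
  have p0: "0 \<le> p" using p by simp
  have "\<exists>\<phi>. test_function \<Omega> \<phi> \<and> sobolev_energy \<Omega> 1 p (\<lambda>x. w n x - \<phi> x) < inverse (real (Suc n))" for n
  proof -
    obtain \<phi> where \<phi>: "\<And>j::nat. test_function \<Omega> (\<phi> j)" "(\<lambda>j. sobolev_energy \<Omega> 1 p (\<lambda>x. w n x - \<phi> j x)) \<longlonglongrightarrow> 0"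
      using w[of n] unfolding sobolev0_iff[OF p] by blast
    have "eventually (\<lambda>j. sobolev_energy \<Omega> 1 p (\<lambda>x. w n x - \<phi> j x) < inverse (real (Suc n))) sequentially"
      using \<phi>(2) by (rule order_tendstoD) simp
    then show ?thesis using \<phi>(1) by (meson eventually_sequentially order_refl)
  qed
  then obtain \<phi> where \<phi>: "\<And>n. test_function \<Omega> (\<phi> n)" "\<And>n. sobolev_energy \<Omega> 1 p (\<lambda>x. w n x - \<phi> n x) < inverse (real (Suc n))"
    by metis
  have sw: "w n \<in> sobolev \<Omega> 1 p" for n using w by (rule sobolev0_sobolev)
  have d: "(\<lambda>x. v x - w n x) \<in> sobolev \<Omega> 1 p" "(\<lambda>x. w n x - \<phi> n x) \<in> sobolev \<Omega> 1 p" for n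
    using sobolev_lincomb[where a = 1 and b = "-1", OF op p0 v sw]
      sobolev_lincomb[where a = 1 and b = "-1", OF op p0 sw test_function_sobolev(1)[OF op \<phi>(1) p]] by auto
  have le: "sobolev_energy \<Omega> 1 p (\<lambda>x. v x - \<phi> n x)
    \<le> 2 powr p * (sobolev_energy \<Omega> 1 p (\<lambda>x. v x - w n x) + inverse (real (Suc n)))" for n
  proof -
    have "sobolev_energy \<Omega> 1 p (\<lambda>x. v x - \<phi> n x)
      \<le> 2 powr p * (sobolev_energy \<Omega> 1 p (\<lambda>x. v x - w n x) + sobolev_energy \<Omega> 1 p (\<lambda>x. w n x - \<phi> n x))"
      using sobolev_energy_lincomb[OF op p0 d, of 1 n 1 n] by simp
    also have "\<dots> \<le> 2 powr p * (sobolev_energy \<Omega> 1 p (\<lambda>x. v x - w n x) + inverse (real (Suc n)))"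
      using \<phi>(2)[of n] by (intro mult_left_mono add_left_mono) auto
    finally show ?thesis .
  qed
  have "(\<lambda>n. 2 powr p * (sobolev_energy \<Omega> 1 p (\<lambda>x. v x - w n x) + inverse (real (Suc n)))) \<longlonglongrightarrow> 2 powr p * (0 + 0)"
    by (intro tendsto_mult tendsto_add tendsto_const lim LIMSEQ_inverse_real_of_nat)
  then have lim': "(\<lambda>n. 2 powr p * (sobolev_energy \<Omega> 1 p (\<lambda>x. v x - w n x) + inverse (real (Suc n)))) \<longlonglongrightarrow> 0"
    by simp
  have "(\<lambda>n. sobolev_energy \<Omega> 1 p (\<lambda>x. v x - \<phi> n x)) \<longlonglongrightarrow> 0"
    by (rule tendsto_sandwich[OF _ _ tendsto_const lim'])
      (use le sobolev_energy_nonneg in \<open>auto intro!: always_eventually\<close>)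
  then show ?thesis unfolding sobolev0_iff[OF p] using v \<phi>(1) by blast
qed

lemma sobolev0_zero:
  fixes \<Omega> :: "(real ^ 'n) set"
  assumes op: "open \<Omega>" and p: "0 < p"
  shows "(\<lambda>x. 0) \<in> sobolev0 \<Omega> 1 p"
proof -
  have z: "(\<lambda>x. 0) \<in> sobolev \<Omega> 1 p" by (rule test_function_sobolev(1)[OF op test_function_zero p])
  have "deriv_energy \<Omega> p ks (\<lambda>x. 0) = 0" if "length ks \<le> 1" for ks
    using deriv_energy_lincomb(1)[OF op less_imp_le[OF p] z z that, of 0 0] by simp
  then have "sobolev_energy \<Omega> 1 p (\<lambda>x. 0) = 0" unfolding sobolev_energy_def by (intro sum.neutral) auto
  then show ?thesis
    unfolding sobolev0_iff[OF p] using z test_function_zero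
    by (intro conjI exI[of _ "\<lambda>j x. 0"]) auto
qed

text \<open>Each derivative converges separately in the p-norm. Closedness of weak differentiation
  shows that the limits are the derivatives of the limit of order zero.\<close>

lemma sobolev_complete:
  fixes w :: "nat \<Rightarrow> real ^ 'n \<Rightarrow> real"
  assumes op: "open \<Omega>" and \<Omega>: "\<Omega> \<in> lmeasurable" and p: "1 \<le> p" and w: "\<And>n. w n \<in> sobolev \<Omega> m p"
    and cauchy: "\<And>ks e. length ks \<le> m \<Longrightarrow> 0 < e \<Longrightarrow> \<exists>N. \<forall>i\<ge>N. \<forall>j\<ge>N. deriv_energy \<Omega> p ks (\<lambda>x. w i x - w j x) < e"
  obtains u where "u \<in> sobolev \<Omega> m p" "\<And>ks. length ks \<le> m \<Longrightarrow>
    (\<lambda>n. LINT x|lebesgue_on \<Omega>. \<bar>wderiv \<Omega> ks (w n) x - wderiv \<Omega> ks u x\<bar> powr p) \<longlonglongrightarrow> 0"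
proof -
  have p0: "0 \<le> p" using p by simp
  have fin: "finite_measure (lebesgue_on \<Omega>)" by (rule finite_measure_lebesgue_on[OF \<Omega>])
  have "\<exists>v. p_integrable (lebesgue_on \<Omega>) p v \<and> (\<lambda>n. LINT x|lebesgue_on \<Omega>. \<bar>wderiv \<Omega> ks (w n) x - v x\<bar> powr p) \<longlonglongrightarrow> 0"
    if ks: "length ks \<le> m" for ks
  proof -
    have "\<exists>N. \<forall>i\<ge>N. \<forall>j\<ge>N. (LINT x|lebesgue_on \<Omega>. \<bar>wderiv \<Omega> ks (w i) x - wderiv \<Omega> ks (w j) x\<bar> powr p) < e" if "0 < e" for e
    proof -
      have "deriv_energy \<Omega> p ks (\<lambda>x. w i x - w j x) = (LINT x|lebesgue_on \<Omega>. \<bar>wderiv \<Omega> ks (w i) x - wderiv \<Omega> ks (w j) x\<bar> powr p)" for i j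
        using deriv_energy_lincomb(1)[where a = 1 and b = "-1", OF op p0 w[of i] w[of j] ks] by simp
      then show ?thesis using cauchy[OF ks that] by simp
    qed
    then obtain v where "p_integrable (lebesgue_on \<Omega>) p v" "(\<lambda>n. LINT x|lebesgue_on \<Omega>. \<bar>wderiv \<Omega> ks (w n) x - v x\<bar> powr p) \<longlonglongrightarrow> 0"
      by (rule p_integrable_complete[OF fin p sobolev_wderiv(2)[OF op w ks]])
    then show ?thesis by blast
  qed
  then have "\<forall>ks. \<exists>v. length ks \<le> m \<longrightarrow> p_integrable (lebesgue_on \<Omega>) p v \<and> (\<lambda>n. LINT x|lebesgue_on \<Omega>. \<bar>wderiv \<Omega> ks (w n) x - v x\<bar> powr p) \<longlonglongrightarrow> 0"
    by blast
  from choice[OF this] obtain L where L: "\<And>ks. length ks \<le> m \<Longrightarrow> p_integrable (lebesgue_on \<Omega>) p (L ks)"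
    "\<And>ks. length ks \<le> m \<Longrightarrow> (\<lambda>n. LINT x|lebesgue_on \<Omega>. \<bar>wderiv \<Omega> ks (w n) x - L ks x\<bar> powr p) \<longlonglongrightarrow> 0"
    by blast
  have L1: "(\<lambda>n. LINT x|lebesgue_on \<Omega>. \<bar>wderiv \<Omega> ks (w n) x - L ks x\<bar>) \<longlonglongrightarrow> 0" if ks: "length ks \<le> m" for ks
    by (rule L1_tendsto_0_if_p_norm_tendsto_0[OF fin p _ L(2)[OF ks]])
      (rule p_integrable_diff[OF p0 sobolev_wderiv(2)[OF op w ks] L(1)[OF ks]])
  have i: "integrable (lebesgue_on \<Omega>) (wderiv \<Omega> ks (w n))" "integrable (lebesgue_on \<Omega>) (L ks)" if ks: "length ks \<le> m" for ks n
    using p_integrable_imp_integrable[OF fin p] sobolev_wderiv(2)[OF op w ks] L(1)[OF ks] by blast+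
  \<comment> \<open>\<open>L []\<close> is the limit function. The picked derivatives of order zero
    may be used in place of the functions \<open>w n\<close>, which they equal almost
    everywhere.\<close>
  have wd: "weak_deriv \<Omega> ks (L []) (L ks)" if ks: "length ks \<le> m" for ks
  proof (rule weak_deriv_limit[OF op _ i(1) i(2) i(1) i(2) L1 L1])
    show "weak_deriv \<Omega> ks (wderiv \<Omega> [] (w n)) (wderiv \<Omega> ks (w n))" for n
      by (rule weak_deriv_cong_AE[OF op sobolev_wderiv(1)[OF op w ks]])
        (use wderiv_Nil[OF op w, of n] in \<open>auto elim: eventually_mono\<close>)
  qed (use ks in auto)
  have u: "L [] \<in> sobolev \<Omega> m p"
    by (rule sobolevI[where v = L]) (use L(1) wd in auto)
  have "(\<lambda>n. LINT x|lebesgue_on \<Omega>. \<bar>wderiv \<Omega> ks (w n) x - wderiv \<Omega> ks (L []) x\<bar> powr p) \<longlonglongrightarrow> 0" if ks: "length ks \<le> m" for ks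
  proof -
    have "(LINT x|lebesgue_on \<Omega>. \<bar>wderiv \<Omega> ks (w n) x - wderiv \<Omega> ks (L []) x\<bar> powr p)
      = (LINT x|lebesgue_on \<Omega>. \<bar>wderiv \<Omega> ks (w n) x - L ks x\<bar> powr p)" for n
    proof (rule p_integral_cong_AE)
      show "(\<lambda>x. wderiv \<Omega> ks (w n) x - wderiv \<Omega> ks (L []) x) \<in> borel_measurable (lebesgue_on \<Omega>)"
        "(\<lambda>x. wderiv \<Omega> ks (w n) x - L ks x) \<in> borel_measurable (lebesgue_on \<Omega>)"
        using p_integrable_diff[OF p0 sobolev_wderiv(2)[OF op w ks] sobolev_wderiv(2)[OF op u ks]]
          p_integrable_diff[OF p0 sobolev_wderiv(2)[OF op w ks] L(1)[OF ks]] by (auto simp: p_integrable_def)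
      show "AE x in lebesgue_on \<Omega>. wderiv \<Omega> ks (w n) x - wderiv \<Omega> ks (L []) x = wderiv \<Omega> ks (w n) x - L ks x"
        using wderiv_AE[OF op wd[OF ks]] by eventually_elim simp
    qed
    then show ?thesis using L(2)[OF ks] by simp
  qed
  with u that show ?thesis by blast
qed

text \<open>Both claims hold for test functions and survive the limit: the inequality in the p-norm,
  the mean of the derivative by convergence in the mean.\<close>

lemma sobolev0_poincare_mean_zero:
  fixes v :: "real ^ 'n \<Rightarrow> real"
  assumes p: "1 < p" and v: "v \<in> sobolev0 (ball 0 1) 1 p"
  shows "deriv_energy (ball 0 1) p [] v \<le> (2 powr p * (real CARD('n) powr p * 2 powr p * 2 powr p)) * (\<Sum>k\<in>UNIV. deriv_energy (ball 0 1) p [k] v)"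
    and "(LINT x|lebesgue_on (ball 0 1). wderiv (ball 0 1) [k] v x) = 0"
proof -
  let ?B = "ball (0 :: real ^ 'n) 1"
  have op: "open ?B" by simp
  have p0: "0 < p" "0 \<le> p" "1 \<le> p" using p by auto
  have fin: "finite_measure (lebesgue_on ?B)" by (rule finite_measure_lebesgue_on) simp
  obtain \<phi> where \<phi>: "\<And>j::nat. test_function ?B (\<phi> j)" "(\<lambda>j. sobolev_energy ?B 1 p (\<lambda>x. v x - \<phi> j x)) \<longlonglongrightarrow> 0"
    using v unfolding sobolev0_iff[OF p0(1)] by blast
  define E where "E j = sobolev_energy ?B 1 p (\<lambda>x. v x - \<phi> j x)" for j
  have sv: "v \<in> sobolev ?B 1 p" by (rule sobolev0_sobolev[OF v])
  have s\<phi>: "\<phi> j \<in> sobolev ?B 1 p" for j by (rule test_function_sobolev(1)[OF op \<phi>(1) p0(1)])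
  have sd: "(\<lambda>x. v x - \<phi> j x) \<in> sobolev ?B 1 p" for j
    using sobolev_lincomb[where a = 1 and b = "-1", OF op p0(2) sv s\<phi>] by simp
  have dE: "deriv_energy ?B p ks (\<lambda>x. v x - \<phi> j x) \<le> E j" if "length ks \<le> 1" for ks j
    unfolding E_def by (rule deriv_energy_le_sobolev_energy[OF that])
  have e\<phi>: "deriv_energy ?B p ks (\<phi> j) = (LINT x|lebesgue_on ?B. \<bar>partial_deriv ks (\<phi> j) x\<bar> powr p)" if "length ks \<le> 1" for ks j
  proof -
    have "AE x in lebesgue_on ?B. wderiv ?B ks (\<phi> j) x = partial_deriv ks (\<phi> j) x"
      using that wderiv_Nil[OF op s\<phi>] test_function_sobolev(2)[OF op \<phi>(1) p0(1)] by (cases ks) auto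
    then show ?thesis
      by (rule deriv_energy_eq[OF op s\<phi> that]) (rule test_function_measurable(2)[OF test_function_partial_deriv[OF \<phi>(1)]])
  qed
  \<comment> \<open>The constant for test functions. Two more factors \<open>2 powr p\<close> arise,
    one from splitting \<open>v\<close> into \<open>v - \<phi> j\<close> and
    \<open>\<phi> j\<close>, one from bounding the gradient of \<open>\<phi> j\<close> by that of
    \<open>v\<close> plus an error.\<close>
  define c where "c = real CARD('n) powr p * 2 powr p"
  have c0: "0 \<le> c" by (simp add: c_def)
  let ?S = "\<Sum>k\<in>UNIV. deriv_energy ?B p [k] v"
  have le: "deriv_energy ?B p [] v \<le> 2 powr p * (E j + c * (2 powr p * (?S + real CARD('n) * E j)))" for j
  proof -
    have "deriv_energy ?B p [] v \<le> 2 powr p * (deriv_energy ?B p [] (\<lambda>x. v x - \<phi> j x) + deriv_energy ?B p [] (\<phi> j))"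
      using deriv_energy_lincomb(2)[OF op p0(2) sd s\<phi>, of "[]" 1 j 1 j] by simp
    also have "\<dots> \<le> 2 powr p * (E j + c * (2 powr p * (?S + real CARD('n) * E j)))"
    proof (intro mult_left_mono add_mono)
      show "deriv_energy ?B p [] (\<lambda>x. v x - \<phi> j x) \<le> E j" by (rule dE) simp
      have "deriv_energy ?B p [] (\<phi> j) \<le> c * (\<Sum>k\<in>UNIV. deriv_energy ?B p [k] (\<phi> j))"
        using poincare_test_function[OF p \<phi>(1)[of j]] by (simp add: e\<phi> c_def)
      also have "\<dots> \<le> c * (\<Sum>k\<in>UNIV. 2 powr p * (deriv_energy ?B p [k] v + E j))"
      proof (intro mult_left_mono sum_mono c0)
        fix k :: 'n
        have "deriv_energy ?B p [k] (\<phi> j) \<le> 2 powr p * (deriv_energy ?B p [k] v + deriv_energy ?B p [k] (\<lambda>x. v x - \<phi> j x))"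
          using deriv_energy_lincomb(2)[OF op p0(2) sv sd, of "[k]" 1 "-1" j] by simp
        also have "\<dots> \<le> 2 powr p * (deriv_energy ?B p [k] v + E j)"
          using dE[of "[k]" j] by (intro mult_left_mono add_left_mono) auto
        finally show "deriv_energy ?B p [k] (\<phi> j) \<le> 2 powr p * (deriv_energy ?B p [k] v + E j)" .
      qed
      also have "\<dots> = c * (2 powr p * (?S + real CARD('n) * E j))"
        by (simp add: sum_distrib_left[symmetric] sum.distrib)
      finally show "deriv_energy ?B p [] (\<phi> j) \<le> c * (2 powr p * (?S + real CARD('n) * E j))" .
    qed simp
    finally show ?thesis .
  qed
  have E0: "E \<longlonglongrightarrow> 0" using \<phi>(2) by (simp add: E_def[abs_def])
  have "(\<lambda>j. 2 powr p * (E j + c * (2 powr p * (?S + real CARD('n) * E j)))) \<longlonglongrightarrow> 2 powr p * (0 + c * (2 powr p * (?S + real CARD('n) * 0)))"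
    by (intro tendsto_mult tendsto_add tendsto_const E0)
  then have "deriv_energy ?B p [] v \<le> 2 powr p * (0 + c * (2 powr p * (?S + real CARD('n) * 0)))"
    by (rule LIMSEQ_le_const) (use le in blast)
  then show "deriv_energy ?B p [] v \<le> (2 powr p * (real CARD('n) powr p * 2 powr p * 2 powr p)) * ?S"
    by (simp add: c_def mult_ac)
  have pv: "p_integrable (lebesgue_on ?B) p (wderiv ?B [k] v)" by (rule sobolev_wderiv(2)[OF op sv]) simp
  have p\<phi>: "p_integrable (lebesgue_on ?B) p (partial_deriv [k] (\<phi> j))" for j
    by (rule test_function_p_integrable[OF op test_function_partial_deriv[OF \<phi>(1)] p0(1)])
  have pd: "p_integrable (lebesgue_on ?B) p (\<lambda>x. wderiv ?B [k] v x - partial_deriv [k] (\<phi> j) x)" for j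
    by (rule p_integrable_diff[OF p0(2) pv p\<phi>])
  have eq: "(LINT x|lebesgue_on ?B. \<bar>wderiv ?B [k] v x - partial_deriv [k] (\<phi> j) x\<bar> powr p) = deriv_energy ?B p [k] (\<lambda>x. v x - \<phi> j x)" for j
  proof (rule deriv_energy_eq[OF op sd, symmetric])
    show "AE x in lebesgue_on ?B. wderiv ?B [k] (\<lambda>x. v x - \<phi> j x) x = wderiv ?B [k] v x - partial_deriv [k] (\<phi> j) x"
      using wderiv_lincomb[OF op sv s\<phi>, of "[k]" 1 "-1" j] test_function_sobolev(2)[OF op \<phi>(1) p0(1), of k j]
      by (auto elim: eventually_elim2)
  qed (use pd in \<open>auto simp: p_integrable_def\<close>)
  have "(\<lambda>j. LINT x|lebesgue_on ?B. \<bar>wderiv ?B [k] v x - partial_deriv [k] (\<phi> j) x\<bar> powr p) \<longlonglongrightarrow> 0"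
    unfolding eq by (rule tendsto_sandwich[OF _ _ tendsto_const E0])
      (use dE deriv_energy_nonneg in \<open>auto intro!: always_eventually\<close>)
  from L1_tendsto_0_if_p_norm_tendsto_0[OF fin p0(3) pd this]
  have l: "(\<lambda>j. LINT x|lebesgue_on ?B. \<bar>wderiv ?B [k] v x - partial_deriv [k] (\<phi> j) x\<bar>) \<longlonglongrightarrow> 0" .
  have b: "\<bar>LINT x|lebesgue_on ?B. wderiv ?B [k] v x\<bar> \<le> (LINT x|lebesgue_on ?B. \<bar>wderiv ?B [k] v x - partial_deriv [k] (\<phi> j) x\<bar>)" for j
  proof -
    obtain K where K: "smooth (\<phi> j)" "compact K" "K \<subseteq> ?B" "\<And>x. x \<notin> K \<Longrightarrow> \<phi> j x = 0"
      using test_functionE[OF \<phi>(1)[of j]] by metis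
    have z: "partial_deriv [k] (\<phi> j) x = 0" if "x \<notin> K" for x
      by (rule partial_deriv_outside[OF compact_imp_closed[OF K(2)] _ that]) (rule K(4))
    have "(LINT x|lebesgue. partial_deriv [k] (\<phi> j) x) = 0"
      by (rule integral_compact_support_partial_deriv[OF smooth_differentiable[OF K(1)] smooth_continuous_on[OF smooth_partial_deriv[OF K(1)]] K(2)])
        (rule K(4))
    moreover have "(\<lambda>x. if x \<in> ?B then partial_deriv [k] (\<phi> j) x else 0) = partial_deriv [k] (\<phi> j)"
      by (rule ext) (metis K(3) subsetD z)
    moreover have "?B \<in> sets lebesgue" by simp
    ultimately have 0: "(LINT x|lebesgue_on ?B. partial_deriv [k] (\<phi> j) x) = 0"
      using Lebesgue_Measure.integral_restrict_UNIV[of ?B "partial_deriv [k] (\<phi> j)"] by simp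
    have "(LINT x|lebesgue_on ?B. wderiv ?B [k] v x) = (LINT x|lebesgue_on ?B. wderiv ?B [k] v x - partial_deriv [k] (\<phi> j) x)"
      using 0 p_integrable_imp_integrable[OF fin p0(3) pv] p_integrable_imp_integrable[OF fin p0(3) p\<phi>] by simp
    then show ?thesis using integral_norm_bound[of "lebesgue_on ?B"] by simp
  qed
  have "\<bar>LINT x|lebesgue_on ?B. wderiv ?B [k] v x\<bar> \<le> 0"
    by (rule LIMSEQ_le_const[OF l]) (use b in blast)
  then show "(LINT x|lebesgue_on ?B. wderiv ?B [k] v x) = 0" by simp
qed

text \<open>The function is bounded by its gradient through its zero boundary values. The gradient
  has no boundary values to use, but its components have mean zero and are bounded by the rows of
  the Hessian.\<close>

lemma sobolev0_second_order_bound: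
  assumes p: "1 < p"
  obtains C where "0 \<le> C" "\<And>(v :: real ^ 'n \<Rightarrow> real) ks. v \<in> sobolev (ball 0 1) 2 p \<Longrightarrow> v \<in> sobolev0 (ball 0 1) 1 p \<Longrightarrow> length ks \<le> 2 \<Longrightarrow>
    deriv_energy (ball 0 1) p ks v \<le> C * (\<Sum>i\<in>UNIV. \<Sum>j\<in>UNIV. deriv_energy (ball 0 1) p [i, j] v)"
proof -
  let ?B = "ball (0 :: real ^ 'n) 1"
  have op: "open ?B" by simp
  have "?B \<noteq> {}" by simp
  obtain C where C: "0 \<le> C" "\<And>f G. (\<And>k. weak_deriv ?B [k] f (G k)) \<Longrightarrow> p_integrable (lebesgue_on ?B) p f \<Longrightarrow>
    (\<And>k. p_integrable (lebesgue_on ?B) p (G k)) \<Longrightarrow> (LINT x|lebesgue_on ?B. f x) = 0 \<Longrightarrow>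
    (LINT x|lebesgue_on ?B. \<bar>f x\<bar> powr p) \<le> C * (\<Sum>k\<in>UNIV. LINT x|lebesgue_on ?B. \<bar>G k x\<bar> powr p)"
    using poincare_mean_zero[OF op convex_ball bounded_ball \<open>?B \<noteq> {}\<close> p] by blast
  define D where "D = 2 powr p * (real CARD('n) powr p * 2 powr p * 2 powr p)"
  have D0: "0 \<le> D" by (simp add: D_def)
  \<comment> \<open>The three summands serve the derivatives of order two, one and zero
    respectively, so one constant covers all of them.\<close>
  show ?thesis
  proof (rule that[of "1 + C + D * C"])
    show "0 \<le> 1 + C + D * C" using C(1) D0 by simp
    fix v :: "real ^ 'n \<Rightarrow> real" and ks :: "'n list"
    assume v: "v \<in> sobolev ?B 2 p" "v \<in> sobolev0 ?B 1 p" and ks: "length ks \<le> 2"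
    let ?S = "\<Sum>i\<in>UNIV. \<Sum>j\<in>UNIV. deriv_energy ?B p [i, j] v"
    have S0: "0 \<le> ?S" by (intro sum_nonneg deriv_energy_nonneg)
    have k1: "deriv_energy ?B p [k] v \<le> C * (\<Sum>j\<in>UNIV. deriv_energy ?B p [k, j] v)" for k
      unfolding deriv_energy_def
    proof (rule C(2))
      show "weak_deriv ?B [j] (wderiv ?B [k] v) (wderiv ?B [k, j] v)" for j
        by (rule weak_deriv_of_weak_deriv[where u = v and i = k]) (use sobolev_wderiv(1)[OF op v(1)] in auto)
      show "p_integrable (lebesgue_on ?B) p (wderiv ?B [k] v)" "p_integrable (lebesgue_on ?B) p (wderiv ?B [k, j] v)" for j
        using sobolev_wderiv(2)[OF op v(1)] by auto
      show "(LINT x|lebesgue_on ?B. wderiv ?B [k] v x) = 0" by (rule sobolev0_poincare_mean_zero(2)[OF p v(2)])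
    qed
    have sum1: "(\<Sum>k\<in>UNIV. deriv_energy ?B p [k] v) \<le> C * ?S"
      unfolding sum_distrib_left[of C] by (rule order_trans[OF sum_mono[OF k1]]) (simp add: sum_distrib_left)
    have k0: "deriv_energy ?B p [] v \<le> D * (C * ?S)"
      using sobolev0_poincare_mean_zero(1)[OF p v(2)] mult_left_mono[OF sum1 D0] unfolding D_def by linarith
    have "0 \<le> C * ?S" "0 \<le> D * (C * ?S)" using C(1) D0 S0 by (intro mult_nonneg_nonneg; simp)+
    then have b: "x \<le> (1 + C + D * C) * ?S" if "x \<le> ?S \<or> x \<le> C * ?S \<or> x \<le> D * (C * ?S)" for x
      using that S0 by (auto simp: distrib_right mult.assoc)
    consider "ks = []" | k where "ks = [k]" | i j where "ks = [i, j]"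
      using ks by (cases ks rule: list.exhaust; cases "tl ks") (auto simp: neq_Nil_conv)
    then show "deriv_energy ?B p ks v \<le> (1 + C + D * C) * ?S"
    proof cases
      case 1
      then show ?thesis using b k0 by blast
    next
      case 2
      have "deriv_energy ?B p [k] v \<le> (\<Sum>k\<in>UNIV. deriv_energy ?B p [k] v)"
        by (rule member_le_sum) (auto intro: deriv_energy_nonneg)
      then show ?thesis using b sum1 2 by force
    next
      case 3
      have "deriv_energy ?B p [i, j] v \<le> (\<Sum>j\<in>UNIV. deriv_energy ?B p [i, j] v)"
        by (rule member_le_sum) (auto intro: deriv_energy_nonneg)
      also have "\<dots> \<le> ?S"
        by (rule member_le_sum) (auto intro: deriv_energy_nonneg sum_nonneg)
      finally show ?thesis using b 3 by blast
    qed
  qed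
qed

section \<open>Limits of convex functions\<close>

text \<open>The limit superior of a bounded real sequence. Unlike a limit it is available at every
  point where the sequence is bounded, and it preserves convexity inequalities.\<close>

definition upper_limit :: "(nat \<Rightarrow> real) \<Rightarrow> real" where
  "upper_limit a = Inf {c. \<exists>N. \<forall>k\<ge>N. a k \<le> c}"

lemma eventual_upper_bounds:
  fixes a :: "nat \<Rightarrow> real"
  assumes "\<And>k. l \<le> a k" "\<And>k. a k \<le> b"
  shows "bdd_below {c. \<exists>N. \<forall>k\<ge>N. a k \<le> c}" "{c. \<exists>N. \<forall>k\<ge>N. a k \<le> c} \<noteq> {}"
proof -
  show "bdd_below {c. \<exists>N. \<forall>k\<ge>N. a k \<le> c}"
    by (rule bdd_belowI[of _ l]) (use assms(1) order_trans in blast)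
  show "{c. \<exists>N. \<forall>k\<ge>N. a k \<le> c} \<noteq> {}" using assms(2) by blast
qed

lemma upper_limit_le:
  assumes "\<And>k. l \<le> a k" "\<And>k. a k \<le> b" "\<And>k. k \<ge> N \<Longrightarrow> a k \<le> c"
  shows "upper_limit a \<le> c"
  unfolding upper_limit_def
  by (rule cInf_lower[OF _ eventual_upper_bounds(1)[OF assms(1,2)]]) (use assms(3) in blast)

lemma upper_limit_eventually:
  assumes "\<And>k. l \<le> a k" "\<And>k. a k \<le> b" "upper_limit a < c"
  obtains N where "\<And>k. k \<ge> N \<Longrightarrow> a k \<le> c"
proof -
  obtain d where "d \<in> {c. \<exists>N. \<forall>k\<ge>N. a k \<le> c}" "d < c"
    using cInf_lessD[OF eventual_upper_bounds(2)[OF assms(1,2)] assms(3)[unfolded upper_limit_def]] by blast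
  then obtain N where "\<forall>k\<ge>N. a k \<le> d" by blast
  then have "a k \<le> c" if "k \<ge> N" for k using that \<open>d < c\<close> by (meson less_imp_le order_trans)
  then show ?thesis by (rule that)
qed

lemma upper_limit_eq:
  assumes "\<And>k. l \<le> a k" "\<And>k. a k \<le> b" "a \<longlonglongrightarrow> L"
  shows "upper_limit a = L"
proof (rule antisym)
  show "upper_limit a \<le> L"
  proof (rule field_le_epsilon)
    fix e :: real assume "0 < e"
    then have "eventually (\<lambda>k. a k < L + e) sequentially" using assms(3) by (intro order_tendstoD) auto
    then obtain N where "\<And>k. k \<ge> N \<Longrightarrow> a k < L + e" by (auto simp: eventually_sequentially)
    then show "upper_limit a \<le> L + e"
      by (intro upper_limit_le[OF assms(1,2), of N]) (auto intro: less_imp_le)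
  qed
  show "L \<le> upper_limit a"
    unfolding upper_limit_def
  proof (rule cInf_greatest[OF eventual_upper_bounds(2)[OF assms(1,2)]])
    fix c assume "c \<in> {c. \<exists>N. \<forall>k\<ge>N. a k \<le> c}"
    then show "L \<le> c" using LIMSEQ_le_const2[OF assms(3)] by blast
  qed
qed

lemma convergent_imp_bounds:
  fixes a :: "nat \<Rightarrow> real"
  assumes "a \<longlonglongrightarrow> L"
  obtains l b where "\<And>k. l \<le> a k" "\<And>k. a k \<le> b"
proof -
  have "Bseq a" using assms by (intro convergent_imp_Bseq convergentI)
  then obtain K where "\<And>k. \<bar>a k\<bar> \<le> K" unfolding Bseq_def by auto
  then have "- K \<le> a k" "a k \<le> K" for k by (simp_all add: abs_le_iff) (metis abs_le_iff minus_le_iff)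
  then show ?thesis using that by blast
qed

text \<open>The preimage is the image of \<open>N\<close> under the inverse affine map, and
  differentiable maps send negligible sets to negligible sets.\<close>

lemma negligible_affine_vimage:
  fixes N :: "'a::euclidean_space set"
  assumes "negligible N" "a \<noteq> 0"
  shows "negligible {h. x + a *\<^sub>R h \<in> N}"
proof -
  have "{h. x + a *\<^sub>R h \<in> N} = (\<lambda>y. (1 / a) *\<^sub>R (y - x)) ` N"
  proof (intro set_eqI iffI)
    fix h assume "h \<in> {h. x + a *\<^sub>R h \<in> N}"
    then have "x + a *\<^sub>R h \<in> N" "h = (1 / a) *\<^sub>R (x + a *\<^sub>R h - x)" using assms(2) by auto
    then show "h \<in> (\<lambda>y. (1 / a) *\<^sub>R (y - x)) ` N" by blast
  qed (use assms(2) in auto)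
  moreover have "negligible ((\<lambda>y. (1 / a) *\<^sub>R (y - x)) ` N)"
    by (rule negligible_differentiable_image_negligible[OF order_refl assms(1)])
      (auto intro!: derivative_intros)
  ultimately show ?thesis by simp
qed

lemma convex_on_midpoint:
  fixes u :: "'a::real_vector \<Rightarrow> real"
  assumes "convex_on S u" "x \<in> S" "y \<in> S" "z + z = x + y"
  shows "2 * u z \<le> u x + u y"
proof -
  have "z = (1 / 2) *\<^sub>R (z + z)" by (simp flip: scaleR_2)
  then have z: "z = (1 - 1 / 2) *\<^sub>R x + (1 / 2) *\<^sub>R y" using assms(4) by (simp add: scaleR_add_right)
  have "u z \<le> (1 - 1 / 2) * u x + (1 / 2) * u y"
    unfolding z using assms by (intro convex_onD) auto
  then show ?thesis by simp
qed

text \<open>Every point of the domain is the midpoint of two points of convergence, and an end point of a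
  segment whose midpoint and other end point are points of convergence; this bounds the sequence from
  above and from below.\<close>

lemma convex_AE_limit:
  fixes w :: "nat \<Rightarrow> 'a::euclidean_space \<Rightarrow> real"
  assumes op: "open S" and conv: "convex S" and w: "\<And>n. convex_on S (w n)"
    and lim: "AE x in lebesgue_on S. (\<lambda>n. w n x) \<longlonglongrightarrow> U x"
  obtains u where "convex_on S u" "AE x in lebesgue_on S. U x = u x"
proof -
  have S: "S \<in> sets lebesgue" using op by auto
  have "AE x in lebesgue. x \<in> S \<longrightarrow> (\<lambda>n. w n x) \<longlonglongrightarrow> U x"
    using lim S by (simp add: AE_restrict_space_iff)
  then obtain N where N': "N \<in> null_sets lebesgue"
    "{x \<in> space lebesgue. \<not> (x \<in> S \<longrightarrow> (\<lambda>n. w n x) \<longlonglongrightarrow> U x)} \<subseteq> N"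
    unfolding eventually_ae_filter by blast
  then have N: "negligible N" "\<And>x. x \<notin> N \<Longrightarrow> x \<in> S \<Longrightarrow> (\<lambda>n. w n x) \<longlonglongrightarrow> U x"
    by (auto simp: negligible_iff_null_sets)
  have bounds: "\<exists>l b. (\<forall>k. l \<le> w k x) \<and> (\<forall>k. w k x \<le> b)" if x: "x \<in> S" for x
  proof -
    obtain r where r: "0 < r" "ball x r \<subseteq> S" using op x by (meson openE)
    \<comment> \<open>Increments for which one of the points x + h, x - h, x + 2 h meets the
      exceptional set. They form a null set, so a good \<open>h\<close> exists in a ball, whose
      radius r / 2 leaves room for 2 h.\<close>
    let ?N = "{h. x + 1 *\<^sub>R h \<in> N} \<union> {h. x + (- 1) *\<^sub>R h \<in> N} \<union> {h. x + 2 *\<^sub>R h \<in> N}"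
    have "negligible ?N" by (intro negligible_Un negligible_affine_vimage N(1)) auto
    moreover have "\<not> negligible (ball (0::'a) (r / 2))" using r(1) by (intro open_not_negligible) auto
    ultimately have "\<not> ball (0::'a) (r / 2) \<subseteq> ?N" using negligible_subset by blast
    then obtain h where "h \<in> ball 0 (r / 2)" "h \<notin> ?N" by blast
    then have h: "norm h < r / 2" "x + h \<notin> N" "x - h \<notin> N" "x + 2 *\<^sub>R h \<notin> N" by simp_all
    have "x + h \<in> ball x r" "x - h \<in> ball x r" "x + 2 *\<^sub>R h \<in> ball x r"
      using h(1) r(1) by (auto simp: dist_norm)
    then have inS: "x + h \<in> S" "x - h \<in> S" "x + 2 *\<^sub>R h \<in> S" using r(2) by auto
    obtain l1 b1 where 1: "\<And>k. l1 \<le> w k (x + h)" "\<And>k. w k (x + h) \<le> b1"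
      using convergent_imp_bounds[OF N(2)[OF h(2) inS(1)]] by metis
    obtain l2 b2 where 2: "\<And>k. l2 \<le> w k (x - h)" "\<And>k. w k (x - h) \<le> b2"
      using convergent_imp_bounds[OF N(2)[OF h(3) inS(2)]] by metis
    obtain l3 b3 where 3: "\<And>k. l3 \<le> w k (x + 2 *\<^sub>R h)" "\<And>k. w k (x + 2 *\<^sub>R h) \<le> b3"
      using convergent_imp_bounds[OF N(2)[OF h(4) inS(3)]] by metis
    have "w k x \<le> (b1 + b2) / 2" for k
      using convex_on_midpoint[OF w inS(1,2), of x k] 1(2)[of k] 2(2)[of k] by simp
    moreover have "2 * l1 - b3 \<le> w k x" for k
      using convex_on_midpoint[OF w x inS(3), of "x + h" k] 1(1)[of k] 3(2)[of k] by (simp add: scaleR_2)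
    ultimately show ?thesis by blast
  qed
  \<comment> \<open>On the exceptional set too the limit superior is meaningful, since the sequence
    is bounded at every point of \<open>S\<close>. Where the sequence converges it agrees with
    \<open>U\<close>.\<close>
  define u where "u x = upper_limit (\<lambda>k. w k x)" for x
  have "U x = u x" if x: "x \<in> S" "x \<notin> N" for x
  proof -
    obtain l b where "\<And>k. l \<le> w k x" "\<And>k. w k x \<le> b" using bounds[OF x(1)] by blast
    from upper_limit_eq[of l "\<lambda>k. w k x", OF this N(2)[OF x(2,1)]] show ?thesis by (simp add: u_def)
  qed
  moreover have "AE x in lebesgue. x \<notin> N"
    using N(1) by (intro AE_not_in) (simp add: negligible_iff_null_sets)
  ultimately have "AE x in lebesgue. x \<in> S \<longrightarrow> U x = u x" by (auto elim: eventually_mono)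
  then have ae: "AE x in lebesgue_on S. U x = u x" using S by (simp add: AE_restrict_space_iff)
  have "convex_on S u"
  proof (rule convex_onI[OF _ conv])
    fix t x y assume t: "0 < t" "t < (1::real)" and xy: "x \<in> S" "y \<in> S"
    let ?z = "(1 - t) *\<^sub>R x + t *\<^sub>R y"
    have z: "?z \<in> S" using conv xy t by (intro convexD) auto
    obtain lx bx where x: "\<And>k. lx \<le> w k x" "\<And>k. w k x \<le> bx" using bounds[OF xy(1)] by blast
    obtain ly b_y where y: "\<And>k. ly \<le> w k y" "\<And>k. w k y \<le> b_y" using bounds[OF xy(2)] by blast
    obtain lz bz where zb: "\<And>k. lz \<le> w k ?z" "\<And>k. w k ?z \<le> bz" using bounds[OF z] by blast
    show "u ?z \<le> (1 - t) * u x + t * u y"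
    proof (rule field_le_epsilon)
      fix e :: real assume e: "0 < e"
      obtain Nx where Nx: "\<And>k. k \<ge> Nx \<Longrightarrow> w k x \<le> u x + e"
        using upper_limit_eventually[of lx "\<lambda>k. w k x" bx "u x + e", OF x] e unfolding u_def by auto
      obtain Ny where Ny: "\<And>k. k \<ge> Ny \<Longrightarrow> w k y \<le> u y + e"
        using upper_limit_eventually[of ly "\<lambda>k. w k y" b_y "u y + e", OF y] e unfolding u_def by auto
      have "w k ?z \<le> (1 - t) * u x + t * u y + e" if k: "k \<ge> max Nx Ny" for k
      proof -
        have "w k ?z \<le> (1 - t) * w k x + t * w k y" using w t xy by (intro convex_onD) auto
        also have "\<dots> \<le> (1 - t) * (u x + e) + t * (u y + e)"
          using Nx[of k] Ny[of k] k t by (intro add_mono mult_left_mono) auto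
        also have "\<dots> = (1 - t) * u x + t * u y + e" by (simp add: algebra_simps)
        finally show ?thesis .
      qed
      then show "u ?z \<le> (1 - t) * u x + t * u y + e"
        unfolding u_def[of ?z] by (rule upper_limit_le[of lz "\<lambda>k. w k ?z", OF zb])
    qed
  qed
  with ae that show ?thesis by blast
qed

section \<open>The energy functional\<close>

lemma borel_measurable_lebesgue_on_AE:
  fixes f h :: "'a::euclidean_space \<Rightarrow> real"
  assumes S: "S \<in> sets lebesgue" and f: "f \<in> borel_measurable (lebesgue_on S)"
    and eq: "AE x in lebesgue_on S. f x = h x"
  shows "h \<in> borel_measurable (lebesgue_on S)"
proof -
  have m: "(\<lambda>x. if x \<in> S then f x else 0) \<in> borel_measurable lebesgue"
    using f S by (rule borel_measurable_if_I)
  have "AE x in lebesgue. x \<in> S \<longrightarrow> f x = h x" using eq S by (simp add: AE_restrict_space_iff)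
  then have "AE x in lebesgue. (if x \<in> S then f x else 0) = (if x \<in> S then h x else 0)"
    by eventually_elim auto
  from borel_measurable_AE[OF m this] show ?thesis by (rule borel_measurable_if_D)
qed

lemma norm_matrix_le_sum:
  fixes M :: "real ^ 'n ^ 'n"
  shows "norm M \<le> (\<Sum>i\<in>UNIV. \<Sum>j\<in>UNIV. \<bar>M $ i $ j\<bar>)"
proof -
  have "norm M \<le> (\<Sum>i\<in>UNIV. norm (M $ i))"
    unfolding norm_vec_def[of M] by (rule L2_set_le_sum) simp
  also have "\<dots> \<le> (\<Sum>i\<in>UNIV. \<Sum>j\<in>UNIV. \<bar>M $ i $ j\<bar>)"
    by (intro sum_mono norm_le_l1_cart)
  finally show ?thesis .
qed

lemma norm_matrix_powr_le:
  fixes M :: "real ^ 'n ^ 'n"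
  assumes p: "0 \<le> p"
  shows "norm M powr p \<le> (real (CARD('n) * CARD('n))) powr p * (\<Sum>i\<in>UNIV. \<Sum>j\<in>UNIV. \<bar>M $ i $ j\<bar> powr p)"
proof -
  have "norm M powr p \<le> (\<Sum>i\<in>UNIV. \<Sum>j\<in>UNIV. \<bar>M $ i $ j\<bar>) powr p"
    using p norm_matrix_le_sum[of M] by (intro powr_mono2) auto
  also have "(\<Sum>i\<in>UNIV. \<Sum>j\<in>UNIV. \<bar>M $ i $ j\<bar>) = (\<Sum>z\<in>UNIV \<times> UNIV. \<bar>M $ fst z $ snd z\<bar>)"
    by (simp add: sum.cartesian_product split_beta)
  also have "\<dots> powr p \<le> real (card (UNIV \<times> UNIV :: ('n \<times> 'n) set)) powr p * (\<Sum>z\<in>UNIV \<times> UNIV. \<bar>M $ fst z $ snd z\<bar> powr p)"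
    using p by (intro sum_powr_le) auto
  also have "\<dots> = (real (CARD('n) * CARD('n))) powr p * (\<Sum>i\<in>UNIV. \<Sum>j\<in>UNIV. \<bar>M $ i $ j\<bar> powr p)"
    by (simp add: sum.cartesian_product split_beta card_cartesian_product)
  finally show ?thesis .
qed

locale convex_energy = elliptic_operator F nrm lam Lam
  for F :: "real ^ 'n ^ 'n \<Rightarrow> real" and nrm :: "real ^ 'n ^ 'n \<Rightarrow> real" and lam Lam :: real +
  fixes p gam_pos gam_neg :: real and g :: "real ^ 'n \<Rightarrow> real"
  assumes p: "1 < p" and gam: "0 \<le> gam_pos" "0 \<le> gam_neg"
    and g_sobolev: "g \<in> sobolev (ball 0 1) 2 p" and g_convex: "convex_on (ball 0 1) g"
begin

abbreviation B where "B \<equiv> ball (0 :: real ^ 'n) 1"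

abbreviation E where "E \<equiv> energy F p gam_pos gam_neg"

definition density :: "(real ^ 'n \<Rightarrow> real) \<Rightarrow> real ^ 'n \<Rightarrow> real" where
  "density u x = F (weak_hessian B u x) powr p + gam_pos * max (u x) 0 - gam_neg * min (u x) 0"

lemma energy_density: "E u = (LINT x|lebesgue_on B. density u x)"
  by (simp add: energy_def density_def)

lemma open_B: "open B" by simp

lemma B_sets: "B \<in> sets lebesgue" by simp

lemma B_finite: "finite_measure (lebesgue_on B)"
  by (rule finite_measure_lebesgue_on) simp

lemma p_pos: "0 < p" "0 \<le> p" "1 \<le> p" using p by auto

text \<open>This holds at every point, even where \<open>F\<close> of the Hessian is negative,
  because \<open>powr\<close> takes nonnegative values.\<close>

lemma density_nonneg: "0 \<le> density u x"
proof -
  have "0 \<le> gam_pos * max (u x) 0" "gam_neg * min (u x) 0 \<le> 0"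
    using gam by (auto intro: mult_nonneg_nonpos)
  then show ?thesis using powr_ge_zero[of "F (weak_hessian B u x)" p] unfolding density_def by linarith
qed

lemma energy_nonneg: "0 \<le> E u"
  unfolding energy_density by (intro Bochner_Integration.integral_nonneg density_nonneg)

lemma admissible_sobolev: "u \<in> admissible p g \<Longrightarrow> u \<in> sobolev B 2 p"
  by (simp add: admissible_def)

lemma admissible_hessian:
  assumes "u \<in> admissible p g"
  shows "AE x in lebesgue_on B. weak_hessian B u x \<in> sym_matrices \<and> nonneg_definite (weak_hessian B u x)"
proof (rule convex_weak_hessian[OF open_B])
  show "convex_on B u" using assms by (simp add: admissible_def)
  show "weak_deriv B [i, j] u (wderiv B [i, j] u)" for i j
    by (rule sobolev_wderiv(1)[OF open_B admissible_sobolev[OF assms]]) simp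
qed

lemma weak_hessian_measurable:
  assumes "u \<in> admissible p g"
  shows "weak_hessian B u \<in> borel_measurable (lebesgue_on B)"
proof -
  have "wderiv B [i, j] u \<in> borel_measurable (lebesgue_on B)" for i j
    using sobolev_wderiv(2)[OF open_B admissible_sobolev[OF assms], of "[i, j]"] by (simp add: p_integrable_def)
  then have "(\<lambda>x. weak_hessian B u x \<bullet> b) \<in> borel_measurable (lebesgue_on B)" if "b \<in> Basis" for b
    using that by (auto simp: Basis_vec_def inner_axis weak_hessian_def)
  then show ?thesis by (subst borel_measurable_euclidean_space) blast
qed

text \<open>\<open>F\<close> is known to be continuous on symmetric matrices only. Composing it with
  the symmetrization \<open>S\<close> gives a function continuous everywhere, and the Hessian equals
  its symmetrization almost everywhere.\<close>

lemma F_hessian_measurable: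
  assumes "u \<in> admissible p g"
  shows "(\<lambda>x. F (weak_hessian B u x)) \<in> borel_measurable (lebesgue_on B)"
proof (rule borel_measurable_lebesgue_on_AE[OF B_sets])
  define S where "S M = (1 / 2) *\<^sub>R (M + transpose M)" for M :: "real ^ 'n ^ 'n"
  have S: "S M \<in> sym_matrices" for M by (auto simp: S_def sym_matrices_iff transpose_def)
  have S': "S M = M" if "M \<in> sym_matrices" for M
  proof -
    have "transpose M = M" using that by (simp add: sym_matrices_def)
    then show ?thesis by (simp add: S_def flip: scaleR_2)
  qed
  have cS: "continuous_on UNIV S"
    unfolding S_def transpose_def by (intro continuous_intros continuous_on_vec_lambda)
  have "continuous_on UNIV (\<lambda>M. F (S M))"
    by (rule continuous_on_compose2[OF F_continuous cS]) (use S in auto)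
  then have "(\<lambda>M. F (S M)) \<in> borel_measurable borel" by (rule borel_measurable_continuous_onI)
  then show "(\<lambda>x. F (S (weak_hessian B u x))) \<in> borel_measurable (lebesgue_on B)"
    by (rule measurable_compose[OF weak_hessian_measurable[OF assms]])
  show "AE x in lebesgue_on B. F (S (weak_hessian B u x)) = F (weak_hessian B u x)"
    using admissible_hessian[OF assms] by eventually_elim (simp add: S')
qed

lemma admissible_measurable: "u \<in> admissible p g \<Longrightarrow> u \<in> borel_measurable (lebesgue_on B)"
  using sobolev_p_integrable[OF admissible_sobolev] by (auto simp: p_integrable_def)

lemma density_measurable:
  assumes "u \<in> admissible p g" shows "density u \<in> borel_measurable (lebesgue_on B)"
proof -
  note [measurable] = F_hessian_measurable[OF assms] admissible_measurable[OF assms]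
  show ?thesis unfolding density_def[abs_def] by measurable
qed

text \<open>The Lipschitz bound and \<open>F 0 = 0\<close> give linear growth, so the p-th power is
  controlled by those of the entries. Integrability matters because the integral of a nonintegrable
  function is 0 by convention, which would make the energy meaningless.\<close>

lemma density_integrable:
  assumes u: "u \<in> admissible p g" shows "integrable (lebesgue_on B) (density u)"
proof -
  obtain L where L: "L-lipschitz_on sym_matrices F" using F_lipschitz .
  have L0: "0 \<le> L" using L by (rule lipschitz_on_nonneg)
  let ?H = "weak_hessian B u"
  define c where "c = L powr p * (real (CARD('n) * CARD('n))) powr p"
  have ui: "integrable (lebesgue_on B) u"
    using p_integrable_imp_integrable[OF B_finite p_pos(3) sobolev_p_integrable[OF admissible_sobolev[OF u]]] .
  have Hi: "integrable (lebesgue_on B) (\<lambda>x. \<bar>?H x $ i $ j\<bar> powr p)" for i j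
    using sobolev_wderiv(2)[OF open_B admissible_sobolev[OF u], of "[i, j]"]
    by (simp add: p_integrable_def weak_hessian_def)
  show ?thesis
  proof (rule Bochner_Integration.integrable_bound[OF _ density_measurable[OF u]])
    show "integrable (lebesgue_on B) (\<lambda>x. c * (\<Sum>i\<in>UNIV. \<Sum>j\<in>UNIV. \<bar>?H x $ i $ j\<bar> powr p) + (gam_pos + gam_neg) * \<bar>u x\<bar>)"
      using Hi ui by simp
    show "AE x in lebesgue_on B. norm (density u x)
      \<le> norm (c * (\<Sum>i\<in>UNIV. \<Sum>j\<in>UNIV. \<bar>?H x $ i $ j\<bar> powr p) + (gam_pos + gam_neg) * \<bar>u x\<bar>)"
      using admissible_hessian[OF u]
    proof eventually_elim
      case (elim x)
      then have F0: "0 \<le> F (?H x)" using F_nonneg by blast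
      have "dist (F (?H x)) (F 0) \<le> L * dist (?H x) 0"
        using elim by (intro lipschitz_onD[OF L] sym_matrices_0) auto
      then have "F (?H x) \<le> L * norm (?H x)" using F0 by (simp add: F_0 dist_norm)
      then have "F (?H x) powr p \<le> (L * norm (?H x)) powr p" using F0 p by (intro powr_mono2) auto
      also have "\<dots> = L powr p * norm (?H x) powr p" using L0 by (simp add: powr_mult)
      also have "\<dots> \<le> c * (\<Sum>i\<in>UNIV. \<Sum>j\<in>UNIV. \<bar>?H x $ i $ j\<bar> powr p)"
        unfolding c_def mult.assoc by (intro mult_left_mono norm_matrix_powr_le p_pos) auto
      finally have 1: "F (?H x) powr p \<le> c * (\<Sum>i\<in>UNIV. \<Sum>j\<in>UNIV. \<bar>?H x $ i $ j\<bar> powr p)" .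
      have 2: "gam_pos * max (u x) 0 \<le> gam_pos * \<bar>u x\<bar>" using gam by (intro mult_left_mono) auto
      have "gam_neg * (- min (u x) 0) \<le> gam_neg * \<bar>u x\<bar>" using gam by (intro mult_left_mono) auto
      then have "density u x \<le> c * (\<Sum>i\<in>UNIV. \<Sum>j\<in>UNIV. \<bar>?H x $ i $ j\<bar> powr p) + (gam_pos + gam_neg) * \<bar>u x\<bar>"
        using 1 2 unfolding density_def by (simp add: distrib_right)
      then show ?case using density_nonneg[of u x] by simp
    qed
  qed
qed

text \<open>The auxiliary functional. Summing p-th powers of entries lets the scalar uniform
  convexity inequality act on every entry separately.\<close>

definition hessian_energy :: "(real ^ 'n \<Rightarrow> real) \<Rightarrow> real" where
  "hessian_energy u = (\<Sum>i\<in>UNIV. \<Sum>j\<in>UNIV. deriv_energy B p [i, j] u)"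

lemma hessian_energy_nonneg: "0 \<le> hessian_energy u"
  unfolding hessian_energy_def by (intro sum_nonneg deriv_energy_nonneg)

text \<open>Each entry of the Hessian is at most \<open>F\<close> of it divided by \<open>c\<close>,
  and the zero order terms are nonnegative. Summation over the entries accounts for the factor
  \<open>CARD('n) * CARD('n)\<close>.\<close>

lemma energy_coercive:
  obtains K where "0 \<le> K" "\<And>u. u \<in> admissible p g \<Longrightarrow> hessian_energy u \<le> K * E u"
proof -
  obtain c where c: "0 < c" "\<And>M i j. M \<in> sym_matrices \<Longrightarrow> nonneg_definite M \<Longrightarrow> c * \<bar>M $ i $ j\<bar> \<le> F M"
    using F_coercive by blast
  define K where "K = real (CARD('n) * CARD('n)) * (1 / c powr p)"
  show ?thesis
  proof (rule that[of K])
    show "0 \<le> K" by (simp add: K_def)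
    fix u assume u: "u \<in> admissible p g"
    have "deriv_energy B p [i, j] u \<le> 1 / c powr p * E u" for i j
    proof -
      have "(LINT x|lebesgue_on B. c powr p * \<bar>wderiv B [i, j] u x\<bar> powr p) \<le> (LINT x|lebesgue_on B. density u x)"
      proof (rule integral_mono_AE)
        show "integrable (lebesgue_on B) (\<lambda>x. c powr p * \<bar>wderiv B [i, j] u x\<bar> powr p)"
          using sobolev_wderiv(2)[OF open_B admissible_sobolev[OF u], of "[i, j]"] by (simp add: p_integrable_def)
        show "integrable (lebesgue_on B) (density u)" by (rule density_integrable[OF u])
        show "AE x in lebesgue_on B. c powr p * \<bar>wderiv B [i, j] u x\<bar> powr p \<le> density u x"
          using admissible_hessian[OF u]
        proof eventually_elim
          case (elim x)
          then have "c * \<bar>weak_hessian B u x $ i $ j\<bar> \<le> F (weak_hessian B u x)" by (intro c(2)) auto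
          then have "(c * \<bar>wderiv B [i, j] u x\<bar>) powr p \<le> F (weak_hessian B u x) powr p"
            using c(1) p by (intro powr_mono2) (auto simp: weak_hessian_def)
          moreover have "(c * \<bar>wderiv B [i, j] u x\<bar>) powr p = c powr p * \<bar>wderiv B [i, j] u x\<bar> powr p"
            using c(1) by (simp add: powr_mult)
          moreover have "0 \<le> gam_pos * max (u x) 0" "gam_neg * min (u x) 0 \<le> 0"
            using gam by (auto intro: mult_nonneg_nonpos)
          ultimately show ?case unfolding density_def by linarith
        qed
      qed
      then have "c powr p * deriv_energy B p [i, j] u \<le> E u" by (simp add: deriv_energy_def energy_density)
      then show ?thesis using c(1) by (simp add: field_simps)
    qed
    then have "hessian_energy u \<le> (\<Sum>i\<in>(UNIV :: 'n set). \<Sum>j\<in>(UNIV :: 'n set). 1 / c powr p * E u)"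
      unfolding hessian_energy_def by (intro sum_mono)
    also have "\<dots> = K * E u" by (simp add: K_def)
    finally show "hessian_energy u \<le> K * E u" .
  qed
qed

lemma g_admissible: "g \<in> admissible p g"
  using g_sobolev g_convex sobolev0_zero[OF open_B p_pos(1)] by (simp add: admissible_def)

lemma admissible_midpoint:
  assumes u: "u \<in> admissible p g" and w: "w \<in> admissible p g"
  shows "(\<lambda>x. 1 / 2 * u x + 1 / 2 * w x) \<in> admissible p g"
proof -
  have "(\<lambda>x. 1 / 2 * (u x - g x) + 1 / 2 * (w x - g x)) \<in> sobolev0 B 1 p"
    using u w by (intro sobolev0_lincomb[OF open_B p_pos(1)]) (auto simp: admissible_def)
  moreover have "(\<lambda>x. 1 / 2 * (u x - g x) + 1 / 2 * (w x - g x)) = (\<lambda>x. 1 / 2 * u x + 1 / 2 * w x - g x)"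
    by (rule ext) (simp add: field_simps)
  moreover have "convex_on B (\<lambda>x. 1 / 2 * u x + 1 / 2 * w x)"
    using u w by (intro convex_on_add convex_on_cmul) (auto simp: admissible_def)
  moreover have "(\<lambda>x. 1 / 2 * u x + 1 / 2 * w x) \<in> sobolev B 2 p"
    by (rule sobolev_lincomb[OF open_B p_pos(2) admissible_sobolev[OF u] admissible_sobolev[OF w]])
  ultimately show ?thesis unfolding admissible_def by simp
qed

lemma admissible_diff:
  assumes u: "u \<in> admissible p g" and w: "w \<in> admissible p g"
  shows "(\<lambda>x. u x - w x) \<in> sobolev B 2 p" "(\<lambda>x. u x - w x) \<in> sobolev0 B 1 p"
proof -
  show "(\<lambda>x. u x - w x) \<in> sobolev B 2 p"
    using sobolev_lincomb[where a = 1 and b = "-1", OF open_B p_pos(2) admissible_sobolev[OF u] admissible_sobolev[OF w]] by simp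
  have "(\<lambda>x. u x - g x) \<in> sobolev0 B 1 p" "(\<lambda>x. w x - g x) \<in> sobolev0 B 1 p"
    using u w by (auto simp: admissible_def)
  from sobolev0_lincomb[where a = 1 and b = "-1", OF open_B p_pos(1) this]
  show "(\<lambda>x. u x - w x) \<in> sobolev0 B 1 p" by simp
qed

text \<open>\<open>F\<close> is convex and nonnegative at the Hessians involved, and on nonnegative
  numbers the power is increasing and convex. The positive part and the negative part are convex as
  well, with nonnegative weights.\<close>

lemma energy_midpoint:
  assumes u: "u \<in> admissible p g" and w: "w \<in> admissible p g"
  shows "E (\<lambda>x. 1 / 2 * u x + 1 / 2 * w x) \<le> (E u + E w) / 2"
proof -
  let ?m = "\<lambda>x. 1 / 2 * u x + 1 / 2 * w x"
  note m = admissible_midpoint[OF u w]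
  have "AE x in lebesgue_on B. wderiv B [i, j] ?m x = 1 / 2 * wderiv B [i, j] u x + 1 / 2 * wderiv B [i, j] w x" for i j
    by (rule wderiv_lincomb[OF open_B admissible_sobolev[OF u] admissible_sobolev[OF w]]) simp
  then have "AE x in lebesgue_on B. \<forall>i\<in>UNIV. \<forall>j\<in>UNIV. wderiv B [i, j] ?m x = 1 / 2 * wderiv B [i, j] u x + 1 / 2 * wderiv B [i, j] w x"
    by (intro AE_finite_allI finite_class.finite_UNIV)
  then have H: "AE x in lebesgue_on B. weak_hessian B ?m x = (1 / 2) *\<^sub>R weak_hessian B u x + (1 / 2) *\<^sub>R weak_hessian B w x"
    by eventually_elim (simp add: vec_eq_iff weak_hessian_def)
  have "E ?m \<le> (LINT x|lebesgue_on B. (density u x + density w x) / 2)"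
    unfolding energy_density
  proof (rule integral_mono_AE[OF density_integrable[OF m]])
    show "integrable (lebesgue_on B) (\<lambda>x. (density u x + density w x) / 2)"
      using density_integrable[OF u] density_integrable[OF w] by simp
    show "AE x in lebesgue_on B. density ?m x \<le> (density u x + density w x) / 2"
      using H admissible_hessian[OF u] admissible_hessian[OF w] admissible_hessian[OF m]
    proof eventually_elim
      case (elim x)
      have F0: "0 \<le> F (weak_hessian B u x)" "0 \<le> F (weak_hessian B w x)" "0 \<le> F (weak_hessian B ?m x)"
        using elim(2-4) F_nonneg by blast+
      have "F (weak_hessian B ?m x) \<le> (F (weak_hessian B u x) + F (weak_hessian B w x)) / 2"
        unfolding elim(1) using elim(2,3) by (intro F_midpoint) auto
      then have "F (weak_hessian B ?m x) powr p \<le> ((F (weak_hessian B u x) + F (weak_hessian B w x)) / 2) powr p"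
        using F0 p by (intro powr_mono2) auto
      also have "\<dots> \<le> (F (weak_hessian B u x) powr p + F (weak_hessian B w x) powr p) / 2"
        by (rule powr_midpoint_le[OF p F0(1,2)])
      finally have 1: "F (weak_hessian B ?m x) powr p \<le> (F (weak_hessian B u x) powr p + F (weak_hessian B w x) powr p) / 2" .
      have "max (?m x) 0 \<le> (max (u x) 0 + max (w x) 0) / 2" by (auto simp: max_def)
      then have 2: "gam_pos * max (?m x) 0 \<le> gam_pos * ((max (u x) 0 + max (w x) 0) / 2)"
        using gam by (intro mult_left_mono) auto
      have "(min (u x) 0 + min (w x) 0) / 2 \<le> min (?m x) 0" by (auto simp: min_def)
      then have 3: "gam_neg * ((min (u x) 0 + min (w x) 0) / 2) \<le> gam_neg * min (?m x) 0"
        using gam by (intro mult_left_mono) auto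
      show ?case using 1 2 3 unfolding density_def by (simp add: field_simps)
    qed
  qed
  also have "\<dots> = (E u + E w) / 2"
    unfolding energy_density using density_integrable[OF u] density_integrable[OF w] by simp
  finally show ?thesis .
qed

lemma energy_lower_semicontinuous:
  assumes w: "\<And>n. w n \<in> admissible p g" and u: "u \<in> admissible p g"
    and conv: "\<And>ks. length ks \<le> 2 \<Longrightarrow> (\<lambda>n. LINT x|lebesgue_on B. \<bar>wderiv B ks (w n) x - wderiv B ks u x\<bar> powr p) \<longlonglongrightarrow> 0"
    and le: "\<And>n. E (w n) \<le> c n" and c: "c \<longlonglongrightarrow> m"
  shows "E u \<le> m"
proof -
  \<comment> \<open>All derivatives are collected in one sum, so that a single subsequence makes
    every one of them converge almost everywhere.\<close>
  define S where "S n x = (\<Sum>ks | length ks \<le> 2. \<bar>wderiv B ks (w n) x - wderiv B ks u x\<bar>)" for n x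
  have d: "p_integrable (lebesgue_on B) p (\<lambda>x. wderiv B ks (w n) x - wderiv B ks u x)" if "length ks \<le> 2" for ks n
    by (intro p_integrable_diff p_pos sobolev_wderiv(2)[OF open_B admissible_sobolev] w u that)
  have di: "integrable (lebesgue_on B) (\<lambda>x. wderiv B ks (w n) x - wderiv B ks u x)" if "length ks \<le> 2" for ks n
    by (rule p_integrable_imp_integrable[OF B_finite p_pos(3) d[OF that]])
  have Si: "integrable (lebesgue_on B) (S n)" for n
    unfolding S_def using di by (intro Bochner_Integration.integrable_sum integrable_abs) auto
  have S0: "0 \<le> S n x" for n x unfolding S_def by (intro sum_nonneg) auto
  have "(LINT x|lebesgue_on B. norm (S n x)) = (\<Sum>ks | length ks \<le> 2. LINT x|lebesgue_on B. \<bar>wderiv B ks (w n) x - wderiv B ks u x\<bar>)" for n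
  proof -
    have "(LINT x|lebesgue_on B. norm (S n x)) = (LINT x|lebesgue_on B. S n x)" using S0 by simp
    also have "\<dots> = (\<Sum>ks | length ks \<le> 2. LINT x|lebesgue_on B. \<bar>wderiv B ks (w n) x - wderiv B ks u x\<bar>)"
      unfolding S_def using di by (intro Bochner_Integration.integral_sum integrable_abs) auto
    finally show ?thesis .
  qed
  moreover have "(\<lambda>n. \<Sum>ks | length ks \<le> 2. LINT x|lebesgue_on B. \<bar>wderiv B ks (w n) x - wderiv B ks u x\<bar>) \<longlonglongrightarrow> (\<Sum>ks :: 'n list | length ks \<le> 2. 0)"
    by (intro tendsto_sum L1_tendsto_0_if_p_norm_tendsto_0[OF B_finite p_pos(3) d conv]) auto
  ultimately have "(\<lambda>n. LINT x|lebesgue_on B. norm (S n x)) \<longlonglongrightarrow> 0" by simp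
  from tendsto_L1_AE_subseq[OF Si this] obtain r where r: "strict_mono r"
    and rl: "AE x in lebesgue_on B. (\<lambda>n. S (r n) x) \<longlonglongrightarrow> 0" by blast
  have Hw: "AE x in lebesgue_on B. \<forall>n. weak_hessian B (w n) x \<in> sym_matrices \<and> nonneg_definite (weak_hessian B (w n) x)"
    unfolding AE_all_countable using admissible_hessian[OF w] by blast
  have w0: "AE x in lebesgue_on B. \<forall>n. wderiv B [] (w n) x = w n x"
    unfolding AE_all_countable using wderiv_Nil[OF open_B admissible_sobolev[OF w]] by blast
  have dl: "AE x in lebesgue_on B. (\<lambda>n. density (w (r n)) x) \<longlonglongrightarrow> density u x"
    using rl Hw w0 wderiv_Nil[OF open_B admissible_sobolev[OF u]] admissible_hessian[OF u]
  proof eventually_elim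
    case (elim x)
    have ks: "(\<lambda>n. wderiv B ks (w (r n)) x) \<longlonglongrightarrow> wderiv B ks u x" if "length ks \<le> 2" for ks
    proof -
      have "\<bar>wderiv B ks (w n) x - wderiv B ks u x\<bar> \<le> S n x" for n
        unfolding S_def using that by (intro member_le_sum finite_multi_indices) auto
      then have "(\<lambda>n. wderiv B ks (w (r n)) x - wderiv B ks u x) \<longlonglongrightarrow> 0"
        by (intro Lim_null_comparison[OF _ elim(1)] always_eventually) auto
      then show ?thesis by (rule LIM_zero_cancel)
    qed
    have ul: "(\<lambda>n. w (r n) x) \<longlonglongrightarrow> u x" using ks[of "[]"] elim(3,4) by simp
    have "(\<lambda>n. weak_hessian B (w (r n)) x) \<longlonglongrightarrow> weak_hessian B u x"
      by (intro vec_tendstoI) (simp add: weak_hessian_def ks)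
    then have "(\<lambda>n. F (weak_hessian B (w (r n)) x)) \<longlonglongrightarrow> F (weak_hessian B u x)"
      using elim(2,5) by (intro continuous_on_tendsto_compose[OF F_continuous]) auto
    moreover have "0 \<le> F (weak_hessian B (w (r n)) x)" for n using elim(2) F_nonneg by blast
    ultimately have "(\<lambda>n. F (weak_hessian B (w (r n)) x) powr p) \<longlonglongrightarrow> F (weak_hessian B u x) powr p"
      using p by (intro tendsto_powr' tendsto_const) auto
    then show ?case unfolding density_def
      by (intro tendsto_diff tendsto_add tendsto_mult tendsto_max tendsto_min tendsto_const ul)
  qed
  have "integrable (lebesgue_on B) (density u) \<and> (LINT x|lebesgue_on B. density u x) \<le> m"
  proof (rule fatou_real[OF _ _ dl density_measurable[OF u]])
    show "integrable (lebesgue_on B) (density (w (r n)))" for n by (rule density_integrable[OF w])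
    show "AE x in lebesgue_on B. 0 \<le> density (w (r n)) x" for n using density_nonneg by simp
    show "(LINT x|lebesgue_on B. density (w (r n)) x) \<le> c (r n)" for n using le[of "r n"] by (simp add: energy_density)
    show "(\<lambda>n. c (r n)) \<longlonglongrightarrow> m" using LIMSEQ_subseq_LIMSEQ[OF c r] by (simp add: o_def)
  qed
  then show ?thesis by (simp add: energy_density)
qed

end

section \<open>Existence of a minimizer\<close>

context convex_energy
begin

text \<open>The scalar uniform convexity inequality, integrated over the ball and summed over the
  entries.\<close>

lemma hessian_energy_diff:
  assumes u: "u \<in> admissible p g" and w: "w \<in> admissible p g"
    and C: "\<And>a b :: real. \<bar>a - b\<bar> powr p \<le> \<epsilon> * (\<bar>a\<bar> powr p + \<bar>b\<bar> powr p)
      + C * ((\<bar>a\<bar> powr p + \<bar>b\<bar> powr p) / 2 - \<bar>(a + b) / 2\<bar> powr p)"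
  shows "hessian_energy (\<lambda>x. u x - w x) \<le> \<epsilon> * (hessian_energy u + hessian_energy w)
      + C * ((hessian_energy u + hessian_energy w) / 2 - hessian_energy (\<lambda>x. 1 / 2 * u x + 1 / 2 * w x))"
proof -
  let ?d = "deriv_energy B p" and ?m = "\<lambda>x. 1 / 2 * u x + 1 / 2 * w x"
  note su = admissible_sobolev[OF u] and sw = admissible_sobolev[OF w]
  have "?d [i, j] (\<lambda>x. u x - w x) \<le> \<epsilon> * (?d [i, j] u + ?d [i, j] w) + C * ((?d [i, j] u + ?d [i, j] w) / 2 - ?d [i, j] ?m)" for i j
  proof -
    have ks: "length [i, j] \<le> 2" by simp
    let ?U = "wderiv B [i, j] u" and ?W = "wderiv B [i, j] w"
    note U = sobolev_wderiv(2)[OF open_B su ks] and W = sobolev_wderiv(2)[OF open_B sw ks]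
    have D: "p_integrable (lebesgue_on B) p (\<lambda>x. ?U x - ?W x)"
      by (rule p_integrable_diff[OF p_pos(2) U W])
    have M: "p_integrable (lebesgue_on B) p (\<lambda>x. (?U x + ?W x) / 2)"
      using p_integrable_lincomb[OF p_pos(2) U W, of "1 / 2" "1 / 2"] by (simp add: add_divide_distrib)
    have i: "integrable (lebesgue_on B) (\<lambda>x. \<bar>?U x\<bar> powr p)" "integrable (lebesgue_on B) (\<lambda>x. \<bar>?W x\<bar> powr p)"
      "integrable (lebesgue_on B) (\<lambda>x. \<bar>?U x - ?W x\<bar> powr p)" "integrable (lebesgue_on B) (\<lambda>x. \<bar>(?U x + ?W x) / 2\<bar> powr p)"
      using U W D M unfolding p_integrable_def by blast+
    have "?d [i, j] (\<lambda>x. u x - w x) = (LINT x|lebesgue_on B. \<bar>?U x - ?W x\<bar> powr p)"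
      using deriv_energy_lincomb(1)[where a = 1 and b = "-1", OF open_B p_pos(2) su sw ks] by simp
    also have "\<dots> \<le> (LINT x|lebesgue_on B. \<epsilon> * (\<bar>?U x\<bar> powr p + \<bar>?W x\<bar> powr p)
       + C * ((\<bar>?U x\<bar> powr p + \<bar>?W x\<bar> powr p) / 2 - \<bar>(?U x + ?W x) / 2\<bar> powr p))"
      using i C by (intro integral_mono Bochner_Integration.integrable_add Bochner_Integration.integrable_diff integrable_mult_right integrable_divide)
    also have "\<dots> = \<epsilon> * (?d [i, j] u + ?d [i, j] w) + C * ((?d [i, j] u + ?d [i, j] w) / 2 - (LINT x|lebesgue_on B. \<bar>(?U x + ?W x) / 2\<bar> powr p))"
      using i unfolding deriv_energy_def
      by (simp only: Bochner_Integration.integral_add Bochner_Integration.integral_diff integral_mult_right_zero integral_divide_zero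
          Bochner_Integration.integrable_add Bochner_Integration.integrable_diff integrable_mult_right integrable_divide)
    also have "(LINT x|lebesgue_on B. \<bar>(?U x + ?W x) / 2\<bar> powr p) = ?d [i, j] ?m"
    proof -
      have "1 / 2 * a + 1 / 2 * b = (a + b) / 2" for a b :: real by (simp add: add_divide_distrib)
      then show ?thesis
        using deriv_energy_lincomb(1)[where a = "1 / 2" and b = "1 / 2", OF open_B p_pos(2) su sw ks] by (simp only:)
    qed
    finally show ?thesis .
  qed
  then have "hessian_energy (\<lambda>x. u x - w x) \<le> (\<Sum>i\<in>UNIV. \<Sum>j\<in>UNIV. \<epsilon> * (?d [i, j] u + ?d [i, j] w) + C * ((?d [i, j] u + ?d [i, j] w) / 2 - ?d [i, j] ?m))"
    unfolding hessian_energy_def by (intro sum_mono)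
  also have "\<dots> = \<epsilon> * (hessian_energy u + hessian_energy w) + C * ((hessian_energy u + hessian_energy w) / 2 - hessian_energy ?m)"
    unfolding hessian_energy_def
    by (simp only: sum.distrib sum_subtractf sum_distrib_left[symmetric] sum_divide_distrib[symmetric])
  finally show ?thesis .
qed

text \<open>Differences of admissible functions satisfy the second order bound, so smallness of
  Hessian differences gives a Cauchy sequence in all derivatives up to order two. The limit is then
  exchanged for a convex representative, and closedness of the space with zero boundary values keeps
  the boundary condition.\<close>

lemma second_derivatives_converge:
  assumes w: "\<And>n. w n \<in> admissible p g"
    and cauchy: "\<And>e. 0 < e \<Longrightarrow> \<exists>N. \<forall>i\<ge>N. \<forall>j\<ge>N. hessian_energy (\<lambda>x. w i x - w j x) < e"
  obtains u where "u \<in> admissible p g" "\<And>ks. length ks \<le> 2 \<Longrightarrow>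
    (\<lambda>n. LINT x|lebesgue_on B. \<bar>wderiv B ks (w n) x - wderiv B ks u x\<bar> powr p) \<longlonglongrightarrow> 0"
proof -
  obtain C where C: "0 \<le> C" "\<And>v ks. v \<in> sobolev B 2 p \<Longrightarrow> v \<in> sobolev0 B 1 p \<Longrightarrow> length ks \<le> 2 \<Longrightarrow>
    deriv_energy B p ks v \<le> C * (\<Sum>i\<in>UNIV. \<Sum>j\<in>UNIV. deriv_energy B p [i, j] v)"
    using sobolev0_second_order_bound[OF p] by blast
  have sw: "w n \<in> sobolev B 2 p" for n by (rule admissible_sobolev[OF w])
  have ca: "\<exists>N. \<forall>i\<ge>N. \<forall>j\<ge>N. deriv_energy B p ks (\<lambda>x. w i x - w j x) < e" if ks: "length ks \<le> 2" and e: "0 < e" for ks e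
  proof -
    \<comment> \<open>Dividing by \<open>C + 1\<close> covers the case C = 0.\<close>
    have "0 < e / (C + 1)" using e C(1) by simp
    then obtain N where N: "\<forall>i\<ge>N. \<forall>j\<ge>N. hessian_energy (\<lambda>x. w i x - w j x) < e / (C + 1)" using cauchy by blast
    have "deriv_energy B p ks (\<lambda>x. w i x - w j x) < e" if "i \<ge> N" "j \<ge> N" for i j
    proof -
      have "deriv_energy B p ks (\<lambda>x. w i x - w j x) \<le> C * hessian_energy (\<lambda>x. w i x - w j x)"
        unfolding hessian_energy_def by (rule C(2)[OF admissible_diff[OF w w] ks])
      also have "\<dots> \<le> (C + 1) * hessian_energy (\<lambda>x. w i x - w j x)"
        by (intro mult_right_mono hessian_energy_nonneg) simp
      also have "\<dots> < (C + 1) * (e / (C + 1))"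
        using N that C(1) by (intro mult_strict_left_mono) auto
      also have "\<dots> = e" using C(1) by (simp add: add_nonneg_eq_0_iff)
      finally show ?thesis .
    qed
    then show ?thesis by blast
  qed
  obtain U where U: "U \<in> sobolev B 2 p" "\<And>ks. length ks \<le> 2 \<Longrightarrow>
    (\<lambda>n. LINT x|lebesgue_on B. \<bar>wderiv B ks (w n) x - wderiv B ks U x\<bar> powr p) \<longlonglongrightarrow> 0"
    using sobolev_complete[OF open_B lmeasurable_ball p_pos(3) sw ca] by blast
  have pd: "p_integrable (lebesgue_on B) p (\<lambda>x. wderiv B [] (w n) x - wderiv B [] U x)" for n
    by (rule p_integrable_diff[OF p_pos(2) sobolev_wderiv(2)[OF open_B sw] sobolev_wderiv(2)[OF open_B U(1)]]) simp_all
  have "(\<lambda>n. LINT x|lebesgue_on B. norm (wderiv B [] (w n) x - wderiv B [] U x)) \<longlonglongrightarrow> 0"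
    unfolding real_norm_def
    by (rule L1_tendsto_0_if_p_norm_tendsto_0[OF B_finite p_pos(3) pd U(2)]) simp
  from tendsto_L1_AE_subseq[OF p_integrable_imp_integrable[OF B_finite p_pos(3) pd] this]
  obtain r :: "nat \<Rightarrow> nat" where r: "AE x in lebesgue_on B. (\<lambda>n. wderiv B [] (w (r n)) x - wderiv B [] U x) \<longlonglongrightarrow> 0" by blast
  have w0: "AE x in lebesgue_on B. \<forall>n. wderiv B [] (w n) x = w n x"
    unfolding AE_all_countable using wderiv_Nil[OF open_B sw] by blast
  have "AE x in lebesgue_on B. (\<lambda>n. w (r n) x) \<longlonglongrightarrow> U x"
    using r w0 wderiv_Nil[OF open_B U(1)]
  proof eventually_elim
    case (elim x)
    then show ?case using LIM_zero_cancel[of "\<lambda>n. w (r n) x" "U x"] by simp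
  qed
  moreover have "convex_on B (w (r n))" for n using w by (simp add: admissible_def)
  ultimately obtain u where u: "convex_on B u" "AE x in lebesgue_on B. U x = u x"
    using convex_AE_limit[OF open_B convex_ball, of "\<lambda>n. w (r n)" U] by blast
  have su: "u \<in> sobolev B 2 p" by (rule sobolev_cong_AE(1)[OF open_B U(1) u(2)])
  have lim: "(\<lambda>n. LINT x|lebesgue_on B. \<bar>wderiv B ks (w n) x - wderiv B ks u x\<bar> powr p) \<longlonglongrightarrow> 0" if ks: "length ks \<le> 2" for ks
  proof -
    have "(LINT x|lebesgue_on B. \<bar>wderiv B ks (w n) x - wderiv B ks u x\<bar> powr p) = (LINT x|lebesgue_on B. \<bar>wderiv B ks (w n) x - wderiv B ks U x\<bar> powr p)" for n
    proof (rule p_integral_cong_AE)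
      show "(\<lambda>x. wderiv B ks (w n) x - wderiv B ks u x) \<in> borel_measurable (lebesgue_on B)"
        "(\<lambda>x. wderiv B ks (w n) x - wderiv B ks U x) \<in> borel_measurable (lebesgue_on B)"
        using p_integrable_diff[OF p_pos(2) sobolev_wderiv(2)[OF open_B sw ks] sobolev_wderiv(2)[OF open_B su ks]]
          p_integrable_diff[OF p_pos(2) sobolev_wderiv(2)[OF open_B sw ks] sobolev_wderiv(2)[OF open_B U(1) ks]]
        unfolding p_integrable_def by blast+
      show "AE x in lebesgue_on B. wderiv B ks (w n) x - wderiv B ks u x = wderiv B ks (w n) x - wderiv B ks U x"
        using sobolev_cong_AE(2)[OF open_B U(1) u(2) ks] by eventually_elim simp
    qed
    then show ?thesis using U(2)[OF ks] by simp
  qed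
  have "(\<lambda>x. u x - g x) \<in> sobolev0 B 1 p"
  proof (rule sobolev0_limit[OF open_B p_pos(1)])
    have "(\<lambda>x. u x - g x) \<in> sobolev B 2 p"
      using sobolev_lincomb[where a = 1 and b = "-1", OF open_B p_pos(2) su g_sobolev] by simp
    then show "(\<lambda>x. u x - g x) \<in> sobolev B 1 p" by (rule sobolev_mono) simp
    show "(\<lambda>x. w n x - g x) \<in> sobolev0 B 1 p" for n using w by (simp add: admissible_def)
    have "sobolev_energy B 1 p (\<lambda>x. (u x - g x) - (w n x - g x))
      = (\<Sum>ks | length ks \<le> 1. LINT x|lebesgue_on B. \<bar>wderiv B ks (w n) x - wderiv B ks u x\<bar> powr p)" for n
      unfolding sobolev_energy_def
    proof (rule sum.cong[OF refl])
      fix ks :: "'n list" assume "ks \<in> {ks. length ks \<le> 1}"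
      then have ks: "length ks \<le> 2" by simp
      show "deriv_energy B p ks (\<lambda>x. (u x - g x) - (w n x - g x)) = (LINT x|lebesgue_on B. \<bar>wderiv B ks (w n) x - wderiv B ks u x\<bar> powr p)"
        using deriv_energy_lincomb(1)[where a = 1 and b = "-1", OF open_B p_pos(2) su sw[of n] ks]
        by (simp add: abs_minus_commute)
    qed
    moreover have "(\<lambda>n. \<Sum>ks | length ks \<le> 1. LINT x|lebesgue_on B. \<bar>wderiv B ks (w n) x - wderiv B ks u x\<bar> powr p) \<longlonglongrightarrow> (\<Sum>ks :: 'n list | length ks \<le> 1. 0)"
      by (intro tendsto_sum lim) auto
    ultimately show "(\<lambda>n. sobolev_energy B 1 p (\<lambda>x. (u x - g x) - (w n x - g x))) \<longlonglongrightarrow> 0" by simp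
  qed
  then have "u \<in> admissible p g" using su u(1) by (simp add: admissible_def)
  with lim that show ?thesis by blast
qed

theorem minimizer_exists: "\<exists>u\<in>admissible p g. \<forall>v\<in>admissible p g. E u \<le> E v"
proof -
  define m where "m = Inf (E ` admissible p g)"
  have bdd: "bdd_below (E ` admissible p g)" by (rule bdd_belowI2[of _ 0]) (rule energy_nonneg)
  have ne: "E ` admissible p g \<noteq> {}" using g_admissible by blast
  have m_le: "m \<le> E v" if "v \<in> admissible p g" for v
    unfolding m_def by (rule cInf_lower[OF _ bdd]) (use that in blast)
  have m0: "0 \<le> m" unfolding m_def by (rule cInf_greatest[OF ne]) (use energy_nonneg in blast)
  define t where "t n = inverse (real (Suc n))" for n
  have t: "0 < t n" "t n \<le> 1" for n by (auto simp: t_def inverse_le_1_iff)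
  have t_mono: "t k \<le> t n" if "n \<le> k" for n k
    unfolding t_def using that by (intro le_imp_inverse_le) auto
  have t0: "t \<longlonglongrightarrow> 0" unfolding t_def by (rule LIMSEQ_inverse_real_of_nat)
  \<comment> \<open>Sublevel sets of the energy, decreasing in \<open>n\<close> and closed under
    midpoints because the energy is midpoint convex.\<close>
  define A where "A n = {u \<in> admissible p g. E u \<le> m + t n}" for n
  have A_ne: "A n \<noteq> {}" for n
  proof -
    have "m < m + t n" using t by simp
    then obtain v where "v \<in> admissible p g" "E v < m + t n"
      using cInf_lessD[OF ne, folded m_def] by blast
    then show ?thesis by (auto simp: A_def intro: less_imp_le)
  qed
  have A_mono: "A k \<subseteq> A n" if "n \<le> k" for n k using t_mono[OF that] by (auto simp: A_def)
  have A_mid: "(\<lambda>x. 1 / 2 * u x + 1 / 2 * w x) \<in> A n" if "u \<in> A n" "w \<in> A n" for u w n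
    using that admissible_midpoint[of u w] energy_midpoint[of u w] by (auto simp: A_def)
  obtain K where K: "0 \<le> K" "\<And>u. u \<in> admissible p g \<Longrightarrow> hessian_energy u \<le> K * E u"
    using energy_coercive by blast
  \<comment> \<open>Smaller sets have larger infima, so \<open>d\<close> increases. Coercivity
    bounds it, since the energies in \<open>A n\<close> are at most m + 1; hence it
    converges.\<close>
  define d where "d n = Inf (hessian_energy ` A n)" for n
  have bddA: "bdd_below (hessian_energy ` A n)" for n
    by (rule bdd_belowI2[of _ 0]) (rule hessian_energy_nonneg)
  have d_le: "d n \<le> hessian_energy u" if "u \<in> A n" for u n
    unfolding d_def by (rule cInf_lower[OF _ bddA]) (use that in blast)
  have "\<exists>u. u \<in> A n \<and> hessian_energy u < d n + t n" for n
  proof -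
    have "d n < d n + t n" using t by simp
    then show ?thesis using cInf_lessD[of "hessian_energy ` A n", folded d_def] A_ne by blast
  qed
  \<comment> \<open>\<open>w n\<close> is almost optimal in two ways: its energy is within
    \<open>t n\<close> of \<open>m\<close>, and its Hessian energy is within \<open>t n\<close> of
    the least value in \<open>A n\<close>.\<close>
  then obtain w where w: "\<And>n. w n \<in> A n" "\<And>n. hessian_energy (w n) < d n + t n" by metis
  have adm: "w n \<in> admissible p g" for n using w(1)[of n] by (simp add: A_def)
  have d_mono: "d n \<le> d k" if "n \<le> k" for n k
  proof -
    have "hessian_energy ` A k \<noteq> {}" using A_ne by blast
    then show ?thesis unfolding d_def[of k]
      by (rule cInf_greatest) (use d_le A_mono[OF that] in blast)
  qed
  have d_bound: "d n \<le> K * (m + 1)" for n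
  proof -
    have "d n \<le> K * E (w n)" using order_trans[OF d_le[OF w(1)] K(2)[OF adm]] .
    also have "\<dots> \<le> K * (m + 1)" using w(1)[of n] t(2)[of n] K(1) by (intro mult_left_mono) (auto simp: A_def)
    finally show ?thesis .
  qed
  have "norm (d n) \<le> \<bar>d 0\<bar> + \<bar>K * (m + 1)\<bar>" for n
    using d_mono[of 0 n] d_bound[of n] by simp
  then have "Bseq d" by (rule BseqI')
  then obtain D where D: "d \<longlonglongrightarrow> D" using d_mono by (meson Bseq_mono_convergent convergent_def)
  have dD: "d n \<le> D" for n using D d_mono by (intro incseq_le[OF _ D]) (simp add: incseq_def)
  have D0: "0 \<le> D + 1"
  proof -
    have "0 \<le> d 0" unfolding d_def using A_ne by (intro cInf_greatest) (auto intro: hessian_energy_nonneg)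
    then show ?thesis using dD[of 0] by simp
  qed
  have average: "(a + b) / 2 - c \<le> x + y - z" if "z \<le> c" "a \<le> x + y" "b \<le> x + y" for a b c x y z :: real
    using add_mono[OF that(2,3)] that(1) by (simp add: field_simps)
  have hc: "\<exists>N. \<forall>i\<ge>N. \<forall>j\<ge>N. hessian_energy (\<lambda>x. w i x - w j x) < e" if e: "0 < e" for e
  proof -
    \<comment> \<open>Hessian energies of the chosen functions are at most D + 1, so the first term
      of the convexity estimate is at most \<epsilon> * 2 (D + 1). This choice puts it strictly
      below e / 2, the extra 1 in the denominator giving strictness.\<close>
    define \<epsilon> where "\<epsilon> = e / (4 * (D + 1) + 1)"
    have \<epsilon>: "0 < \<epsilon>" using e D0 by (simp add: \<epsilon>_def)
    have \<epsilon>2: "\<epsilon> * (2 * (D + 1)) < e / 2"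
    proof -
      have "e = \<epsilon> * (4 * (D + 1) + 1)" unfolding \<epsilon>_def using D0 by simp
      also have "\<dots> = 2 * (\<epsilon> * (2 * (D + 1))) + \<epsilon>" by (simp add: algebra_simps)
      finally show ?thesis using \<epsilon> by linarith
    qed
    obtain C where C: "0 < C" "\<And>a b :: real. \<bar>a - b\<bar> powr p \<le> \<epsilon> * (\<bar>a\<bar> powr p + \<bar>b\<bar> powr p)
      + C * ((\<bar>a\<bar> powr p + \<bar>b\<bar> powr p) / 2 - \<bar>(a + b) / 2\<bar> powr p)"
      using abs_powr_uniform_convexity[OF p \<epsilon>] by blast
    \<comment> \<open>The gap between the upper bound \<open>D + t n\<close> for the Hessian
      energies and the lower bound \<open>d n\<close> for midpoints tends to zero, so it can absorb
      the constant \<open>C\<close>.\<close>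
    have "(\<lambda>n. C * (D + t n - d n)) \<longlonglongrightarrow> C * (D + 0 - D)"
      by (intro tendsto_mult tendsto_diff tendsto_add tendsto_const t0 D)
    then have "eventually (\<lambda>n. C * (D + t n - d n) < e / 2) sequentially"
      by (rule order_tendstoD) (use e in simp)
    then obtain N where N: "C * (D + t N - d N) < e / 2" by (meson eventually_sequentially order_refl)
    have "hessian_energy (\<lambda>x. w i x - w j x) < e" if ij: "i \<ge> N" "j \<ge> N" for i j
    proof -
      let ?h = "hessian_energy (w i)" and ?k = "hessian_energy (w j)"
      have h: "?h \<le> D + t N" "?k \<le> D + t N"
        using w(2)[of i] w(2)[of j] dD[of i] dD[of j] t_mono[OF ij(1)] t_mono[OF ij(2)] by linarith+
      \<comment> \<open>Both functions belong to \<open>A N\<close>, hence so does their midpoint,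
        whose Hessian energy cannot fall below \<open>d N\<close>. This is what bounds the convexity
        defect from above.\<close>
      have "d N \<le> hessian_energy (\<lambda>x. 1 / 2 * w i x + 1 / 2 * w j x)"
        using A_mid[of "w i" N "w j"] A_mono[OF ij(1)] A_mono[OF ij(2)] w(1) d_le by blast
      then have "(?h + ?k) / 2 - hessian_energy (\<lambda>x. 1 / 2 * w i x + 1 / 2 * w j x) \<le> D + t N - d N"
        by (rule average[OF _ h])
      then have "C * ((?h + ?k) / 2 - hessian_energy (\<lambda>x. 1 / 2 * w i x + 1 / 2 * w j x)) \<le> C * (D + t N - d N)"
        using C(1) by (intro mult_left_mono) auto
      moreover have "\<epsilon> * (?h + ?k) \<le> \<epsilon> * (2 * (D + 1))"
        using \<epsilon> h t(2)[of N] by (intro mult_left_mono) auto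
      ultimately show ?thesis
        using hessian_energy_diff[OF adm adm C(2), of i j] N \<epsilon>2 by linarith
    qed
    then show ?thesis by blast
  qed
  obtain u where u: "u \<in> admissible p g" "\<And>ks. length ks \<le> 2 \<Longrightarrow>
    (\<lambda>n. LINT x|lebesgue_on B. \<bar>wderiv B ks (w n) x - wderiv B ks u x\<bar> powr p) \<longlonglongrightarrow> 0"
    using second_derivatives_converge[OF adm hc] by blast
  have "E u \<le> m"
  proof (rule energy_lower_semicontinuous[OF adm u])
    show "E (w n) \<le> m + t n" for n using w(1)[of n] by (simp add: A_def)
    show "(\<lambda>n. m + t n) \<longlonglongrightarrow> m" using tendsto_add[OF tendsto_const t0, of m] by simp
  qed
  then show ?thesis using u(1) m_le order_trans by blast
qed

end

theorem proposition2:
  fixes F :: "real ^ 'n ^ 'n \<Rightarrow> real"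
    and nrm :: "real ^ 'n ^ 'n \<Rightarrow> real"
    and g :: "real ^ 'n \<Rightarrow> real"
    and p gam_pos gam_neg lam Lam :: real
  assumes "1 < p" and "real CARD('n) / 2 < p" and "p \<le> real CARD('n)"
    and "0 \<le> gam_pos" and "0 \<le> gam_neg" and "0 < gam_pos + gam_neg"
    and "0 < lam" and "lam \<le> Lam"
    and "norm_on_sym_matrices nrm"
    and "convex_on sym_matrices F" and "F 0 = 0"
    and "\<And>M N. M \<in> sym_matrices \<Longrightarrow> N \<in> sym_matrices \<Longrightarrow> nonneg_definite N \<Longrightarrow>
           lam * nrm N \<le> F (M + N) - F M \<and> F (M + N) - F M \<le> Lam * nrm N"
    and "g \<in> sobolev (ball 0 1) 2 p"
    and "convex_on (ball 0 1) g"
    and "\<exists>x \<in> ball 0 1. g x \<noteq> 0"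
  shows "\<exists>u_min \<in> admissible p g. \<forall>u \<in> admissible p g.
           energy F p gam_pos gam_neg u_min \<le> energy F p gam_pos gam_neg u"
proof -
  interpret convex_energy F nrm lam Lam p gam_pos gam_neg g
    using assms by unfold_locales blast+
  show ?thesis by (rule minimizer_exists)
qed

end
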